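(* Fix $\rho\in\mathbb{N}$, a multi-index $\iota\in\mathbb{N}_0^D$, and $Q\in\mathbb{N}$ with $Q\geq |\iota|_1+\rho$, and let $y\in\mathcal{C}^{Q+1}_b(\mathbb{R}^D)$. Let $c_{\mathrm{cube}},c_{1,\mathrm{trunc}},c_{2,\mathrm{trunc}}>0$ be arbitrary, and let $c_{2,\mathrm{paths}}>0$ and $$c_{1,\mathrm{paths}}>c^*_{\mathrm{paths}}(Q,D):=\frac23+\frac83\sum_{\mathbf j\in\mathbb{N}_0^D,\ |\mathbf j|_1\le Q}\ \prod_{d=1}^D(2j_d+1).$$ For $\Delta>0$ compute $\hat z$ by Algorithm 1 (described in the context) with input $y,Q,\Delta,\iota$, the constants $c_{\mathrm{cube}},c_{1,\mathrm{trunc}},c_{2,\mathrm{trunc}}$, and $$\gamma_{\mathrm{cube}}=\frac{\rho+|\iota|_1}{2(Q+1)},\quad \gamma_{1,\mathrm{trunc}}=\rho,\quad \gamma_{2,\mathrm{trunc}}=1.5(|\iota|_1+\rho),\quad L=L_\Delta=\lceil \rho\, c_{1,\mathrm{paths}}\log(c_{2,\mathrm{paths}}\Delta^{-1})\rceil,$$ $$\tau\in\Big(0,\ 1-\big(c^*_{\mathrm{paths}}(Q,D)/c_{1,\mathrm{paths}}\big)^{1/2}\Big).$$ Then there are constants $C>0$ and $\Delta_0>0$ (depending on all constants of the setting, including $D,Q,|\iota|_1,\tau$, the constants in the standing assumptions, and the $\mathcal{C}^{Q+1}_b$-norm of $y$, but not on $\Delta$) such that for every $\Delta\le\Delta_0$,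 $$E\Big[\int_{\mathbb{R}^D}\big|E[\mathcal{H}_{\iota,\Delta}(\xi)\,y(X_2)\mid X_1=x]-\hat z(x)\big|^2\,\mu_1(dx)\Big]\le C\log(\Delta^{-1})^{D/2}\Delta^{\rho},$$ where the outer expectation is over the random samples used in Algorithm 1.
   Context: Standing setting. $D\in\mathbb{N}$. $X_1$ is an $\mathbb{R}^D$-valued random variable with law $\mu_1$ having a Lebesgue density $f$ satisfying $f(x)\le \frac{C_{1,f}}{(2\pi C_{2,f})^{D/2}}\exp\{-|x|_2^2/(2C_{2,f})\}$ for all $x$, for constants $C_{1,f},C_{2,f}>0$. $b:\mathbb{R}^D\to\mathbb{R}^D$ and $\sigma:\mathbb{R}^D\to\mathbb{R}^{D\times D}$ are measurable with $\sup_u(|b(u)|_2+\|\sigma(u)\|_2)\le C_{b,\sigma}<\infty$ ($\|\cdot\|_2$ the spectral norm). $\xi$ is a $D$-dimensional standard normal vector independent of $X_1$, and $X_2=X_1+b(X_1)\Delta+\sigma(X_1)\sqrt\Delta\,\xi$. $\mathcal{C}^{Q}_b(\mathbb{R}^D)$ denotes bounded $Q$-times continuously differentiable functions with bounded derivatives. Hermite polynomials: $\mathcal{H}_q(x)=(-1)^qe^{x^2/2}\frac{d^q}{dx^q}e^{-x^2/2}$; for $\iota\in\mathbb{N}_0^D$, $|\iota|_1=\sum_d\iota_d$ and $\mathcal{H}_{\iota,\Delta}(x)=\Delta^{-|\iota|_1/2}\prod_{d=1}^D\mathcal{H}_{\iota_d}(x_d)$. For $x\in\mathbb{R}^D$,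 $r>0$, $[x]_r$ is the componentwise truncation $[x_d]_r=\max(\min(x_d,r),-r)$. $\chi^2_D(\alpha)$ is the $(1-\alpha)$-quantile of the $\chi^2$ distribution with $D$ degrees of freedom. Algorithm 1 (input $y$, $L,Q\in\mathbb{N}$, $\Delta>0$, $\iota$, $\tau\in(0,1)$, $\gamma_{\mathrm{cube}}\in(0,1/2)$, $c_{\mathrm{cube}},c_{1,\mathrm{trunc}},c_{2,\mathrm{trunc}},\gamma_{1,\mathrm{trunc}},\gamma_{2,\mathrm{trunc}}>0$). Step 1: $h=c_{\mathrm{cube}}\Delta^{\gamma_{\mathrm{cube}}}$, $r_1=\sqrt{C_{2,f}\chi^2_D(c_{1,\mathrm{trunc}}\Delta^{\gamma_{1,\mathrm{trunc}}})}$; for $\mathbf i\in\mathbb{Z}^D$, $\Gamma_{\mathbf i}=\prod_{d}(hi_d,h(i_d+1)]$ with center $a_{\mathbf i}$; $I=\{\mathbf i:\Gamma_{\mathbf i}\cap\{|x|_2\le r_1\}\neq\emptyset\}$. Step 2: $\mathcal{L}_q$ is the Legendre polynomial of degree $q$ normalized by $\mathcal{L}_q(1)=1$; $p_{\mathbf j}(x)=\prod_{d=1}^D\sqrt{2j_d+1}\,\mathcal{L}_{j_d}(x_d)$; $K=\binom{D+Q}{D}$; for $\mathbf i\in I$, $\eta_{\mathbf i,1},\dots,\eta_{\mathbf i,K}$ is a fixed ordering of $x\mapsto p_{\mathbf j}((x-a_{\mathbf i})/(h/2))$, $|\mathbf j|_1\le Q$. Step 3: for each $\mathbf i\in I$ draw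 samples $(U_{\mathbf i,l},\xi_{\mathbf i,l})_{l=1}^L$, all mutually independent (also across $\mathbf i$), $U_{\mathbf i,l}$ uniform on $\Gamma_{\mathbf i}$, $\xi_{\mathbf i,l}$ $D$-dim standard normal. Let $r_2=\sqrt{2\log(c_{2,\mathrm{trunc}}\Delta^{-\gamma_{2,\mathrm{trunc}}}\log(\Delta^{-1}))}$, $X_{\mathbf i,l}=U_{\mathbf i,l}+b(U_{\mathbf i,l})\Delta+\sigma(U_{\mathbf i,l})\sqrt\Delta[\xi_{\mathbf i,l}]_{r_2}$, and the $L\times K$ matrix $A_{\mathbf i}=(\eta_{\mathbf i,k}(X_{\mathbf i,l}))_{l,k}$. Step 4: let $s_K$ be the smallest of the $K$ singular values of $A_{\mathbf i}$. If $s_K^2\ge\tau L$, set $\alpha_{L,\mathbf i}=A_{\mathbf i}^{+}(y(X_{\mathbf i,1}),\dots,y(X_{\mathbf i,L}))^\top$ ($A^+$ the Moore–Penrose pseudoinverse, i.e. the least-squares coefficient vector); otherwise $\alpha_{L,\mathbf i}=0\in\mathbb{R}^K$. Step 5: output $\hat z(x)=\sum_{\mathbf i\in I}\mathbf 1_{\Gamma_{\mathbf i}}(x)\sum_{k=1}^K\alpha_{L,\mathbf i,k}\,E\big[\eta_{\mathbf i,k}(x+b(x)\Delta+\sigma(x)\sqrt\Delta[\xi]_{r_2})\mathcal{H}_{\iota,\Delta}([\xi]_{r_2})\big]$, the expectation taken only over a standard normal $\xi$ independent of the samples. *)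

theory Defs
  imports "HOL-Probability.Probability"
begin

definition hermite :: "nat \<Rightarrow> real \<Rightarrow> real" where
  "hermite q x = (-1) ^ q * exp (x\<^sup>2 / 2) * (deriv ^^ q) (\<lambda>t. exp (- (t\<^sup>2) / 2)) x"

definition l1 :: "('d::finite \<Rightarrow> nat) \<Rightarrow> nat" where
  "l1 j = (\<Sum>d\<in>UNIV. j d)"

definition hermite_multi :: "real \<Rightarrow> ('d::finite \<Rightarrow> nat) \<Rightarrow> real^'d \<Rightarrow> real" where
  "hermite_multi \<Delta> \<iota> x = \<Delta> powr (- real (l1 \<iota>) / 2) * (\<Prod>d\<in>UNIV. hermite (\<iota> d) (x $ d))"

text \<open>Legendre polynomials normalised by L_q(1) = 1 (Rodrigues' formula).\<close>
definition legendre :: "nat \<Rightarrow> real \<Rightarrow> real" where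
  "legendre q x = (deriv ^^ q) (\<lambda>t. (t\<^sup>2 - 1) ^ q) x / (2 ^ q * fact q)"

definition std_normal_vec :: "(real^'d::finite) measure" where
  "std_normal_vec = density lborel (\<lambda>x. ennreal (\<Prod>d\<in>UNIV. std_normal_density (x $ d)))"

definition chi2_cdf :: "nat \<Rightarrow> real \<Rightarrow> real" where
  "chi2_cdf D t = measure (PiM {..<D} (\<lambda>_. std_normal_distribution)) {\<omega>\<in>space (PiM {..<D} (\<lambda>_. std_normal_distribution)). (\<Sum>k<D. (\<omega> k)\<^sup>2) \<le> t}"

definition chi2_quantile :: "nat \<Rightarrow> real \<Rightarrow> real" where
  "chi2_quantile D \<alpha> = Inf {t. chi2_cdf D t \<ge> 1 - \<alpha>}"

definition trunc_vec :: "real \<Rightarrow> real^'d::finite \<Rightarrow> real^'d" where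
  "trunc_vec r x = (\<chi> d. max (min (x $ d) r) (- r))"

fun pdiff :: "(real^'d::finite \<Rightarrow> real) \<Rightarrow> 'd list \<Rightarrow> real^'d \<Rightarrow> real" where
  "pdiff f [] = f"
| "pdiff f (i # is) = (\<lambda>x. deriv (\<lambda>t. pdiff f is (x + t *\<^sub>R axis i 1)) 0)"

definition Cb :: "nat \<Rightarrow> (real^'d::finite \<Rightarrow> real) \<Rightarrow> bool" where
  "Cb k f \<longleftrightarrow>
     (\<forall>is i x. length is < k \<longrightarrow> (\<lambda>t. pdiff f is (x + t *\<^sub>R axis i 1)) differentiable (at 0)) \<and>
     (\<forall>is. length is \<le> k \<longrightarrow> continuous_on UNIV (pdiff f is) \<and> bounded (range (pdiff f is)))"

definition Cb_norm :: "nat \<Rightarrow> (real^'d::finite \<Rightarrow> real) \<Rightarrow> real" where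
  "Cb_norm k f = (SUP p\<in>{(is, x). length is \<le> k}. \<bar>pdiff f (fst p) (snd p)\<bar>)"

definition multi_idx :: "nat \<Rightarrow> ('d::finite \<Rightarrow> nat) set" where
  "multi_idx Q = {j. l1 j \<le> Q}"

definition cstar_paths :: "'d::finite itself \<Rightarrow> nat \<Rightarrow> real" where
  "cstar_paths _ Q = 2/3 + 8/3 * (\<Sum>j\<in>(multi_idx Q :: ('d \<Rightarrow> nat) set). \<Prod>d\<in>UNIV. real (2 * j d + 1))"

definition cube :: "real \<Rightarrow> int^'d::finite \<Rightarrow> (real^'d) set" where
  "cube h i = {x. \<forall>d. h * of_int (i $ d) < x $ d \<and> x $ d \<le> h * (of_int (i $ d) + 1)}"

definition center :: "real \<Rightarrow> int^'d::finite \<Rightarrow> real^'d" where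
  "center h i = (\<chi> d. h * (of_int (i $ d) + 1/2))"

definition alg1_h :: "real \<Rightarrow> real \<Rightarrow> real \<Rightarrow> real" where
  "alg1_h c_cube \<gamma>_cube \<Delta> = c_cube * \<Delta> powr \<gamma>_cube"

definition alg1_r1 :: "nat \<Rightarrow> real \<Rightarrow> real \<Rightarrow> real \<Rightarrow> real \<Rightarrow> real" where
  "alg1_r1 D C2f c1 \<gamma>1 \<Delta> = sqrt (C2f * chi2_quantile D (c1 * \<Delta> powr \<gamma>1))"

definition alg1_r2 :: "real \<Rightarrow> real \<Rightarrow> real \<Rightarrow> real" where
  "alg1_r2 c2 \<gamma>2 \<Delta> = sqrt (2 * ln (c2 * \<Delta> powr (- \<gamma>2) * ln (1 / \<Delta>)))"

definition alg1_I :: "real \<Rightarrow> real \<Rightarrow> (int^'d::finite) set" where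
  "alg1_I h r1 = {i. cube h i \<inter> cball 0 r1 \<noteq> {}}"

definition eta :: "real \<Rightarrow> int^'d::finite \<Rightarrow> ('d \<Rightarrow> nat) \<Rightarrow> real^'d \<Rightarrow> real" where
  "eta h i j x = (\<Prod>d\<in>UNIV. sqrt (2 * real (j d) + 1) * legendre (j d) (((x - center h i) $ d) / (h / 2)))"

text \<open>Smallest of the K singular values of an L x K matrix A (columns indexed by the
  K-element set J): square root of the smallest eigenvalue of A^T A.\<close>
definition smallest_sv :: "nat \<Rightarrow> 'j set \<Rightarrow> (nat \<Rightarrow> 'j \<Rightarrow> real) \<Rightarrow> real" where
  "smallest_sv L J A =
     sqrt (Min {ev. \<exists>v. (\<exists>j\<in>J. v j \<noteq> 0) \<and>
                 (\<forall>j\<in>J. (\<Sum>j'\<in>J. (\<Sum>l<L. A l j * A l j') * v j') = ev * v j)})"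

text \<open>Moore--Penrose pseudoinverse applied to a vector: A^+ Y is the least-squares
  coefficient vector of minimal Euclidean norm.\<close>
definition rss :: "nat \<Rightarrow> 'j set \<Rightarrow> (nat \<Rightarrow> 'j \<Rightarrow> real) \<Rightarrow> (nat \<Rightarrow> real) \<Rightarrow> ('j \<Rightarrow> real) \<Rightarrow> real" where
  "rss L J A Y \<beta> = (\<Sum>l<L. (Y l - (\<Sum>j\<in>J. A l j * \<beta> j))\<^sup>2)"

definition pinv_apply :: "nat \<Rightarrow> 'j set \<Rightarrow> (nat \<Rightarrow> 'j \<Rightarrow> real) \<Rightarrow> (nat \<Rightarrow> real) \<Rightarrow> ('j \<Rightarrow> real)" where
  "pinv_apply L J A Y =
     (THE \<alpha>. \<alpha> \<in> extensional J \<and> (\<forall>\<beta>\<in>extensional J. rss L J A Y \<alpha> \<le> rss L J A Y \<beta>) \<and>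
        (\<forall>\<beta>\<in>extensional J. (\<forall>\<gamma>\<in>extensional J. rss L J A Y \<beta> \<le> rss L J A Y \<gamma>) \<longrightarrow>
             (\<Sum>j\<in>J. (\<alpha> j)\<^sup>2) \<le> (\<Sum>j\<in>J. (\<beta> j)\<^sup>2)))"

definition alg1_samples :: "(int^'d::finite) set \<Rightarrow> real \<Rightarrow> nat \<Rightarrow> ((int^'d) \<times> nat \<Rightarrow> (real^'d) \<times> (real^'d)) measure" where
  "alg1_samples I h L = PiM (I \<times> {..<L}) (\<lambda>(i, l). uniform_measure lborel (cube h i) \<Otimes>\<^sub>M std_normal_vec)"

definition alg1_zhat ::
  "((real^'d::finite) \<Rightarrow> real) \<Rightarrow> nat \<Rightarrow> nat \<Rightarrow> real \<Rightarrow> ('d \<Rightarrow> nat) \<Rightarrow> real \<Rightarrow> real \<Rightarrow> real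
   \<Rightarrow> real \<Rightarrow> real \<Rightarrow> real \<Rightarrow> real \<Rightarrow> real
   \<Rightarrow> ((real^'d) \<Rightarrow> (real^'d)) \<Rightarrow> ((real^'d) \<Rightarrow> ((real^'d)^'d))
   \<Rightarrow> ((int^'d) \<times> nat \<Rightarrow> (real^'d) \<times> (real^'d)) \<Rightarrow> (real^'d) \<Rightarrow> real" where
  "alg1_zhat y L Q \<Delta> \<iota> \<tau> \<gamma>_cube c_cube c1t c2t \<gamma>1t \<gamma>2t C2f b \<sigma> \<omega> x =
    (let h = alg1_h c_cube \<gamma>_cube \<Delta>;
         r1 = alg1_r1 CARD('d) C2f c1t \<gamma>1t \<Delta>;
         I = (alg1_I h r1 :: (int^'d) set);
         J = (multi_idx Q :: ('d \<Rightarrow> nat) set);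
         r2 = alg1_r2 c2t \<gamma>2t \<Delta>;
         X = (\<lambda>i l. fst (\<omega> (i, l)) + \<Delta> *\<^sub>R b (fst (\<omega> (i, l)))
                    + sqrt \<Delta> *\<^sub>R (\<sigma> (fst (\<omega> (i, l))) *v trunc_vec r2 (snd (\<omega> (i, l)))));
         A = (\<lambda>i l j. eta h i j (X i l));
         \<alpha> = (\<lambda>i. if (smallest_sv L J (A i))\<^sup>2 \<ge> \<tau> * real L
                  then pinv_apply L J (A i) (\<lambda>l. y (X i l)) else (\<lambda>j. 0))
     in (\<Sum>i\<in>I. indicator (cube h i) x *
           (\<Sum>j\<in>J. \<alpha> i j *
              (\<integral>\<xi>. eta h i j (x + \<Delta> *\<^sub>R b x + sqrt \<Delta> *\<^sub>R (\<sigma> x *v trunc_vec r2 \<xi>))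
                     * hermite_multi \<Delta> \<iota> (trunc_vec r2 \<xi>) \<partial>std_normal_vec))))"

text \<open>E[H_{iota,Delta}(xi) y(X_2) | X_1 = x], with X_2 = x + b(x) Delta + sigma(x) sqrt Delta xi.\<close>
definition cond_target ::
  "((real^'d::finite) \<Rightarrow> real) \<Rightarrow> real \<Rightarrow> ('d \<Rightarrow> nat) \<Rightarrow> ((real^'d) \<Rightarrow> (real^'d))
   \<Rightarrow> ((real^'d) \<Rightarrow> ((real^'d)^'d)) \<Rightarrow> (real^'d) \<Rightarrow> real" where
  "cond_target y \<Delta> \<iota> b \<sigma> x =
     (\<integral>\<xi>. hermite_multi \<Delta> \<iota> \<xi> * y (x + \<Delta> *\<^sub>R b x + sqrt \<Delta> *\<^sub>R (\<sigma> x *v \<xi>)) \<partial>std_normal_vec)"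

end

theory Submission
  imports Defs "HOL-Computational_Algebra.Polynomial" "HOL-Real_Asymp.Real_Asymp"
begin

text \<open>
  On a cube where the singular value test succeeds, the error is bounded pointwise. The function
  \<open>y\<close> differs from its Taylor polynomial of degree \<open>Q\<close> at the centre by \<open>O(h\<^bsup>Q+1\<^esup>)\<close> in a
  neighbourhood of size \<open>O(h)\<close> that contains all truncated Euler steps, so the least-squares
  coefficients are within \<open>O(h\<^bsup>Q+1\<^esup> / \<surd>\<tau>)\<close> of those of the Taylor polynomial, and
  \<open>\<Delta>\<^bsup>-|\<iota>|/2\<^esup> h\<^bsup>Q+1\<^esup>\<close> is of order \<open>\<Delta>\<^bsup>\<rho>/2\<^esup>\<close>. Where the test fails, the estimate is \<open>0\<close>, and the
  target is bounded uniformly in \<open>\<Delta>\<close> because Hermite weights annihilate polynomials of lower degree.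

  Failure has probability \<open>O(\<Delta>\<^bsup>\<rho>\<^esup>)\<close>: up to \<open>o(1)\<close> the samples may be replaced by their uniform
  components, for which the Legendre basis is orthonormal and bounded, so a one-sided Chernoff bound
  for \<open>\<Sum>\<^sub>l (w \<bullet> \<eta>(U\<^sub>l))\<^sup>2\<close> over a fixed finite net of unit vectors \<open>w\<close> suffices. The net also replaces
  the possibly non-measurable failure event by a measurable one. Finally, the mass of \<open>\<mu>\<^sub>1\<close> outside
  the cubes is \<open>O(\<Delta>\<^bsup>\<rho>\<^esup>)\<close> by the choice of the \<open>\<chi>\<^sup>2\<close> quantile.
\<close>

section \<open>Hermite polynomials\<close>

text \<open>The constants fit together as follows. For independent squares
  \<open>0 \<le> Z \<le> B\<close> of mean 1 the one-sided exponential bound has exponent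
  \<open>L \<delta>^2 / (2 B)\<close>, where \<open>B\<close> is the sum occurring in
  \<open>cstar_paths\<close>. With \<open>\<delta>^2 = cstar_paths / c1p\<close> and
  \<open>L\<close> at least \<open>\<rho> c1p ln (c2p / \<Delta>)\<close>, this exponent reaches
  \<open>\<rho> ln (c2p / \<Delta>)\<close> because \<open>cstar_paths\<close> is at least
  \<open>2 B\<close>. The gap between \<open>\<tau>\<close> and \<open>1 - \<delta>\<close> pays
  both for the finite net and for moving the sample points from the uniform points to the Euler
  steps. Since \<open>Q + 1\<close> exceeds \<open>|\<iota>| + \<rho>\<close>, the cube width is a
  power of \<open>\<Delta>\<close> below 1/2; hence \<open>sqrt \<Delta> r2\<close>, logarithm
  included, is negligible against \<open>h\<close>. Two obstacles shape the rest. The number of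
  cubes grows as \<open>\<Delta>\<close> decreases, so each failure probability is weighted by the
  mass of its own cube instead of being summed over cubes. And all constants must be fixed before
  \<open>f\<close>, \<open>b\<close>, \<open>\<sigma>\<close>, \<open>y\<close> and
  \<open>\<Delta>\<close>, so every compactness argument is carried out once, in coordinates that
  are independent of the cube and of \<open>h\<close>.\<close>

primrec hermite_poly :: "nat \<Rightarrow> real poly" where
  "hermite_poly 0 = 1"
| "hermite_poly (Suc q) = [:0, 1:] * hermite_poly q - pderiv (hermite_poly q)"

text \<open>The derivative of p(t) exp(-t^2/2) is -(t p - p') exp(-t^2/2), which is one step of the
  recursion \<open>hermite_poly\<close> up to the sign.\<close>

lemma higher_deriv_gauss:
  "(deriv ^^ q) (\<lambda>t::real. exp (- (t\<^sup>2) / 2)) =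
     (\<lambda>t. (-1) ^ q * poly (hermite_poly q) t * exp (- (t\<^sup>2) / 2))"
proof (induction q)
  case (Suc q)
  have "deriv (\<lambda>t. (-1) ^ q * poly (hermite_poly q) t * exp (- (t\<^sup>2) / 2)) x
      = (-1) ^ Suc q * poly (hermite_poly (Suc q)) x * exp (- (x\<^sup>2) / 2)" for x :: real
    by (rule DERIV_imp_deriv) (auto intro!: derivative_eq_intros simp: algebra_simps)
  then have "deriv (\<lambda>t. (-1) ^ q * poly (hermite_poly q) t * exp (- (t\<^sup>2) / 2))
      = (\<lambda>x :: real. (-1) ^ Suc q * poly (hermite_poly (Suc q)) x * exp (- (x\<^sup>2) / 2))"
    by (rule ext)
  then show ?case
    by (simp only: funpow.simps o_apply Suc.IH)
qed simp

lemma hermite_eq_poly: "hermite q x = poly (hermite_poly q) x"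
proof -
  have "exp (x\<^sup>2 / 2) * exp (- (x\<^sup>2) / 2) = 1"
    by (simp flip: exp_add)
  then show ?thesis
    unfolding hermite_def higher_deriv_gauss
    by (simp add: mult_ac flip: power_mult_distrib)
qed

lemma integrable_std_normal_poly:
  "integrable lborel (\<lambda>x. std_normal_density x * poly p x)"
proof -
  have "integrable lborel (\<lambda>x. \<Sum>i\<le>degree p. coeff p i * (std_normal_density x * x ^ i))"
    by (intro Bochner_Integration.integrable_sum integrable_mult_right integrable_std_normal_moment)
  then show ?thesis
    by (simp add: poly_altdef sum_distrib_left mult_ac)
qed

text \<open>This is Gaussian integration by parts for monomials, read off from the closed form of
  the even moments and the vanishing of the odd ones, so no boundary terms at infinity have to be
  discussed.\<close>

lemma std_normal_moment_rec:
  "(LBINT x. std_normal_density x * x ^ Suc (Suc n)) = real (Suc n) * (LBINT x. std_normal_density x * x ^ n)"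
proof (cases "even n")
  case True
  then obtain k where k: "n = 2 * k" by (elim evenE)
  have "fact (2 * Suc k) / (2 ^ Suc k * fact (Suc k)) = real (Suc (2 * k)) * (fact (2 * k) / (2 ^ k * fact k))"
    by (simp add: divide_simps)
  then show ?thesis
    using integral_std_normal_moment_even[of "Suc k"] integral_std_normal_moment_even[of k] by (simp add: k)
next
  case False
  then obtain k where k: "n = 2 * k + 1" by (elim oddE)
  show ?thesis
    using integral_std_normal_moment_odd[of "Suc k"] integral_std_normal_moment_odd[of k] by (simp add: k)
qed

text \<open>Stein's identity E[X p(X)] = E[p'(X)]. Both sides are linear in p, and for monomials it
  is the moment recursion.\<close>

lemma stein_poly:
  "(LBINT x. std_normal_density x * (x * poly p x)) = (LBINT x. std_normal_density x * poly (pderiv p) x)"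
proof -
  define E where "E p = (LBINT x. std_normal_density x * poly p x)" for p
  have E_sum: "E (\<Sum>i\<in>A. smult (c i) (f i)) = (\<Sum>i\<in>A. c i * E (f i))" if "finite A" for A :: "nat set" and c f
  proof -
    have "E (\<Sum>i\<in>A. smult (c i) (f i)) = (LBINT x. \<Sum>i\<in>A. c i * (std_normal_density x * poly (f i) x))"
      unfolding E_def by (simp add: poly_sum sum_distrib_left mult_ac)
    also have "\<dots> = (\<Sum>i\<in>A. c i * E (f i))"
      unfolding E_def
      by (subst Bochner_Integration.integral_sum) (auto intro!: integrable_mult_right integrable_std_normal_poly)
    finally show ?thesis .
  qed
  have mono: "E (monom 1 (Suc n)) = E (pderiv (monom 1 n))" for n
  proof (cases n)
    case 0
    show ?thesis
      using integral_std_normal_moment_odd[of 0] by (simp add: E_def poly_monom 0 pderiv_monom)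
  next
    case (Suc k)
    show ?thesis
      using std_normal_moment_rec[of k]
      by (simp add: E_def poly_monom Suc pderiv_monom mult.left_commute[of _ "1 + real k"])
  qed
  have p: "p = (\<Sum>i\<le>degree p. smult (coeff p i) (monom 1 i))"
    by (simp add: smult_monom poly_as_sum_of_monoms)
  have p1: "[:0, 1:] * p = (\<Sum>i\<le>degree p. smult (coeff p i) (monom 1 (Suc i)))"
    by (subst p) (simp add: sum_distrib_left monom_Suc)
  have p2: "pderiv p = (\<Sum>i\<le>degree p. smult (coeff p i) (pderiv (monom 1 i)))"
    by (subst p) (simp add: pderiv_smult higher_pderiv_sum[of 1, simplified])
  have "E ([:0, 1:] * p) = E (pderiv p)"
    unfolding p1 p2 by (simp add: E_sum mono)
  then show ?thesis
    by (simp add: E_def)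
qed

text \<open>Under the Gaussian weight the map h -> x h - h' is the adjoint of differentiation:
  Stein's identity for the product h p produces h' p + h p', and the recursion cancels h' p.
  Iterating moves all q derivatives onto p.\<close>

lemma hermite_poly_integral:
  "(LBINT x. std_normal_density x * (poly (hermite_poly q) x * poly p x))
     = (LBINT x. std_normal_density x * poly ((pderiv ^^ q) p) x)"
proof (induction q arbitrary: p)
  case (Suc q)
  let ?h = "hermite_poly q"
  have "(LBINT x. std_normal_density x * (poly (hermite_poly (Suc q)) x * poly p x))
     = (LBINT x. std_normal_density x * (x * poly (?h * p) x) - std_normal_density x * poly (pderiv ?h * p) x)"
    by (intro Bochner_Integration.integral_cong) (simp_all add: algebra_simps)
  also have "\<dots> = (LBINT x. std_normal_density x * poly (pderiv (?h * p)) x)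
       - (LBINT x. std_normal_density x * poly (pderiv ?h * p) x)"
    using integrable_std_normal_poly[of "[:0, 1:] * (?h * p)"]
    by (subst Bochner_Integration.integral_diff)
       (auto simp: stein_poly integrable_std_normal_poly simp del: poly_mult)
  also have "\<dots> = (LBINT x. std_normal_density x * poly (pderiv (?h * p)) x - std_normal_density x * poly (pderiv ?h * p) x)"
    by (subst Bochner_Integration.integral_diff)
       (auto simp: integrable_std_normal_poly simp del: poly_mult)
  also have "\<dots> = (LBINT x. std_normal_density x * (poly ?h x * poly (pderiv p) x))"
    by (intro Bochner_Integration.integral_cong) (simp_all add: pderiv_mult algebra_simps)
  also have "\<dots> = (LBINT x. std_normal_density x * poly ((pderiv ^^ Suc q) p) x)"
    by (subst Suc.IH) (simp only: funpow_Suc_right o_apply)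
  finally show ?case .
qed simp

lemma hermite_orthogonal_power:
  assumes "m < q"
  shows "(LBINT x. std_normal_density x * (hermite q x * x ^ m)) = 0"
proof -
  have "(pderiv ^^ q) (monom 1 m :: real poly) = 0"
    using assms by (auto intro!: poly_eqI simp: coeff_higher_pderiv)
  then show ?thesis
    using hermite_poly_integral[of q "monom 1 m"] by (simp add: hermite_eq_poly poly_monom)
qed

text \<open>Every degree spends half of the exponent: |t| \<le> (1 + 2/c) exp(c t^2 / 2) absorbs the
  new factor t, and the other half is left for the induction hypothesis. An arbitrarily small rate
  lets several polynomial factors share one integrable Gaussian weight.\<close>

lemma poly_exp_bound:
  fixes p :: "real poly"
  shows "(c :: real) > 0 \<Longrightarrow> \<exists>C>0. \<forall>t. \<bar>poly p t\<bar> \<le> C * exp (c * t\<^sup>2)"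
proof (induction p arbitrary: c)
  case 0
  show ?case by (rule exI[of _ 1]) simp
next
  case (pCons a p)
  obtain C where C: "C > 0" "\<And>t. \<bar>poly p t\<bar> \<le> C * exp (c / 2 * t\<^sup>2)"
    using pCons.IH[of "c / 2"] pCons.prems by auto
  define K where "K = \<bar>a\<bar> + (1 + 2 / c) * C"
  have "\<bar>poly (pCons a p) t\<bar> \<le> K * exp (c * t\<^sup>2)" for t
  proof -
    let ?e = "exp (c / 2 * t\<^sup>2)"
    have ee: "?e * ?e = exp (c * t\<^sup>2)" by (simp flip: exp_add)
    have "c / 2 * t\<^sup>2 \<le> ?e" using exp_ge_add_one_self[of "c / 2 * t\<^sup>2"] by linarith
    then have "t\<^sup>2 \<le> 2 / c * ?e" using pCons.prems by (simp add: field_simps)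
    moreover have "\<bar>t\<bar> \<le> 1 + t\<^sup>2"
      using zero_le_power2[of "\<bar>t\<bar> - 1 / 2"] by (simp add: power2_eq_square algebra_simps)
    moreover have "1 \<le> ?e" using pCons.prems by simp
    ultimately have t: "\<bar>t\<bar> \<le> (1 + 2 / c) * ?e" unfolding distrib_right by linarith
    have "\<bar>poly (pCons a p) t\<bar> \<le> \<bar>a\<bar> * 1 + \<bar>t\<bar> * \<bar>poly p t\<bar>"
      by (simp flip: abs_mult)
    also have "\<dots> \<le> \<bar>a\<bar> * exp (c * t\<^sup>2) + ((1 + 2 / c) * ?e) * (C * ?e)"
      using t C pCons.prems by (intro add_mono mult_left_mono mult_mono) auto
    also have "((1 + 2 / c) * ?e) * (C * ?e) = (1 + 2 / c) * C * exp (c * t\<^sup>2)"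
      by (simp add: ee[symmetric])
    finally show ?thesis by (simp add: K_def distrib_right)
  qed
  moreover have "K > 0" using C(1) pCons.prems by (simp add: K_def add_nonneg_pos add_pos_pos)
  ultimately show ?case by blast
qed

lemma hermite_exp_bound:
  fixes c :: real
  assumes "c > 0"
  shows "\<exists>C>0. \<forall>t. \<bar>hermite q t\<bar> \<le> C * exp (c * t\<^sup>2)"
  using poly_exp_bound[OF assms, of "hermite_poly q"] by (simp add: hermite_eq_poly)

section \<open>Legendre polynomials\<close>

definition legendre_poly :: "nat \<Rightarrow> real poly" where
  "legendre_poly q = smult (1 / (2 ^ q * fact q)) ((pderiv ^^ q) ([:-1, 0, 1:] ^ q))"

lemma higher_deriv_poly: "(deriv ^^ n) (poly p) = poly ((pderiv ^^ n) p)" for p :: "real poly"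
proof (induction n)
  case (Suc n)
  have "deriv (poly ((pderiv ^^ n) p)) = poly (pderiv ((pderiv ^^ n) p))"
    by (rule ext, rule DERIV_imp_deriv) simp
  with Suc show ?case by simp
qed simp

lemma legendre_eq_poly: "legendre q x = poly (legendre_poly q) x"
proof -
  have "(\<lambda>t::real. (t\<^sup>2 - 1) ^ q) = poly ([:-1, 0, 1:] ^ q)"
    by (simp add: fun_eq_iff poly_power power2_eq_square)
  then show ?thesis
    by (simp add: legendre_def legendre_poly_def higher_deriv_poly)
qed

lemma degree_legendre_poly [simp]: "degree (legendre_poly q) = q"
  by (simp add: legendre_poly_def degree_higher_pderiv degree_power_eq)

lemma legendre_poly_nonzero [simp]: "legendre_poly q \<noteq> 0"
proof (cases q)
  case (Suc k)
  then show ?thesis using degree_legendre_poly[of q] by fastforce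
qed (simp add: legendre_poly_def)

lemma higher_pderiv_Suc_right: "(pderiv ^^ n) (pderiv p) = (pderiv ^^ Suc n) p"
  by (simp only: funpow_Suc_right o_apply)

text \<open>Leibniz rule for a factor x, where only two terms survive because x has vanishing second
  derivative.\<close>

lemma higher_pderiv_mult_x:
  "(pderiv ^^ Suc n) ([:0, 1:] * p) = [:0, 1:] * (pderiv ^^ Suc n) p + smult (of_nat (Suc n)) ((pderiv ^^ n) p)"
  for p :: "real poly"
proof (induction n)
  case 0
  show ?case by (simp add: pderiv_mult pderiv_pCons)
next
  case (Suc n)
  have "(pderiv ^^ Suc (Suc n)) ([:0, 1:] * p)
      = pderiv ([:0, 1:] * (pderiv ^^ Suc n) p + smult (of_nat (Suc n)) ((pderiv ^^ n) p))"
    by (simp only: funpow.simps(2)[of "Suc n"] o_apply Suc.IH)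
  also have "\<dots> = [:0, 1:] * (pderiv ^^ Suc (Suc n)) p + (pderiv ^^ Suc n) p
      + smult (of_nat (Suc n)) ((pderiv ^^ Suc n) p)"
    by (simp only: pderiv_add pderiv_mult pderiv_smult funpow.simps o_apply) (simp add: pderiv_pCons)
  finally show ?case by (simp add: smult_add_left numeral_mult_conv_smult del: funpow.simps)
qed

text \<open>Differentiating \<open>(x\<^sup>2 - 1) u' = 2 n x u\<close>, where \<open>u = (x\<^sup>2 - 1)\<^sup>n\<close>, \<open>n + 1\<close> times.\<close>

lemma legendre_ode:
  "[:-1, 0, 1:] * pderiv (pderiv (legendre_poly n)) + [:0, 2:] * pderiv (legendre_poly n)
     = smult (real n * (real n + 1)) (legendre_poly n)"
proof -
  define u :: "real poly" where "u = [:-1, 0, 1:] ^ n"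
  define D where "D k = (pderiv ^^ k) u" for k
  have u1: "[:-1, 0, 1:] * pderiv u = smult (2 * real n) ([:0, 1:] * u)"
  proof (cases n)
    case (Suc k)
    have "pderiv u = smult (real n) ([:-1, 0, 1:] ^ k) * [:0, 2:]"
      unfolding u_def Suc pderiv_power_Suc by (simp add: pderiv_pCons)
    then show ?thesis by (simp add: u_def Suc algebra_simps)
  qed (simp add: u_def)
  \<comment> \<open>Written with two separate factors x, the equation can be differentiated using
    only the Leibniz rule for multiplication by x.\<close>
  have "[:-1, 0, 1:] * pderiv u = [:0, 1:] * ([:0, 1:] * pderiv u) - pderiv u"
    by (simp add: algebra_simps)
  then have eq: "[:0, 1:] * ([:0, 1:] * pderiv u) - pderiv u = smult (2 * real n) ([:0, 1:] * u)"
    using u1 by simp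
  have D': "(pderiv ^^ k) (pderiv u) = D (Suc k)" for k
    by (simp only: D_def higher_pderiv_Suc_right)
  have pD: "(pderiv ^^ k) u = D k" for k by (simp add: D_def)
  have diff: "(pderiv ^^ k) (p - q) = (pderiv ^^ k) p - (pderiv ^^ k) q" for k and p q :: "real poly"
    using higher_pderiv_add[of k p "-q"] higher_pderiv_smult[of k "-1" q] by simp
  have "(pderiv ^^ Suc n) ([:0, 1:] * ([:0, 1:] * pderiv u) - pderiv u)
      = (pderiv ^^ Suc n) (smult (2 * real n) ([:0, 1:] * u))"
    by (simp only: eq)
  moreover have m1: "(pderiv ^^ Suc n) ([:0, 1:] * q) = [:0, 1:] * (pderiv ^^ Suc n) q + smult (real (n + 1)) ((pderiv ^^ n) q)" for q
    using higher_pderiv_mult_x[of n q] by (simp only: Suc_eq_plus1)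
  moreover have "(pderiv ^^ Suc n) (pderiv u) = D (n + 2)" "(pderiv ^^ Suc n) u = D (n + 1)"
    by (simp_all only: D' pD) simp_all
  moreover have "(pderiv ^^ n) (pderiv u) = D (n + 1)"
    by (simp only: D') simp
  moreover have "(pderiv ^^ n) ([:0, 1:] * pderiv u) = [:0, 1:] * D (n + 1) + smult (real n) (D n)"
  proof (cases n)
    case 0
    then show ?thesis by (simp add: D_def)
  next
    case (Suc k)
    have "(pderiv ^^ n) ([:0, 1:] * pderiv u) = [:0, 1:] * (pderiv ^^ n) (pderiv u) + smult (real n) ((pderiv ^^ k) (pderiv u))"
      unfolding Suc by (rule higher_pderiv_mult_x)
    then show ?thesis by (simp only: D' Suc) simp
  qed
  ultimately have "[:0, 1:] * ([:0, 1:] * D (n + 2) + smult (real (n + 1)) (D (n + 1)))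
       + smult (real (n + 1)) ([:0, 1:] * D (n + 1) + smult (real n) (D n)) - D (n + 2)
     = smult (2 * real n) ([:0, 1:] * D (n + 1) + smult (real (n + 1)) (D n))"
    by (simp only: diff higher_pderiv_smult pD)
  then have "poly ([:0, 1:] * ([:0, 1:] * D (n + 2) + smult (real (n + 1)) (D (n + 1)))
       + smult (real (n + 1)) ([:0, 1:] * D (n + 1) + smult (real n) (D n)) - D (n + 2)) x
     = poly (smult (2 * real n) ([:0, 1:] * D (n + 1) + smult (real (n + 1)) (D n))) x" for x
    by simp
  then have "poly ([:-1, 0, 1:] * D (n + 2) + [:0, 2:] * D (n + 1)) x = poly (smult (real n * (real n + 1)) (D n)) x" for x
    by (simp add: algebra_simps)
  then have "[:-1, 0, 1:] * D (n + 2) + [:0, 2:] * D (n + 1) = smult (real n * (real n + 1)) (D n)"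
    by (intro poly_ext)
  moreover define c :: real where "c = 1 / (2 ^ n * fact n)"
  moreover have L: "legendre_poly n = smult c (D n)"
    by (simp add: legendre_poly_def D_def u_def c_def)
  moreover have "pderiv (D n) = D (n + 1)" "pderiv (D (n + 1)) = D (n + 2)"
    by (simp_all add: D_def)
  ultimately have "[:-1, 0, 1:] * pderiv (pderiv (legendre_poly n)) + [:0, 2:] * pderiv (legendre_poly n)
      = smult c (smult (real n * (real n + 1)) (D n))"
    by (simp only: pderiv_smult mult_smult_right smult_add_right[symmetric])
  then show ?thesis
    unfolding L smult_smult by (simp only: mult.commute)
qed

text \<open>One differentiation turns (x - a)^n p into (x - a)^(n-1) (n p + (x - a) p'), and the new
  cofactor has value n p(a) at a. After n steps these values multiply to n!. The case k = n gives
  the end point values of the Legendre polynomials, the case k < n the vanishing of boundary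
  terms.\<close>

lemma higher_pderiv_power_mult_root:
  fixes a :: real
  shows "k \<le> n \<Longrightarrow> poly ((pderiv ^^ k) ([:- a, 1:] ^ n * p)) a = (if k = n then fact n * poly p a else 0)"
proof (induction k arbitrary: n p)
  case 0
  then show ?case by (cases n) (auto simp: poly_power)
next
  case (Suc k)
  then obtain m where m: "n = Suc m" by (cases n) auto
  have "pderiv ([:- a, 1:] ^ n * p) = [:- a, 1:] ^ m * (smult (real n) p + [:- a, 1:] * pderiv p)"
    unfolding m pderiv_mult pderiv_power_Suc by (simp add: pderiv_pCons algebra_simps)
  then have "poly ((pderiv ^^ Suc k) ([:- a, 1:] ^ n * p)) a
     = poly ((pderiv ^^ k) ([:- a, 1:] ^ m * (smult (real n) p + [:- a, 1:] * pderiv p))) a"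
    by (simp only: funpow_Suc_right o_apply)
  also have "\<dots> = (if Suc k = n then fact n * poly p a else 0)"
    using Suc.prems by (subst Suc.IH) (auto simp: m algebra_simps)
  finally show ?case .
qed

lemma legendre_poly_1 [simp]: "poly (legendre_poly n) 1 = 1"
proof -
  have "[:-1, 0, 1:] = [:-1, 1:] * [:1, 1 :: real:]" by simp
  then have "([:-1, 0, 1 :: real:]) ^ n = [:-1, 1:] ^ n * [:1, 1:] ^ n" by (simp only: power_mult_distrib)
  then show ?thesis
    using higher_pderiv_power_mult_root[of n n 1 "[:1, 1:] ^ n"]
    by (simp add: legendre_poly_def poly_power)
qed

lemma legendre_poly_minus1 [simp]: "poly (legendre_poly n) (-1) = (-1) ^ n"
proof -
  have "[:-1, 0, 1:] = [:1, 1:] * [:-1, 1 :: real:]" by simp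
  then have "([:-1, 0, 1 :: real:]) ^ n = [:1, 1:] ^ n * [:-1, 1:] ^ n" by (simp only: power_mult_distrib)
  then show ?thesis
    using higher_pderiv_power_mult_root[of n n "-1" "[:-1, 1:] ^ n"]
    by (simp add: legendre_poly_def poly_power power_minus[of 2 n])
qed

text \<open>Sonin's function \<open>P\<^sup>2 + (1 - x\<^sup>2) P'\<^sup>2 / (n (n + 1))\<close> has derivative \<open>2 x P'\<^sup>2 / (n (n + 1))\<close>
  by the differential equation, so on \<open>[-1, 1]\<close> it is largest at the end points.\<close>

lemma abs_legendre_le_1:
  assumes "\<bar>x\<bar> \<le> 1"
  shows "\<bar>legendre n x\<bar> \<le> 1"
proof (cases "n = 0")
  case True
  then show ?thesis by (simp add: legendre_eq_poly legendre_poly_def)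
next
  case False
  define N where "N = real n * (real n + 1)"
  have N: "N > 0" using False by (simp add: N_def)
  define P where "P = legendre_poly n"
  \<comment> \<open>Sonin's function multiplied by \<open>N = n (n + 1)\<close>, so that it stays a
    polynomial without division; its value at both end points is \<open>N\<close>.\<close>
  define S where "S = smult N (P * P) + [:1, 0, -1:] * (pderiv P * pderiv P)"
  have ode: "(x * x - 1) * poly (pderiv (pderiv P)) x + 2 * x * poly (pderiv P) x = N * poly P x" for x
    using arg_cong[OF legendre_ode[of n], of "\<lambda>p. poly p x"] by (simp add: P_def N_def algebra_simps)
  have S': "poly (pderiv S) x = 2 * x * (poly (pderiv P) x)\<^sup>2" for x
  proof -
    have *: "poly (pderiv S) x = 2 * poly (pderiv P) x * (N * poly P x)
        + 2 * (1 - x * x) * poly (pderiv P) x * poly (pderiv (pderiv P)) x - 2 * x * (poly (pderiv P) x)\<^sup>2"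
      unfolding S_def pderiv_add pderiv_mult pderiv_smult
      by (simp add: pderiv_pCons algebra_simps power2_eq_square)
    show ?thesis
      unfolding * ode[symmetric] by (simp add: algebra_simps power2_eq_square)
  qed
  have "poly S x \<le> N"
  proof (cases "x \<ge> 0")
    case True
    have "poly S x \<le> poly S 1"
    proof (rule DERIV_nonneg_imp_nondecreasing[where f = "poly S"])
      show "x \<le> 1" using assms by simp
      show "\<exists>d. ((poly S) has_real_derivative d) (at t) \<and> 0 \<le> d" if "x \<le> t" for t
        using that True by (intro exI[of _ "poly (pderiv S) t"] conjI poly_DERIV) (simp add: S')
    qed
    then show ?thesis by (simp add: S_def P_def)
  next
    case False
    have "poly S x \<le> poly S (-1)"
    proof (rule DERIV_nonpos_imp_nonincreasing[where f = "poly S"])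
      show "- 1 \<le> x" using assms by simp
      show "\<exists>d. ((poly S) has_real_derivative d) (at t) \<and> d \<le> 0" if "t \<le> x" for t
        using that False by (intro exI[of _ "poly (pderiv S) t"] conjI poly_DERIV)
          (simp add: S' mult_nonpos_nonneg)
    qed
    then show ?thesis by (simp add: S_def P_def flip: power_add)
  qed
  moreover have "N * (poly P x)\<^sup>2 \<le> poly S x"
  proof -
    have "x * x \<le> 1" using assms by (simp add: abs_square_le_1 flip: power2_eq_square)
    then have "0 \<le> (1 - x * x) * (poly (pderiv P) x)\<^sup>2" by simp
    then show ?thesis by (simp add: S_def power2_eq_square algebra_simps)
  qed
  ultimately have "N * (poly P x)\<^sup>2 \<le> N * 1" by simp
  then have "(poly P x)\<^sup>2 \<le> 1" using N by (simp only: mult_le_cancel_left_pos)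
  then show ?thesis by (simp add: abs_square_le_1 legendre_eq_poly P_def)
qed

lemma poly_has_integral:
  fixes p :: "real poly"
  shows "((\<lambda>x. poly (pderiv p) x) has_integral (poly p 1 - poly p (-1))) {-1..1}"
  by (rule fundamental_theorem_of_calculus)
     (simp_all add: has_real_derivative_iff_has_vector_derivative[THEN iffD1, OF has_field_derivative_at_within[OF poly_DERIV]])

lemma poly_integrable_on: "(\<lambda>x. poly p x) integrable_on {a..b}" for p :: "real poly"
  by (intro integrable_continuous_interval continuous_intros)

text \<open>Repeated integration by parts in Rodrigues' formula: (x^2 - 1)^n has zeros of order n at
  both end points, so all boundary terms vanish, and p is differentiated to zero before the n
  derivatives are used up.\<close>

lemma legendre_poly_integral_low:
  assumes "degree p < n"
  shows "integral {-1..1} (\<lambda>x. poly (legendre_poly n) x * poly p x) = 0"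
proof -
  define u :: "real poly" where "u = [:-1, 0, 1:] ^ n"
  have u1: "poly ((pderiv ^^ k) u) 1 = 0" and um1: "poly ((pderiv ^^ k) u) (-1) = 0" if "k < n" for k
  proof -
    have "u = [:-1, 1:] ^ n * [:1, 1:] ^ n"
      by (simp add: u_def flip: power_mult_distrib)
    then show "poly ((pderiv ^^ k) u) 1 = 0"
      using higher_pderiv_power_mult_root[of k n 1 "[:1, 1:] ^ n"] that by simp
    have "u = [:1, 1:] ^ n * [:-1, 1:] ^ n"
      by (simp add: u_def flip: power_mult_distrib)
    then show "poly ((pderiv ^^ k) u) (-1) = 0"
      using higher_pderiv_power_mult_root[of k n "-1" "[:-1, 1:] ^ n"] that by simp
  qed
  have main: "integral {-1..1} (\<lambda>x. poly ((pderiv ^^ k) u) x * poly p x) = 0"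
    if "k \<le> n" "degree p < k" for k p
    using that
  proof (induction k arbitrary: p)
    case (Suc k)
    let ?v = "(pderiv ^^ k) u"
    have "((\<lambda>x. poly (pderiv (?v * p)) x) has_integral (poly (?v * p) 1 - poly (?v * p) (-1))) {-1..1}"
      by (rule poly_has_integral)
    then have *: "((\<lambda>x. poly (pderiv ?v) x * poly p x + poly ?v x * poly (pderiv p) x) has_integral 0) {-1..1}"
      using Suc.prems by (simp add: u1 um1 pderiv_mult algebra_simps)
    have "integral {-1..1} (\<lambda>x. poly ?v x * poly (pderiv p) x) = 0"
    proof (cases "degree p = 0")
      case True
      then show ?thesis by (simp add: pderiv_eq_0_iff[THEN iffD2])
    next
      case False
      then show ?thesis using Suc by (simp add: degree_pderiv)
    qed
    moreover have "(\<lambda>x. poly ?v x * poly (pderiv p) x) integrable_on {-1..1}"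
      by (intro integrable_continuous_interval continuous_intros)
    ultimately have "((\<lambda>x. poly ?v x * poly (pderiv p) x) has_integral 0) {-1..1}"
      by (metis integrable_integral)
    from has_integral_diff[OF * this] show ?case
      by (simp add: integral_unique)
  qed simp
  have "integral {-1..1} (\<lambda>x. poly (legendre_poly n) x * poly p x)
      = integral {-1..1} (\<lambda>x. 1 / (2 ^ n * fact n) * (poly ((pderiv ^^ n) u) x * poly p x))"
    by (simp add: legendre_poly_def u_def mult_ac)
  also have "\<dots> = 0"
    using main[of n p] assms by simp
  finally show ?thesis .
qed

text \<open>For the norm, integrate \<open>(x P\<^sup>2)' = P\<^sup>2 + 2 x P P'\<close> and use that \<open>x P' - n P\<close> has degree below \<open>n\<close>.\<close>

lemma legendre_poly_norm:
  "integral {-1..1} (\<lambda>x. poly (legendre_poly n) x * poly (legendre_poly n) x) = 2 / (2 * real n + 1)"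
proof -
  let ?P = "legendre_poly n"
  define r where "r = [:0, 1:] * pderiv ?P - smult (real n) ?P"
  have r0: "integral {-1..1} (\<lambda>x. poly ?P x * poly r x) = 0"
  proof (cases "n = 0")
    case True
    then show ?thesis by (simp add: r_def legendre_poly_def)
  next
    case False
    have "coeff r n = 0"
      using False by (cases n) (simp_all add: r_def coeff_pderiv)
    moreover have "degree r \<le> n"
      unfolding r_def using False
      by (intro degree_diff_le order.trans[OF degree_mult_le] order.trans[OF degree_smult_le])
         (simp_all add: degree_pderiv)
    ultimately have "degree r < n"
      using False eq_zero_or_degree_less[of r n] by auto
    then show ?thesis by (rule legendre_poly_integral_low)
  qed
  let ?I = "integral {-1..1} (\<lambda>x. poly ?P x * poly ?P x)"
  have "((\<lambda>x. poly (pderiv ([:0, 1:] * (?P * ?P))) x) has_integral 2) {-1..1}"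
    using poly_has_integral[of "[:0, 1:] * (?P * ?P)"] by (simp flip: power_add)
  moreover have "poly (pderiv ([:0, 1:] * (?P * ?P))) x
      = (2 * real n + 1) * (poly ?P x * poly ?P x) + 2 * (poly ?P x * poly r x)" for x
    by (simp add: pderiv_mult pderiv_pCons r_def algebra_simps)
  ultimately have two: "((\<lambda>x. (2 * real n + 1) * (poly ?P x * poly ?P x) + 2 * (poly ?P x * poly r x)) has_integral 2) {-1..1}"
    by simp
  have "((\<lambda>x. (2 * real n + 1) * (poly ?P x * poly ?P x) + 2 * (poly ?P x * poly r x)) has_integral
      ((2 * real n + 1) * ?I + 2 * 0)) {-1..1}"
    using poly_integrable_on[of "?P * ?P"] poly_integrable_on[of "?P * r"] r0
    by (intro has_integral_add has_integral_mult_right) (simp_all add: has_integral_iff)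
  from has_integral_unique[OF two this] have "(2 * real n + 1) * ?I = 2"
    by simp
  then show ?thesis by (simp add: field_simps)
qed

lemma legendre_orthogonal:
  "integral {-1..1} (\<lambda>x. legendre m x * legendre n x) = (if m = n then 2 / (2 * real n + 1) else 0)"
proof -
  consider "m < n" | "n < m" | "m = n" by linarith
  then show ?thesis
  proof cases
    case 1
    then show ?thesis
      using legendre_poly_integral_low[of "legendre_poly m" n] by (simp add: legendre_eq_poly mult.commute)
  next
    case 2
    then show ?thesis
      using legendre_poly_integral_low[of "legendre_poly n" m] by (simp add: legendre_eq_poly)
  next
    case 3
    then show ?thesis
      using legendre_poly_norm[of n] by (simp add: legendre_eq_poly)
  qed
qed

text \<open>\<open>legendre_poly k\<close> has degree exactly k, so subtracting the multiple with
  matching top coefficient lowers the degree. This is what later places Taylor polynomials inside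
  the regression space.\<close>

lemma poly_in_legendre_span:
  "degree p \<le> k \<Longrightarrow> \<exists>c. \<forall>t. poly p t = (\<Sum>q\<le>k. c q * legendre q t)"
proof (induction k arbitrary: p)
  case 0
  then obtain a where "p = [:a:]" by (auto elim: degree_eq_zeroE)
  then show ?case by (intro exI[of _ "\<lambda>_. a"]) (simp add: legendre_eq_poly legendre_poly_def)
next
  case (Suc k)
  let ?P = "legendre_poly (Suc k)"
  define a where "a = coeff p (Suc k) / coeff ?P (Suc k)"
  define r where "r = p - smult a ?P"
  have "coeff ?P (Suc k) \<noteq> 0"
    using leading_coeff_neq_0[of ?P] by simp
  then have "coeff r (Suc k) = 0" by (simp add: r_def a_def)
  moreover have "degree r \<le> Suc k"
    unfolding r_def using Suc.prems by (intro degree_diff_le order.trans[OF degree_smult_le]) auto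
  ultimately have "degree r \<le> k"
    using eq_zero_or_degree_less[of r "Suc k"] by auto
  then obtain c where c: "\<And>t. poly r t = (\<Sum>q\<le>k. c q * legendre q t)"
    using Suc.IH by blast
  have "poly p t = (\<Sum>q\<le>Suc k. (c(Suc k := a)) q * legendre q t)" for t
  proof -
    have "poly p t = poly r t + a * legendre (Suc k) t" by (simp add: r_def legendre_eq_poly)
    also have "poly r t = (\<Sum>q\<le>k. (c(Suc k := a)) q * legendre q t)"
      unfolding c by (intro sum.cong) auto
    finally show ?thesis by simp
  qed
  then show ?case by blast
qed

lemma power_in_legendre_span: "\<exists>c. \<forall>t. t ^ k = (\<Sum>q\<le>k. c q * legendre q t)"
  using poly_in_legendre_span[of "monom 1 k" k] by (simp add: poly_monom degree_monom_eq)

section \<open>Smallest singular value and least squares\<close>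

text \<open>The squared Euclidean norm of A v. A lower bound for it in terms of the squared norm of
  v is the form in which the singular value test can be both verified and exploited.\<close>

definition quad_form :: "nat \<Rightarrow> 'j set \<Rightarrow> (nat \<Rightarrow> 'j \<Rightarrow> real) \<Rightarrow> ('j \<Rightarrow> real) \<Rightarrow> real" where
  "quad_form L J A v = (\<Sum>l<L. (\<Sum>j\<in>J. A l j * v j)\<^sup>2)"

definition gram :: "nat \<Rightarrow> (nat \<Rightarrow> 'j \<Rightarrow> real) \<Rightarrow> 'j \<Rightarrow> 'j \<Rightarrow> real" where
  "gram L A j j' = (\<Sum>l<L. A l j * A l j')"

lemma quad_form_nonneg: "0 \<le> quad_form L J A v"
  by (simp add: quad_form_def sum_nonneg)

lemma gram_inner:
  "(\<Sum>j\<in>J. u j * (\<Sum>j'\<in>J. gram L A j j' * v j')) = (\<Sum>l<L. (\<Sum>j\<in>J. A l j * u j) * (\<Sum>j\<in>J. A l j * v j))"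
proof -
  have "(\<Sum>j\<in>J. u j * (\<Sum>j'\<in>J. gram L A j j' * v j')) = (\<Sum>j\<in>J. \<Sum>j'\<in>J. \<Sum>l<L. (A l j * u j) * (A l j' * v j'))"
    by (simp add: gram_def sum_distrib_left sum_distrib_right mult_ac)
  also have "\<dots> = (\<Sum>j\<in>J. \<Sum>l<L. \<Sum>j'\<in>J. (A l j * u j) * (A l j' * v j'))"
    by (intro sum.cong refl sum.swap)
  also have "\<dots> = (\<Sum>l<L. \<Sum>j\<in>J. \<Sum>j'\<in>J. (A l j * u j) * (A l j' * v j'))"
    by (rule sum.swap)
  finally show ?thesis by (simp add: sum_product)
qed

lemma quad_form_gram: "quad_form L J A v = (\<Sum>j\<in>J. v j * (\<Sum>j'\<in>J. gram L A j j' * v j'))"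
  by (simp add: gram_inner quad_form_def power2_eq_square)

text \<open>Coefficient vectors are total functions. Prescribing the value 0 off J makes the sphere
  a closed subset of a product of compact sets, so Tychonoff's theorem applies.\<close>

lemma compact_unit_sphere_fun:
  fixes J :: "'j set"
  assumes "finite J"
  shows "compact {v :: 'j \<Rightarrow> real. (\<forall>j. j \<notin> J \<longrightarrow> v j = 0) \<and> (\<Sum>j\<in>J. (v j)\<^sup>2) = 1}"
proof -
  define S where "S = (\<lambda>j. if j \<in> J then {-1..1} else {0 :: real})"
  have "compactin (product_topology (\<lambda>_. euclidean) UNIV) (PiE UNIV S)"
    by (subst compactin_PiE) (simp add: S_def)
  then have "compact (PiE UNIV S)"
    by (simp add: euclidean_product_topology)
  moreover have "closed {v :: 'j \<Rightarrow> real. (\<Sum>j\<in>J. (v j)\<^sup>2) = 1}"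
    by (intro closed_Collect_eq continuous_intros continuous_on_product_coordinates)
  ultimately have "compact (PiE UNIV S \<inter> {v. (\<Sum>j\<in>J. (v j)\<^sup>2) = 1})"
    by (rule compact_Int_closed)
  moreover have "PiE UNIV S \<inter> {v. (\<Sum>j\<in>J. (v j)\<^sup>2) = 1}
      = {v. (\<forall>j. j \<notin> J \<longrightarrow> v j = 0) \<and> (\<Sum>j\<in>J. (v j)\<^sup>2) = 1}"
  proof (intro equalityI subsetI)
    fix v :: "'j \<Rightarrow> real" assume v: "v \<in> {v. (\<forall>j. j \<notin> J \<longrightarrow> v j = 0) \<and> (\<Sum>j\<in>J. (v j)\<^sup>2) = 1}"
    have "\<bar>v j\<bar> \<le> 1" if "j \<in> J" for j
    proof -
      have "(v j)\<^sup>2 \<le> (\<Sum>j\<in>J. (v j)\<^sup>2)" using assms that by (intro member_le_sum) auto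
      then show ?thesis using v by (simp add: abs_square_le_1)
    qed
    then show "v \<in> PiE UNIV S \<inter> {v. (\<Sum>j\<in>J. (v j)\<^sup>2) = 1}"
      using v by (auto simp: S_def abs_le_iff minus_le_iff PiE_UNIV_domain)
  qed (auto simp: S_def PiE_UNIV_domain Pi_iff split: if_splits)
  ultimately show ?thesis by simp
qed

definition gram_eigenvalues :: "nat \<Rightarrow> 'j set \<Rightarrow> (nat \<Rightarrow> 'j \<Rightarrow> real) \<Rightarrow> real set" where
  "gram_eigenvalues L J A = {e. \<exists>v. (\<exists>j\<in>J. v j \<noteq> 0) \<and>
     (\<forall>j\<in>J. (\<Sum>j'\<in>J. gram L A j j' * v j') = e * v j)}"

lemma smallest_sv_eq: "smallest_sv L J A = sqrt (Min (gram_eigenvalues L J A))"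
  by (simp add: smallest_sv_def gram_eigenvalues_def gram_def)

lemma quad_form_eigen:
  assumes "\<forall>j\<in>J. (\<Sum>j'\<in>J. gram L A j j' * v j') = e * v j"
  shows "quad_form L J A v = e * (\<Sum>j\<in>J. (v j)\<^sup>2)"
  using assms by (simp add: quad_form_gram sum_distrib_left power2_eq_square mult_ac)

lemma sum_squares_pos: "finite J \<Longrightarrow> j \<in> J \<Longrightarrow> v j \<noteq> 0 \<Longrightarrow> (\<Sum>j\<in>J. (v j)\<^sup>2) > (0 :: real)"
  by (rule sum_pos2[of J j]) auto

text \<open>A minimiser of the Rayleigh quotient is an eigenvector.\<close>

lemma gram_min_eigenvalue:
  assumes "finite J" "J \<noteq> {}"
  shows "\<exists>m\<in>gram_eigenvalues L J A. \<forall>v. m * (\<Sum>j\<in>J. (v j)\<^sup>2) \<le> quad_form L J A v"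
proof -
  let ?S = "{v :: 'a \<Rightarrow> real. (\<forall>j. j \<notin> J \<longrightarrow> v j = 0) \<and> (\<Sum>j\<in>J. (v j)\<^sup>2) = 1}"
  obtain j0 where j0: "j0 \<in> J" using assms by auto
  have "(\<lambda>j. if j = j0 then 1 else 0) \<in> ?S"
  proof -
    have "(\<Sum>j\<in>J. (if j = j0 then 1 else 0)\<^sup>2) = (\<Sum>j\<in>J. if j = j0 then 1 else (0 :: real))"
      by (intro sum.cong) auto
    then show ?thesis using j0 assms by auto
  qed
  then have ne: "?S \<noteq> {}" by (metis empty_iff)
  have cont: "continuous_on ?S (quad_form L J A)"
    unfolding quad_form_def
    by (intro continuous_intros continuous_on_subset[OF continuous_on_product_coordinates]) auto
  obtain w where w: "w \<in> ?S" "\<And>v. v \<in> ?S \<Longrightarrow> quad_form L J A w \<le> quad_form L J A v"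
    using continuous_attains_inf[OF compact_unit_sphere_fun[OF assms(1)] ne cont] by blast
  define m where "m = quad_form L J A w"
  have w1: "(\<Sum>j\<in>J. (w j)\<^sup>2) = 1" using w by simp
  have le: "m * (\<Sum>j\<in>J. (v j)\<^sup>2) \<le> quad_form L J A v" for v
  proof (cases "(\<Sum>j\<in>J. (v j)\<^sup>2) = 0")
    case True
    then show ?thesis by (simp add: quad_form_nonneg)
  next
    case False
    define s where "s = sqrt (\<Sum>j\<in>J. (v j)\<^sup>2)"
    have s: "s > 0" "s\<^sup>2 = (\<Sum>j\<in>J. (v j)\<^sup>2)"
      using False by (auto simp: s_def sum_nonneg less_le)
    define u where "u j = (if j \<in> J then v j / s else 0)" for j
    have "(\<Sum>j\<in>J. (u j)\<^sup>2) = (\<Sum>j\<in>J. (v j)\<^sup>2) / s\<^sup>2"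
      by (simp add: u_def power_divide sum_divide_distrib)
    then have "(\<Sum>j\<in>J. (u j)\<^sup>2) = 1" using s(1) by (simp flip: s(2))
    then have "u \<in> ?S" by (simp add: u_def)
    then have "m \<le> quad_form L J A u" unfolding m_def by (rule w)
    also have "\<dots> = quad_form L J A v / s\<^sup>2"
      by (simp add: quad_form_def u_def sum_divide_distrib[symmetric] power_divide)
    finally have "m * s\<^sup>2 \<le> quad_form L J A v" using s(1) by (simp add: field_simps)
    then show ?thesis by (simp only: s(2))
  qed
  have eig: "(\<Sum>j'\<in>J. gram L A j j' * w j') = m * w j" if j: "j \<in> J" for j
  proof -
    define d where "d = (\<Sum>j'\<in>J. gram L A j j' * w j') - m * w j"
    define a where "a = (\<Sum>l<L. (A l j)\<^sup>2) - m"
    \<comment> \<open>The minimiser \<open>w\<close> is compared with \<open>w\<close> perturbed by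
      \<open>t\<close> in coordinate \<open>j\<close>. The resulting quadratic in \<open>t\<close>
      is nonnegative and vanishes at 0, which forces its linear coefficient \<open>2 d\<close> to be
      zero.\<close>
    have "0 \<le> 2 * t * d + t\<^sup>2 * a" for t
    proof -
      define v where "v j' = w j' + (if j' = j then t else 0)" for j'
      have "(\<Sum>j\<in>J. A l j * v j) = (\<Sum>j\<in>J. A l j * w j) + t * A l j" for l
      proof -
        have "(\<Sum>j'\<in>J. A l j' * v j') = (\<Sum>j'\<in>J. A l j' * w j' + (if j' = j then t * A l j else 0))"
          by (intro sum.cong) (auto simp: v_def algebra_simps)
        then show ?thesis using j assms by (simp add: sum.distrib)
      qed
      then have q: "quad_form L J A v = m + 2 * t * (\<Sum>l<L. A l j * (\<Sum>j\<in>J. A l j * w j)) + t\<^sup>2 * (\<Sum>l<L. (A l j)\<^sup>2)"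
        by (simp add: quad_form_def m_def power2_sum sum.distrib sum_distrib_left power_mult_distrib mult_ac)
      have g: "(\<Sum>l<L. A l j * (\<Sum>j\<in>J. A l j * w j)) = (\<Sum>j'\<in>J. gram L A j j' * w j')"
        by (simp add: gram_def sum_distrib_left sum_distrib_right mult_ac) (rule sum.swap)
      have "(\<Sum>j\<in>J. (v j)\<^sup>2) = (\<Sum>j'\<in>J. (w j')\<^sup>2 + (if j' = j then 2 * t * w j + t\<^sup>2 else 0))"
        by (intro sum.cong) (auto simp: v_def power2_sum)
      also have "\<dots> = 1 + 2 * t * w j + t\<^sup>2"
        using j assms w1 by (simp add: sum.distrib)
      finally have "m * (1 + 2 * t * w j + t\<^sup>2) \<le> quad_form L J A v" using le[of v] by simp
      then show ?thesis unfolding q g d_def a_def by (simp add: algebra_simps)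
    qed
    note pos = this
    have "d = 0"
    proof (rule ccontr)
      assume d: "d \<noteq> 0"
      \<comment> \<open>Any positive \<open>c\<close> above \<open>a\<close> works: at
        \<open>t = - d / c\<close> the quadratic is at most \<open>- d^2 / c\<close>.\<close>
      define c where "c = \<bar>a\<bar> + 1"
      have c: "c > 0" "a \<le> c" by (auto simp: c_def)
      have "0 \<le> 2 * (- d / c) * d + (- d / c)\<^sup>2 * a" by (rule pos)
      also have "\<dots> \<le> 2 * (- d / c) * d + (- d / c)\<^sup>2 * c"
        using c by (intro add_left_mono mult_left_mono) auto
      also have "\<dots> = - (d\<^sup>2 / c)" using c by (simp add: power2_eq_square field_simps)
      also have "\<dots> < 0" using d c by simp
      finally show False by simp
    qed
    then show ?thesis by (simp add: d_def)
  qed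
  have "\<exists>j\<in>J. w j \<noteq> 0"
    using w1 by (rule contrapos_pp) simp
  with eig have "m \<in> gram_eigenvalues L J A" by (auto simp: gram_eigenvalues_def)
  with le show ?thesis by blast
qed

lemma eigenvectors_orthogonal:
  assumes "\<forall>j\<in>J. (\<Sum>j'\<in>J. gram L A j j' * v j') = a * v j"
    and "\<forall>j\<in>J. (\<Sum>j'\<in>J. gram L A j j' * w j') = b * w j" and "a \<noteq> b"
  shows "(\<Sum>j\<in>J. v j * w j) = 0"
proof -
  have "a * (\<Sum>j\<in>J. v j * w j) = (\<Sum>j\<in>J. w j * (\<Sum>j'\<in>J. gram L A j j' * v j'))"
    using assms(1) by (simp add: sum_distrib_left mult_ac)
  also have "\<dots> = (\<Sum>j\<in>J. v j * (\<Sum>j'\<in>J. gram L A j j' * w j'))"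
    unfolding gram_inner by (simp add: mult.commute)
  also have "\<dots> = b * (\<Sum>j\<in>J. v j * w j)"
    using assms(2) by (simp add: sum_distrib_left mult_ac)
  finally show ?thesis using assms(3) by simp
qed

text \<open>Summing Bessel's inequality for the coordinate vectors bounds the size of an orthonormal family.\<close>

lemma orthonormal_card_le:
  fixes e :: "'a \<Rightarrow> 'j \<Rightarrow> real"
  assumes "finite J" "finite E"
    and ortho: "\<And>a b. a \<in> E \<Longrightarrow> b \<in> E \<Longrightarrow> (\<Sum>j\<in>J. e a j * e b j) = (if a = b then 1 else 0)"
  shows "card E \<le> card J"
proof -
  have bessel: "(\<Sum>a\<in>E. (e a k)\<^sup>2) \<le> 1" if k: "k \<in> J" for k
  proof -
    define r where "r j = (\<Sum>a\<in>E. e a k * e a j)" for j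
    have rr: "(\<Sum>j\<in>J. r j * r j) = (\<Sum>a\<in>E. (e a k)\<^sup>2)"
    proof -
      have "(\<Sum>j\<in>J. r j * r j) = (\<Sum>j\<in>J. \<Sum>a\<in>E. \<Sum>b\<in>E. (e a k * e b k) * (e a j * e b j))"
        by (simp add: r_def sum_product mult_ac)
      also have "\<dots> = (\<Sum>a\<in>E. \<Sum>j\<in>J. \<Sum>b\<in>E. (e a k * e b k) * (e a j * e b j))"
        by (rule sum.swap)
      also have "\<dots> = (\<Sum>a\<in>E. \<Sum>b\<in>E. \<Sum>j\<in>J. (e a k * e b k) * (e a j * e b j))"
        by (intro sum.cong refl sum.swap)
      also have "\<dots> = (\<Sum>a\<in>E. \<Sum>b\<in>E. (e a k * e b k) * (if a = b then 1 else 0))"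
        by (intro sum.cong refl) (simp only: ortho flip: sum_distrib_left)
      also have "\<dots> = (\<Sum>a\<in>E. \<Sum>b\<in>E. if b = a then (e a k)\<^sup>2 else 0)"
        by (intro sum.cong) (auto simp: power2_eq_square)
      also have "\<dots> = (\<Sum>a\<in>E. (e a k)\<^sup>2)"
        using assms(2) by simp
      finally show ?thesis .
    qed
    have "0 \<le> (\<Sum>j\<in>J. ((if j = k then 1 else 0) - r j)\<^sup>2)" by (simp add: sum_nonneg)
    also have "\<dots> = (\<Sum>j\<in>J. (if j = k then 1 - 2 * r k else 0) + r j * r j)"
      by (intro sum.cong) (auto simp: power2_eq_square algebra_simps)
    also have "\<dots> = 1 - 2 * r k + (\<Sum>a\<in>E. (e a k)\<^sup>2)"
      using k assms(1) by (simp add: sum.distrib rr)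
    also have "r k = (\<Sum>a\<in>E. (e a k)\<^sup>2)" by (simp add: r_def power2_eq_square)
    finally show ?thesis by simp
  qed
  have "real (card E) = (\<Sum>a\<in>E. \<Sum>j\<in>J. (e a j)\<^sup>2)"
    using ortho by (simp add: power2_eq_square)
  also have "\<dots> = (\<Sum>j\<in>J. \<Sum>a\<in>E. (e a j)\<^sup>2)" by (rule sum.swap)
  also have "\<dots> \<le> (\<Sum>j\<in>J. 1)" by (intro sum_mono bessel)
  finally show ?thesis by simp
qed

text \<open>Normalised eigenvectors to distinct eigenvalues of the symmetric Gram matrix are
  orthonormal, so there are at most \<open>card J\<close> of them. Finiteness is what gives
  \<open>Min\<close> in \<open>smallest_sv\<close> its meaning.\<close>

lemma finite_gram_eigenvalues:
  assumes "finite J"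
  shows "finite (gram_eigenvalues L J A)"
proof (rule ccontr)
  assume "infinite (gram_eigenvalues L J A)"
  then obtain E where E: "finite E" "card E = Suc (card J)" "E \<subseteq> gram_eigenvalues L J A"
    using infinite_arbitrarily_large by blast
  have "\<forall>a\<in>E. \<exists>v. (\<exists>j\<in>J. v j \<noteq> 0) \<and> (\<forall>j\<in>J. (\<Sum>j'\<in>J. gram L A j j' * v j') = a * v j)"
    using E(3) by (auto simp: gram_eigenvalues_def)
  then obtain v where v: "\<And>a. a \<in> E \<Longrightarrow> \<exists>j\<in>J. v a j \<noteq> 0"
    and ev: "\<And>a. a \<in> E \<Longrightarrow> \<forall>j\<in>J. (\<Sum>j'\<in>J. gram L A j j' * v a j') = a * v a j"
    by metis
  define s where "s a = (\<Sum>j\<in>J. (v a j)\<^sup>2)" for a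
  have s: "s a > 0" if "a \<in> E" for a
    using v[OF that] sum_squares_pos[OF assms] by (auto simp: s_def)
  have "card E \<le> card J"
  proof (rule orthonormal_card_le[OF assms E(1), where e = "\<lambda>a j. v a j / sqrt (s a)"])
    fix a b assume ab: "a \<in> E" "b \<in> E"
    have "(\<Sum>j\<in>J. v a j / sqrt (s a) * (v b j / sqrt (s b))) = (\<Sum>j\<in>J. v a j * v b j) / (sqrt (s a) * sqrt (s b))"
      by (simp add: sum_divide_distrib)
    also have "\<dots> = (if a = b then 1 else 0)"
      using eigenvectors_orthogonal[OF ev ev, of a b] ab s[of a] by (auto simp: s_def power2_eq_square)
    finally show "(\<Sum>j\<in>J. v a j / sqrt (s a) * (v b j / sqrt (s b))) = (if a = b then 1 else 0)" .
  qed
  with E(2) show False by simp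
qed

text \<open>The minimal Rayleigh quotient is an eigenvalue and lies below every other one, so it is
  the \<open>Min\<close>; being nonnegative, it is recovered by squaring the root. From here on the
  test is handled only through \<open>quad_form\<close>.\<close>

lemma smallest_sv_le_iff:
  assumes "finite J" "J \<noteq> {}" "t \<ge> 0"
  shows "t \<le> (smallest_sv L J A)\<^sup>2 \<longleftrightarrow> (\<forall>v. t * (\<Sum>j\<in>J. (v j)\<^sup>2) \<le> quad_form L J A v)"
proof -
  obtain m where m: "m \<in> gram_eigenvalues L J A" "\<And>v. m * (\<Sum>j\<in>J. (v j)\<^sup>2) \<le> quad_form L J A v"
    using gram_min_eigenvalue[OF assms(1,2)] by blast
  have le: "t \<le> e" if "e \<in> gram_eigenvalues L J A" "\<forall>v. t * (\<Sum>j\<in>J. (v j)\<^sup>2) \<le> quad_form L J A v" for e t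
  proof -
    obtain v j where v: "j \<in> J" "v j \<noteq> 0" "\<forall>j\<in>J. (\<Sum>j'\<in>J. gram L A j j' * v j') = e * v j"
      using \<open>e \<in> _\<close> by (auto simp: gram_eigenvalues_def)
    have "t * (\<Sum>j\<in>J. (v j)\<^sup>2) \<le> e * (\<Sum>j\<in>J. (v j)\<^sup>2)"
      using that(2) quad_form_eigen[OF v(3)] by metis
    then show ?thesis using sum_squares_pos[of J j v] v assms(1) by simp
  qed
  have "Min (gram_eigenvalues L J A) = m"
    by (rule Min_eqI) (use finite_gram_eigenvalues[OF assms(1)] m le in auto)
  moreover have "0 \<le> m"
    using le[OF m(1), of 0] quad_form_nonneg by auto
  ultimately have sv: "(smallest_sv L J A)\<^sup>2 = m"
    by (simp add: smallest_sv_eq)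
  show ?thesis
  proof
    assume "t \<le> (smallest_sv L J A)\<^sup>2"
    then have "t * (\<Sum>j\<in>J. (v j)\<^sup>2) \<le> m * (\<Sum>j\<in>J. (v j)\<^sup>2)" for v
      unfolding sv by (intro mult_right_mono sum_nonneg) auto
    with m(2) show "\<forall>v. t * (\<Sum>j\<in>J. (v j)\<^sup>2) \<le> quad_form L J A v"
      using order_trans by blast
  next
    assume "\<forall>v. t * (\<Sum>j\<in>J. (v j)\<^sup>2) \<le> quad_form L J A v"
    then show "t \<le> (smallest_sv L J A)\<^sup>2" using le m(1) sv by metis
  qed
qed

section \<open>Least squares: normal equations and coefficient error\<close>

text \<open>Gram-Schmidt by induction on the columns. The induction hypothesis is used twice, for
  the data and for the new column itself, and the residual of the data is then projected onto the
  residual of the new column.\<close>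

lemma normal_equations_exist:
  fixes A :: "nat \<Rightarrow> 'j \<Rightarrow> real"
  assumes "finite J"
  shows "\<exists>\<alpha>. \<forall>j\<in>J. (\<Sum>l<L. A l j * (Y l - (\<Sum>j'\<in>J. A l j' * \<alpha> j'))) = (0 :: real)"
  using assms
proof (induction J arbitrary: Y rule: finite_induct)
  case (insert k J)
  obtain \<beta> where \<beta>: "\<And>j. j \<in> J \<Longrightarrow> (\<Sum>l<L. A l j * (Y l - (\<Sum>j'\<in>J. A l j' * \<beta> j'))) = 0"
    using insert.IH[of Y] by blast
  obtain \<gamma> where \<gamma>: "\<And>j. j \<in> J \<Longrightarrow> (\<Sum>l<L. A l j * (A l k - (\<Sum>j'\<in>J. A l j' * \<gamma> j'))) = 0"
    using insert.IH[of "\<lambda>l. A l k"] by blast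
  define r where "r l = A l k - (\<Sum>j'\<in>J. A l j' * \<gamma> j')" for l
  define z where "z l = Y l - (\<Sum>j'\<in>J. A l j' * \<beta> j')" for l
  \<comment> \<open>If the new column depends linearly on the old ones, then \<open>r\<close>
    vanishes, the quotient is 0 by convention, and the new equation holds trivially.\<close>
  define c where "c = (\<Sum>l<L. r l * z l) / (\<Sum>l<L. r l * r l)"
  define \<alpha> where "\<alpha> j = (if j = k then c else \<beta> j - c * \<gamma> j)" for j
  have res: "Y l - (\<Sum>j'\<in>insert k J. A l j' * \<alpha> j') = z l - c * r l" for l
  proof -
    have "(\<Sum>j'\<in>J. A l j' * \<alpha> j') = (\<Sum>j'\<in>J. A l j' * \<beta> j' - c * (A l j' * \<gamma> j'))"
      using insert.hyps by (intro sum.cong) (auto simp: \<alpha>_def algebra_simps)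
    then show ?thesis
      using insert.hyps by (simp add: \<alpha>_def z_def r_def sum_subtractf algebra_simps flip: sum_distrib_left)
  qed
  have z: "(\<Sum>l<L. A l j * z l) = 0" and r: "(\<Sum>l<L. A l j * r l) = 0" if "j \<in> J" for j
    using \<beta> \<gamma> that by (simp_all add: z_def r_def)
  have J0: "(\<Sum>l<L. A l j * (z l - c * r l)) = 0" if "j \<in> J" for j
    using z[OF that] r[OF that]
    by (simp add: right_diff_distrib sum_subtractf mult.left_commute[of _ c] flip: sum_distrib_left)
  have "(\<Sum>l<L. r l * (z l - c * r l)) = (\<Sum>l<L. r l * z l) - c * (\<Sum>l<L. r l * r l)"
    by (simp add: right_diff_distrib sum_subtractf mult.left_commute[of _ c] flip: sum_distrib_left)
  also have "\<dots> = 0"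
  proof (cases "(\<Sum>l<L. r l * r l) = 0")
    case True
    then have "\<forall>l<L. r l = 0" by (subst (asm) sum_nonneg_eq_0_iff) auto
    then show ?thesis by simp
  qed (simp add: c_def)
  finally have r0: "(\<Sum>l<L. r l * (z l - c * r l)) = 0" .
  have "(\<Sum>l<L. A l k * (z l - c * r l))
      = (\<Sum>l<L. r l * (z l - c * r l)) + (\<Sum>l<L. (\<Sum>j\<in>J. A l j * \<gamma> j) * (z l - c * r l))"
    by (simp add: r_def algebra_simps flip: sum.distrib)
  also have "(\<Sum>l<L. (\<Sum>j\<in>J. A l j * \<gamma> j) * (z l - c * r l)) = (\<Sum>l<L. \<Sum>j\<in>J. \<gamma> j * (A l j * (z l - c * r l)))"
    by (intro sum.cong refl) (subst sum_distrib_right, simp add: mult_ac)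
  also have "\<dots> = (\<Sum>j\<in>J. \<Sum>l<L. \<gamma> j * (A l j * (z l - c * r l)))"
    by (rule sum.swap)
  also have "\<dots> = 0"
    by (simp add: J0 flip: sum_distrib_left)
  finally have "(\<Sum>l<L. A l k * (z l - c * r l)) = 0" using r0 by simp
  with J0 show ?case
    by (intro exI[of _ \<alpha>]) (auto simp: res)
qed simp

text \<open>Coercivity of the Gram matrix makes the least-squares solution unique on
  \<open>extensional J\<close>, which identifies \<open>pinv_apply\<close>. By Pythagoras the
  residual of any competitor splits into the optimal residual and the \<open>quad_form\<close> of
  the coefficient difference, so the residual of a good competitor controls the distance to
  it.\<close>

lemma pinv_apply_error:
  assumes J: "finite J" and t: "t > 0" "\<And>v. t * (\<Sum>j\<in>J. (v j)\<^sup>2) \<le> quad_form L J A v"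
  shows "t * (\<Sum>j\<in>J. (pinv_apply L J A Y j - \<beta> j)\<^sup>2) \<le> rss L J A Y \<beta>"
proof -
  obtain \<alpha>0 where \<alpha>0: "\<And>j. j \<in> J \<Longrightarrow> (\<Sum>l<L. A l j * (Y l - (\<Sum>j'\<in>J. A l j' * \<alpha>0 j'))) = 0"
    using normal_equations_exist[OF J] by blast
  \<comment> \<open>Values off \<open>J\<close> do not enter the normal equations; restricting fixes
    them, so that equality on \<open>J\<close> becomes equality of functions.\<close>
  define \<alpha> where "\<alpha> = restrict \<alpha>0 J"
  define z where "z l = Y l - (\<Sum>j'\<in>J. A l j' * \<alpha> j')" for l
  have z: "(\<Sum>l<L. A l j * z l) = 0" if "j \<in> J" for j
    using \<alpha>0[OF that] by (simp add: z_def \<alpha>_def)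
  have pyth: "rss L J A Y \<beta> = rss L J A Y \<alpha> + quad_form L J A (\<lambda>j. \<alpha> j - \<beta> j)" for \<beta>
  proof -
    let ?d = "\<lambda>l. \<Sum>j\<in>J. A l j * (\<alpha> j - \<beta> j)"
    have "(\<Sum>l<L. z l * ?d l) = (\<Sum>l<L. \<Sum>j\<in>J. (\<alpha> j - \<beta> j) * (A l j * z l))"
      by (simp only: sum_distrib_left mult_ac)
    also have "\<dots> = (\<Sum>j\<in>J. \<Sum>l<L. (\<alpha> j - \<beta> j) * (A l j * z l))"
      by (rule sum.swap)
    also have "\<dots> = 0" by (simp add: z flip: sum_distrib_left)
    finally have zd: "(\<Sum>l<L. z l * ?d l) = 0" .
    have "rss L J A Y \<beta> = (\<Sum>l<L. (z l + ?d l)\<^sup>2)"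
      by (simp add: rss_def z_def right_diff_distrib sum_subtractf)
    also have "\<dots> = (\<Sum>l<L. (z l)\<^sup>2) + (\<Sum>l<L. (?d l)\<^sup>2) + 2 * (\<Sum>l<L. z l * ?d l)"
      by (simp only: power2_sum sum.distrib sum_distrib_left mult.assoc)
    finally show ?thesis unfolding zd by (simp add: rss_def z_def quad_form_def)
  qed
  have opt: "rss L J A Y \<alpha> \<le> rss L J A Y \<beta>" for \<beta>
    unfolding pyth[of \<beta>] by (simp add: quad_form_nonneg)
  have uniq: "\<beta> = \<alpha>" if "\<beta> \<in> extensional J" "rss L J A Y \<beta> \<le> rss L J A Y \<alpha>" for \<beta>
  proof (rule extensionalityI[of \<beta> J \<alpha>])
    fix j assume j: "j \<in> J"
    have "quad_form L J A (\<lambda>j. \<alpha> j - \<beta> j) \<le> 0" using that(2) unfolding pyth[of \<beta>] by simp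
    then have "t * (\<Sum>j\<in>J. (\<alpha> j - \<beta> j)\<^sup>2) \<le> 0" using t(2)[of "\<lambda>j. \<alpha> j - \<beta> j"] by linarith
    then have "(\<Sum>j\<in>J. (\<alpha> j - \<beta> j)\<^sup>2) \<le> 0" using t(1) by (simp add: mult_le_0_iff)
    then show "\<beta> j = \<alpha> j" using sum_squares_pos[OF J j, of "\<lambda>j. \<alpha> j - \<beta> j"] by force
  qed (use that in \<open>auto simp: \<alpha>_def\<close>)
  have "pinv_apply L J A Y = \<alpha>"
    unfolding pinv_apply_def
  proof (rule the_equality)
    show "\<alpha> \<in> extensional J \<and> (\<forall>\<beta>\<in>extensional J. rss L J A Y \<alpha> \<le> rss L J A Y \<beta>) \<and>
        (\<forall>\<beta>\<in>extensional J. (\<forall>\<gamma>\<in>extensional J. rss L J A Y \<beta> \<le> rss L J A Y \<gamma>) \<longrightarrow>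
             (\<Sum>j\<in>J. (\<alpha> j)\<^sup>2) \<le> (\<Sum>j\<in>J. (\<beta> j)\<^sup>2))"
      using opt uniq by (fastforce simp: \<alpha>_def)
  qed (use uniq in \<open>auto simp: \<alpha>_def\<close>)
  then have "t * (\<Sum>j\<in>J. (pinv_apply L J A Y j - \<beta> j)\<^sup>2) \<le> quad_form L J A (\<lambda>j. \<alpha> j - \<beta> j)"
    using t(2)[of "\<lambda>j. \<alpha> j - \<beta> j"] by simp
  also have "\<dots> \<le> rss L J A Y \<beta>"
    unfolding pyth[of \<beta>] by (simp add: rss_def sum_nonneg)
  finally show ?thesis .
qed

section \<open>Taylor expansion in several variables\<close>

lemma Cb_Suc_pdiff:
  assumes "Cb k f" "length is < k"
  shows "((\<lambda>t. pdiff f is (x + t *\<^sub>R axis i 1)) has_real_derivative pdiff f (i # is) x) (at 0)"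
proof -
  have "(\<lambda>t. pdiff f is (x + t *\<^sub>R axis i 1)) differentiable (at 0)"
    using assms by (auto simp: Cb_def)
  then show ?thesis
    by (simp add: DERIV_deriv_iff_real_differentiable)
qed

lemma Cb_pdiff_axis_derivative:
  assumes "Cb k f" "length is < k"
  shows "((\<lambda>t. pdiff f is (x + t *\<^sub>R axis i 1)) has_real_derivative pdiff f (i # is) (x + s *\<^sub>R axis i 1)) (at s)"
proof -
  have "((\<lambda>t. pdiff f is (x + (t + s) *\<^sub>R axis i 1)) has_real_derivative pdiff f (i # is) (x + s *\<^sub>R axis i 1)) (at 0)"
    using Cb_Suc_pdiff[OF assms, of "x + s *\<^sub>R axis i 1" i] by (simp add: algebra_simps)
  then show ?thesis
    using DERIV_shift[of "\<lambda>t. pdiff f is (x + t *\<^sub>R axis i 1)" _ 0 s] by (simp add: add.commute)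
qed

lemma Cb_continuous: "Cb k f \<Longrightarrow> length is \<le> k \<Longrightarrow> continuous_on UNIV (pdiff f is)"
  by (auto simp: Cb_def)

text \<open>Continuous partial derivatives give total differentiability: change one coordinate at a time.\<close>

lemma Cb_differential_aux:
  fixes f :: "real^'d::finite \<Rightarrow> real"
  assumes Cb: "Cb k f" and len: "length is < k" and "finite S" and "e > 0"
  shows "\<exists>\<delta>>0. \<forall>v. norm v < \<delta> \<longrightarrow> (\<forall>d. d \<notin> S \<longrightarrow> v $ d = 0) \<longrightarrow>
     \<bar>pdiff f is (x + v) - pdiff f is x - (\<Sum>d\<in>S. v $ d * pdiff f (d # is) x)\<bar> \<le> e * norm v * real (card S)"
  using \<open>finite S\<close>
proof (induction S rule: finite_induct)
  case empty
  have "v = 0" if "\<forall>d. v $ d = 0" for v :: "real^'d" using that by (simp add: vec_eq_iff)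
  then show ?case by (intro exI[of _ 1]) force
next
  case (insert k' S)
  obtain \<delta>1 where d1: "\<delta>1 > 0" and IH: "\<And>v. norm v < \<delta>1 \<Longrightarrow> (\<forall>d. d \<notin> S \<longrightarrow> v $ d = 0) \<Longrightarrow>
     \<bar>pdiff f is (x + v) - pdiff f is x - (\<Sum>d\<in>S. v $ d * pdiff f (d # is) x)\<bar> \<le> e * norm v * real (card S)"
    using insert.IH by blast
  have "isCont (pdiff f (k' # is)) x"
    using Cb_continuous[OF Cb, of "k' # is"] len
    by (metis Suc_leI continuous_on_eq_continuous_at UNIV_I length_Cons open_UNIV)
  then obtain \<delta>2 where d2: "\<delta>2 > 0" "\<And>z. dist z x < \<delta>2 \<Longrightarrow> dist (pdiff f (k' # is) z) (pdiff f (k' # is) x) < e"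
    using assms(4) unfolding continuous_at_eps_delta by blast
  show ?case
  proof (intro exI[of _ "min \<delta>1 \<delta>2"] conjI allI impI)
    fix v :: "real^'d" assume v: "norm v < min \<delta>1 \<delta>2" "\<forall>d. d \<notin> insert k' S \<longrightarrow> v $ d = 0"
    define w :: "real^'d" where "w = (\<chi> d. if d = k' then 0 else v $ d)"
    have wle: "norm w \<le> norm v" by (rule norm_le_componentwise_cart) (simp add: w_def)
    have vw: "v = w + v $ k' *\<^sub>R axis k' 1" by (simp add: vec_eq_iff w_def axis_def)
    define g where "g t = pdiff f is (x + w + t *\<^sub>R axis k' 1)" for t
    have g': "(g has_real_derivative pdiff f (k' # is) (x + w + t *\<^sub>R axis k' 1)) (at t)" for t
      unfolding g_def by (rule Cb_pdiff_axis_derivative[OF Cb len])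
    have seg: "norm (w + t *\<^sub>R axis k' 1) \<le> norm v" if "\<bar>t\<bar> \<le> \<bar>v $ k'\<bar>" for t
      by (rule norm_le_componentwise_cart) (use that in \<open>auto simp: w_def axis_def\<close>)
    \<comment> \<open>Mean value theorem along coordinate \<open>k'\<close>, with the sign of
      \<open>v $ k'\<close> deciding the order of the end points. The bound on \<open>t\<close>
      keeps the intermediate point within distance \<open>norm v\<close> of
      \<open>x\<close>.\<close>
    have "\<exists>t. \<bar>t\<bar> \<le> \<bar>v $ k'\<bar> \<and> g (v $ k') - g 0 = v $ k' * pdiff f (k' # is) (x + w + t *\<^sub>R axis k' 1)"
    proof -
      consider "v $ k' = 0" | "v $ k' > 0" | "v $ k' < 0" by linarith
      then show ?thesis
      proof cases
        case 1 then show ?thesis by (intro exI[of _ 0]) simp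
      next
        case 2 from MVT2[OF this g'] show ?thesis by force
      next
        case 3 from MVT2[OF this g'] obtain z where "v $ k' < z" "z < 0"
          "g 0 - g (v $ k') = (0 - v $ k') * pdiff f (k' # is) (x + w + z *\<^sub>R axis k' 1)" by blast
        then show ?thesis by (intro exI[of _ z]) (simp add: algebra_simps)
      qed
    qed
    then obtain t where t: "\<bar>t\<bar> \<le> \<bar>v $ k'\<bar>"
        "g (v $ k') - g 0 = v $ k' * pdiff f (k' # is) (x + w + t *\<^sub>R axis k' 1)" by blast
    have gd: "g (v $ k') - g 0 = pdiff f is (x + v) - pdiff f is (x + w)"
      by (subst (2) vw) (simp add: g_def add.assoc)
    have "dist (x + w + t *\<^sub>R axis k' 1) x < \<delta>2"
      using seg[OF t(1)] v(1) by (simp add: dist_norm add.assoc)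
    then have "\<bar>pdiff f (k' # is) (x + w + t *\<^sub>R axis k' 1) - pdiff f (k' # is) x\<bar> \<le> e"
      using d2(2) by (fastforce simp: dist_real_def)
    then have "\<bar>v $ k'\<bar> * \<bar>pdiff f (k' # is) (x + w + t *\<^sub>R axis k' 1) - pdiff f (k' # is) x\<bar> \<le> norm v * e"
      using component_le_norm_cart[of v k'] by (intro mult_mono) auto
    then have 1: "\<bar>pdiff f is (x + v) - pdiff f is (x + w) - v $ k' * pdiff f (k' # is) x\<bar> \<le> e * norm v"
      unfolding gd[symmetric] t(2) by (simp add: abs_mult[symmetric] algebra_simps)
    have w0: "\<forall>d. d \<notin> S \<longrightarrow> w $ d = 0" using v(2) by (auto simp: w_def)
    have "norm w < \<delta>1" using wle v(1) by simp
    then have "\<bar>pdiff f is (x + w) - pdiff f is x - (\<Sum>d\<in>S. w $ d * pdiff f (d # is) x)\<bar> \<le> e * norm w * real (card S)"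
      using IH w0 by blast
    also have "\<dots> \<le> e * norm v * real (card S)"
      using wle assms(4) by (intro mult_right_mono mult_left_mono) auto
    also have "(\<Sum>d\<in>S. w $ d * pdiff f (d # is) x) = (\<Sum>d\<in>S. v $ d * pdiff f (d # is) x)"
      using insert.hyps by (intro sum.cong) (auto simp: w_def)
    finally have 2: "\<bar>pdiff f is (x + w) - pdiff f is x - (\<Sum>d\<in>S. v $ d * pdiff f (d # is) x)\<bar> \<le> e * norm v * real (card S)" .
    show "\<bar>pdiff f is (x + v) - pdiff f is x - (\<Sum>d\<in>insert k' S. v $ d * pdiff f (d # is) x)\<bar>
        \<le> e * norm v * real (card (insert k' S))"
      using 1 2 insert.hyps by (simp add: algebra_simps)
  qed (use d1 d2 in auto)
qed

lemma Cb_differential: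
  fixes f :: "real^'d::finite \<Rightarrow> real"
  assumes Cb: "Cb k f" and len: "length is < k"
  shows "(pdiff f is has_derivative (\<lambda>v. \<Sum>d\<in>UNIV. v $ d * pdiff f (d # is) x)) (at x)"
  unfolding has_derivative_at_alt
proof (intro conjI allI impI)
  show "bounded_linear (\<lambda>v. \<Sum>d\<in>UNIV. v $ d * pdiff f (d # is) x)"
    by (intro bounded_linear_sum bounded_linear_mult_const bounded_linear_vec_nth)
  fix e :: real assume "e > 0"
  then have "e / real CARD('d) > 0" by simp
  from Cb_differential_aux[OF Cb len finite_class.finite_UNIV this, of x]
  obtain \<delta> where "\<delta> > 0" and *: "\<And>v. norm v < \<delta> \<Longrightarrow>
     \<bar>pdiff f is (x + v) - pdiff f is x - (\<Sum>d\<in>UNIV. v $ d * pdiff f (d # is) x)\<bar> \<le> e * norm v"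
    by auto
  show "\<exists>\<delta>>0. \<forall>y. norm (y - x) < \<delta> \<longrightarrow>
      norm (pdiff f is y - pdiff f is x - (\<Sum>d\<in>UNIV. (y - x) $ d * pdiff f (d # is) x)) \<le> e * norm (y - x)"
    using \<open>\<delta> > 0\<close> *[of "_ - x"] by (intro exI[of _ \<delta>]) auto
qed

text \<open>The n-th derivative of f along v. Summing over ordered index lists takes the place of
  multinomial coefficients, and a further derivative is one more \<open>Cons\<close>, as in
  \<open>pdiff\<close>.\<close>

definition dir_deriv :: "nat \<Rightarrow> (real^'d::finite \<Rightarrow> real) \<Rightarrow> real^'d \<Rightarrow> real^'d \<Rightarrow> real" where
  "dir_deriv n f v x = (\<Sum>is | length is = n. (\<Prod>i\<leftarrow>is. v $ i) * pdiff f is x)"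

lemma sum_lists_Suc:
  fixes F :: "'d::finite list \<Rightarrow> real"
  shows "(\<Sum>is | length is = Suc n. F is) = (\<Sum>is | length is = n. \<Sum>i\<in>UNIV. F (i # is))"
proof -
  have "{is :: 'd list. length is = Suc n} = (\<lambda>(is, i). i # is) ` ({is. length is = n} \<times> UNIV)"
    by (force simp: length_Suc_conv)
  moreover have "inj_on (\<lambda>(is, i). i # is) ({is :: 'd list. length is = n} \<times> UNIV)"
    by (auto simp: inj_on_def)
  ultimately have "(\<Sum>is | length is = Suc n. F is) = (\<Sum>p\<in>{is :: 'd list. length is = n} \<times> UNIV. F (snd p # fst p))"
    by (simp add: sum.reindex case_prod_unfold)
  then show ?thesis by (simp add: sum.cartesian_product case_prod_unfold)
qed

lemma dir_deriv_has_derivative: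
  fixes f :: "real^'d::finite \<Rightarrow> real"
  assumes Cb: "Cb k f" and n: "n < k"
  shows "((\<lambda>t. dir_deriv n f v (z + t *\<^sub>R v)) has_real_derivative dir_deriv (Suc n) f v (z + t *\<^sub>R v)) (at t)"
proof -
  have 1: "((\<lambda>t. pdiff f is (z + t *\<^sub>R v)) has_real_derivative (\<Sum>d\<in>UNIV. v $ d * pdiff f (d # is) (z + t *\<^sub>R v))) (at t)"
    if "length is = n" for "is"
  proof -
    have "((\<lambda>t. z + t *\<^sub>R v) has_derivative (\<lambda>s. s *\<^sub>R v)) (at t)"
      by (auto intro!: derivative_eq_intros)
    from has_derivative_compose[OF this Cb_differential[OF Cb, of "is"]] that n
    show ?thesis
      unfolding has_field_derivative_def
      by (auto elim!: has_derivative_eq_rhs simp: fun_eq_iff sum_distrib_left mult_ac)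
  qed
  have "((\<lambda>t. dir_deriv n f v (z + t *\<^sub>R v)) has_real_derivative
     (\<Sum>is | length is = n. (\<Prod>i\<leftarrow>is. v $ i) * (\<Sum>d\<in>UNIV. v $ d * pdiff f (d # is) (z + t *\<^sub>R v)))) (at t)"
    unfolding dir_deriv_def by (intro DERIV_sum DERIV_cmult 1) simp
  then show ?thesis
    by (simp add: dir_deriv_def sum_lists_Suc sum_distrib_left mult_ac)
qed

text \<open>Multiplying out the n-th power of the l1 norm of v yields exactly the products over all
  index lists of length n.\<close>

lemma dir_deriv_bound:
  assumes "\<And>is x. length is = n \<Longrightarrow> \<bar>pdiff f is x\<bar> \<le> M"
  shows "\<bar>dir_deriv n f v x\<bar> \<le> M * (\<Sum>i\<in>UNIV. \<bar>v $ i\<bar>) ^ n"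
proof -
  have M: "0 \<le> M"
    using assms[of "replicate n undefined" 0] by simp
  have pow: "(\<Sum>is | length is = n. \<Prod>i\<leftarrow>is. \<bar>v $ i\<bar>) = (\<Sum>i\<in>UNIV. \<bar>v $ i\<bar>) ^ n"
    by (induction n) (simp_all add: sum_lists_Suc sum_distrib_left[symmetric] sum_distrib_right[symmetric] mult.commute)
  have "\<bar>dir_deriv n f v x\<bar> \<le> (\<Sum>is | length is = n. \<bar>(\<Prod>i\<leftarrow>is. v $ i) * pdiff f is x\<bar>)"
    unfolding dir_deriv_def by (rule sum_abs)
  also have "\<dots> \<le> (\<Sum>is | length is = n. (\<Prod>i\<leftarrow>is. \<bar>v $ i\<bar>) * M)"
  proof (intro sum_mono)
    fix "is" :: "'a list" assume "is \<in> {is. length is = n}"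
    moreover have "\<bar>\<Prod>i\<leftarrow>is. v $ i\<bar> = (\<Prod>i\<leftarrow>is. \<bar>v $ i\<bar>)"
      by (induction "is") (simp_all add: abs_mult)
    ultimately show "\<bar>(\<Prod>i\<leftarrow>is. v $ i) * pdiff f is x\<bar> \<le> (\<Prod>i\<leftarrow>is. \<bar>v $ i\<bar>) * M"
      using assms[of "is" x] by (auto simp: abs_mult intro!: mult_left_mono prod_list_nonneg)
  qed
  also have "\<dots> = M * (\<Sum>i\<in>UNIV. \<bar>v $ i\<bar>) ^ n"
    unfolding sum_distrib_right[symmetric] pow by (rule mult.commute)
  finally show ?thesis .
qed

lemma sum_abs_le_norm: "(\<Sum>i\<in>UNIV. \<bar>v $ i\<bar>) \<le> real CARD('d) * norm (v :: real^'d::finite)"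
  using sum_bounded_above[of UNIV "\<lambda>i. \<bar>v $ i\<bar>" "norm v"] component_le_norm_cart[of v] by simp

text \<open>Here n counts terms, so the degree is below n. The Hermite argument takes n = |\<iota>|,
  the regression takes n = Q + 1.\<close>

definition taylor_poly :: "nat \<Rightarrow> (real^'d::finite \<Rightarrow> real) \<Rightarrow> real^'d \<Rightarrow> real^'d \<Rightarrow> real" where
  "taylor_poly n f z v = (\<Sum>k<n. dir_deriv k f v z / fact k)"

text \<open>Maclaurin's formula for t -> f(z + t v) at t = 1. Discarding 1/n! and bounding the l1
  norm by D times the Euclidean one leaves a constant that depends on f only through M.\<close>

lemma taylor_poly_error:
  fixes f :: "real^'d::finite \<Rightarrow> real"
  assumes Cb: "Cb k f" and n: "n \<le> k" and M: "\<And>is x. length is = n \<Longrightarrow> \<bar>pdiff f is x\<bar> \<le> M"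
  shows "\<bar>f (z + v) - taylor_poly n f z v\<bar> \<le> M * (real CARD('d) * norm v) ^ n"
proof (cases "n = 0")
  case True
  then show ?thesis using M[of "[]" "z + v"] by (simp add: taylor_poly_def)
next
  case False
  have M0: "0 \<le> M" using M[of "replicate n undefined" 0] by simp
  have "\<exists>t>0. t < 1 \<and> dir_deriv 0 f v (z + 1 *\<^sub>R v)
      = (\<Sum>m<n. dir_deriv m f v (z + 0 *\<^sub>R v) / fact m * 1 ^ m) + dir_deriv n f v (z + t *\<^sub>R v) / fact n * 1 ^ n"
    by (rule Maclaurin[where f = "\<lambda>t. dir_deriv 0 f v (z + t *\<^sub>R v)" and h = 1])
       (use False n in \<open>auto intro!: dir_deriv_has_derivative[OF Cb]\<close>)
  then obtain t where "dir_deriv 0 f v (z + v) = taylor_poly n f z v + dir_deriv n f v (z + t *\<^sub>R v) / fact n"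
    by (auto simp: taylor_poly_def)
  then have "\<bar>f (z + v) - taylor_poly n f z v\<bar> = \<bar>dir_deriv n f v (z + t *\<^sub>R v)\<bar> / fact n"
    by (simp add: dir_deriv_def)
  also have "\<dots> \<le> \<bar>dir_deriv n f v (z + t *\<^sub>R v)\<bar> / 1"
    by (intro divide_left_mono) auto
  also have "\<dots> \<le> M * (\<Sum>i\<in>UNIV. \<bar>v $ i\<bar>) ^ n"
    using dir_deriv_bound[OF M] by simp
  also have "\<dots> \<le> M * (real CARD('d) * norm v) ^ n"
    using M0 by (intro mult_left_mono power_mono sum_abs_le_norm sum_nonneg) auto
  finally show ?thesis .
qed

text \<open>A real supremum bounds its members only if the set is bounded above; this holds because
  there are finitely many index lists of length at most k and each derivative is bounded.\<close>

lemma Cb_norm_bound: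
  fixes f :: "real^'d::finite \<Rightarrow> real"
  assumes "Cb k f" "length is \<le> k"
  shows "\<bar>pdiff f is x\<bar> \<le> Cb_norm k f"
proof -
  have "bdd_above ((\<lambda>p. \<bar>pdiff f (fst p) (snd p)\<bar>) ` {(is, x). length is \<le> k})"
  proof -
    have "{(is, x :: real^'d). length is \<le> k} = (SIGMA is:{is. length is \<le> k}. UNIV)" by auto
    then have "(\<lambda>p. \<bar>pdiff f (fst p) (snd p)\<bar>) ` {(is, x). length is \<le> k} = (\<Union>is\<in>{is. length is \<le> k}. (\<lambda>x. \<bar>pdiff f is x\<bar>) ` UNIV)"
      by force
    moreover have "finite {is :: 'd list. length is \<le> k}"
      using finite_lists_length_le[of "UNIV :: 'd set" k] by simp
    moreover have "bdd_above ((\<lambda>x. \<bar>pdiff f is x\<bar>) ` UNIV)" if "length is \<le> k" for "is"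
      using assms(1) that by (fastforce simp: Cb_def bounded_iff bdd_above_def)
    ultimately show ?thesis by (simp add: bdd_above_UN)
  qed
  then show ?thesis
    unfolding Cb_norm_def using assms(2) by (intro cSUP_upper2[where x = "(is, x)"]) auto
qed

section \<open>Product measures\<close>

lemma Basis_vec_eq: "(Basis :: (real^'d::finite) set) = range (\<lambda>d. axis d 1)"
  by (auto simp: Basis_vec_def)

lemma measurable_vec_lambda [measurable]:
  "(\<lambda>f. \<chi> d. f d) \<in> borel_measurable (PiM UNIV (\<lambda>_::'d::finite. borel :: real measure))"
  by (subst borel_measurable_euclidean_space) (auto simp: Basis_vec_eq inner_axis)

lemma measurable_vec_nth [measurable]: "(\<lambda>x :: real^'d::finite. x $ d) \<in> borel_measurable borel"
  by (intro borel_measurable_continuous_onI continuous_intros)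

lemma sets_PiM_lborel: "sets (PiM UNIV (\<lambda>_::'d::finite. lborel :: real measure)) = sets (PiM UNIV (\<lambda>_. borel))"
  by (intro sets_PiM_cong) auto

text \<open>Lebesgue measure is determined by the volumes of boxes, and boxes are products of
  intervals. The identity transports the product formulas for \<open>PiM\<close> to vectors.\<close>

lemma lborel_vec_eq:
  "(lborel :: (real^'d::finite) measure) = distr (PiM UNIV (\<lambda>_::'d. lborel)) borel (\<lambda>f. \<chi> d. f d)"
proof (rule lborel_eqI)
  interpret product_sigma_finite "\<lambda>_::'d. lborel :: real measure"
    by standard
  fix l u :: "real^'d" assume le: "\<And>b. b \<in> Basis \<Longrightarrow> l \<bullet> b \<le> u \<bullet> b"
  have le': "l $ d \<le> u $ d" for d
    using le[of "axis d 1"] by (simp add: Basis_vec_eq inner_axis)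
  have "emeasure (distr (PiM UNIV (\<lambda>_::'d. lborel)) borel (\<lambda>f. \<chi> d. f d)) (box l u)
      = emeasure (PiM UNIV (\<lambda>_::'d. lborel)) (PiE UNIV (\<lambda>d. {l $ d <..< u $ d}))"
    by (subst emeasure_distr)
       (auto intro!: arg_cong2[where f = emeasure] simp: measurable_cong_sets[OF sets_PiM_lborel refl]
          mem_box_cart space_PiM PiE_UNIV_domain Pi_iff)
  also have "\<dots> = (\<Prod>d\<in>UNIV. ennreal (u $ d - l $ d))"
    using le' by (subst emeasure_PiM) auto
  also have "\<dots> = ennreal (\<Prod>d\<in>UNIV. u $ d - l $ d)"
    using le' by (intro prod_ennreal) auto
  also have "(\<Prod>d\<in>UNIV. u $ d - l $ d) = (\<Prod>b\<in>Basis. (u - l) \<bullet> b)"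
    unfolding Basis_vec_eq
    by (subst prod.reindex) (auto simp: inj_on_def axis_eq_axis inner_axis)
  finally show "emeasure (distr (PiM UNIV (\<lambda>_::'d. lborel)) borel (\<lambda>f. \<chi> d. f d)) (box l u)
      = ennreal (\<Prod>b\<in>Basis. (u - l) \<bullet> b)" .
qed simp

lemma nn_integral_lborel_vec_prod:
  fixes g :: "'d::finite \<Rightarrow> real \<Rightarrow> ennreal"
  assumes [measurable]: "\<And>d. g d \<in> borel_measurable borel"
  shows "(\<integral>\<^sup>+x. (\<Prod>d\<in>UNIV. g d (x $ d)) \<partial>(lborel :: (real^'d) measure)) = (\<Prod>d\<in>UNIV. \<integral>\<^sup>+t. g d t \<partial>lborel)"
proof -
  interpret product_sigma_finite "\<lambda>_::'d. lborel :: real measure"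
    by standard
  have "(\<integral>\<^sup>+x. (\<Prod>d\<in>UNIV. g d (x $ d)) \<partial>(lborel :: (real^'d) measure))
      = (\<integral>\<^sup>+f. (\<Prod>d\<in>UNIV. g d (f d)) \<partial>PiM UNIV (\<lambda>_. lborel))"
    unfolding lborel_vec_eq
    by (subst nn_integral_distr) (auto simp: measurable_cong_sets[OF sets_PiM_lborel refl])
  also have "\<dots> = (\<Prod>d\<in>UNIV. \<integral>\<^sup>+t. g d t \<partial>lborel)"
    by (rule product_nn_integral_prod) auto
  finally show ?thesis .
qed

lemma
  fixes g :: "'d::finite \<Rightarrow> real \<Rightarrow> real"
  assumes g: "\<And>d. integrable lborel (g d)"
  shows integrable_lborel_vec_prod: "integrable (lborel :: (real^'d) measure) (\<lambda>x. \<Prod>d\<in>UNIV. g d (x $ d))"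
    and integral_lborel_vec_prod:
      "(\<integral>x. (\<Prod>d\<in>UNIV. g d (x $ d)) \<partial>(lborel :: (real^'d) measure)) = (\<Prod>d\<in>UNIV. \<integral>t. g d t \<partial>lborel)"
proof -
  interpret product_sigma_finite "\<lambda>_::'d. lborel :: real measure"
    by standard
  have [measurable]: "g d \<in> borel_measurable borel" for d
    using g[of d] by auto
  have m: "(\<lambda>f. \<chi> d. f d) \<in> borel_measurable (PiM UNIV (\<lambda>_::'d. lborel :: real measure))"
    by (simp add: measurable_cong_sets[OF sets_PiM_lborel refl])
  have "integrable (PiM UNIV (\<lambda>_::'d. lborel)) (\<lambda>f. \<Prod>d\<in>UNIV. g d (f d))"
    by (rule product_integrable_prod) (use g in auto)
  then show "integrable (lborel :: (real^'d) measure) (\<lambda>x. \<Prod>d\<in>UNIV. g d (x $ d))"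
    unfolding lborel_vec_eq by (subst integrable_distr_eq[OF m]) auto
  have "(\<integral>x. (\<Prod>d\<in>UNIV. g d (x $ d)) \<partial>(lborel :: (real^'d) measure))
      = (\<integral>f. (\<Prod>d\<in>UNIV. g d (f d)) \<partial>PiM UNIV (\<lambda>_. lborel))"
    unfolding lborel_vec_eq by (subst integral_distr[OF m]) auto
  also have "\<dots> = (\<Prod>d\<in>UNIV. \<integral>t. g d t \<partial>lborel)"
    by (rule product_integral_prod) (use g in auto)
  finally show "(\<integral>x. (\<Prod>d\<in>UNIV. g d (x $ d)) \<partial>(lborel :: (real^'d) measure)) = (\<Prod>d\<in>UNIV. \<integral>t. g d t \<partial>lborel)" .
qed

lemma sets_std_normal_vec [simp, measurable_cong]: "sets std_normal_vec = sets borel"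
  by (simp add: std_normal_vec_def)

lemma space_std_normal_vec [simp]: "space std_normal_vec = UNIV"
  by (simp add: std_normal_vec_def)

lemma
  fixes g :: "'d::finite \<Rightarrow> real \<Rightarrow> real"
  assumes [measurable]: "\<And>d. g d \<in> borel_measurable borel"
    and g: "\<And>d. integrable lborel (\<lambda>t. std_normal_density t * g d t)"
  shows integrable_std_normal_vec_prod: "integrable (std_normal_vec :: (real^'d) measure) (\<lambda>x. \<Prod>d\<in>UNIV. g d (x $ d))"
    and integral_std_normal_vec_prod:
      "(\<integral>x. (\<Prod>d\<in>UNIV. g d (x $ d)) \<partial>(std_normal_vec :: (real^'d) measure))
        = (\<Prod>d\<in>UNIV. LBINT t. std_normal_density t * g d t)"
  using integrable_lborel_vec_prod[OF g] integral_lborel_vec_prod[OF g]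
  by (simp_all add: std_normal_vec_def integrable_density integral_density prod_nonneg flip: prod.distrib)

lemma emeasure_std_normal_vec_PiE:
  fixes A :: "'d::finite \<Rightarrow> real set"
  assumes [measurable]: "\<And>d. A d \<in> sets borel"
  shows "emeasure std_normal_vec {x. \<forall>d. x $ d \<in> A d} = (\<Prod>d\<in>UNIV. emeasure std_normal_distribution (A d))"
proof -
  have "indicator {x. \<forall>d. x $ d \<in> A d} x = (\<Prod>d\<in>UNIV. indicator (A d) (x $ d) :: ennreal)" for x :: "real^'d"
    by (auto simp: indicator_def)
  then have "emeasure std_normal_vec {x. \<forall>d. x $ d \<in> A d}
      = (\<integral>\<^sup>+x. (\<Prod>d\<in>UNIV. ennreal (std_normal_density (x $ d)) * indicator (A d) (x $ d)) \<partial>lborel)"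
    by (simp add: std_normal_vec_def emeasure_density prod.distrib prod_ennreal)
  also have "\<dots> = (\<Prod>d\<in>UNIV. \<integral>\<^sup>+t. ennreal (std_normal_density t) * indicator (A d) t \<partial>lborel)"
    by (rule nn_integral_lborel_vec_prod) measurable
  also have "\<dots> = (\<Prod>d\<in>UNIV. emeasure std_normal_distribution (A d))"
    by (simp add: emeasure_density)
  finally show ?thesis .
qed

lemma prob_space_std_normal: "prob_space std_normal_distribution"
  by (rule prob_space_normal_density) simp

lemma prob_space_std_normal_vec: "prob_space (std_normal_vec :: (real^'d::finite) measure)"
proof
  interpret prob_space std_normal_distribution by (rule prob_space_std_normal)
  show "emeasure (std_normal_vec :: (real^'d) measure) (space std_normal_vec) = 1"
    using emeasure_std_normal_vec_PiE[of "\<lambda>_ :: 'd. UNIV"] emeasure_space_1 by simp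
qed

text \<open>Links the law given by a density on vectors with the product of one-dimensional normal
  laws, in terms of which \<open>chi2_cdf\<close> is stated.\<close>

lemma distr_std_normal_vec:
  "distr std_normal_vec (PiM UNIV (\<lambda>_::'d::finite. std_normal_distribution)) (\<lambda>x d. x $ d)
     = PiM UNIV (\<lambda>_::'d. std_normal_distribution)"
proof -
  interpret product_sigma_finite "\<lambda>_::'d. std_normal_distribution"
    using prob_space_std_normal by (auto simp: product_sigma_finite_def prob_space_imp_sigma_finite)
  have m: "(\<lambda>x d. x $ d) \<in> measurable (std_normal_vec :: (real^'d) measure) (PiM UNIV (\<lambda>_::'d. std_normal_distribution))"
    by (rule measurable_PiM_single') (auto simp: space_PiM)
  show ?thesis
  proof (rule PiM_eqI)
    fix A :: "'d \<Rightarrow> real set" assume A: "\<And>d. d \<in> UNIV \<Longrightarrow> A d \<in> sets std_normal_distribution"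
    then have "emeasure (distr std_normal_vec (PiM UNIV (\<lambda>_::'d. std_normal_distribution)) (\<lambda>x d. x $ d)) (PiE UNIV A)
        = emeasure std_normal_vec {x. \<forall>d. x $ d \<in> A d}"
      by (subst emeasure_distr[OF m sets_PiM_I_finite])
         (auto intro!: arg_cong2[where f = emeasure] simp: PiE_UNIV_domain)
    then show "emeasure (distr std_normal_vec (PiM UNIV (\<lambda>_::'d. std_normal_distribution)) (\<lambda>x d. x $ d)) (PiE UNIV A)
        = (\<Prod>d\<in>UNIV. emeasure std_normal_distribution (A d))"
      using A by (simp add: emeasure_std_normal_vec_PiE)
  qed auto
qed

lemma cube_borel [measurable]: "cube h i \<in> sets borel"
  by (simp add: cube_def)

lemma cube_lborel: "cube h i \<in> sets lborel"
  by simp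

lemma emeasure_lborel_cube:
  fixes i :: "int^'d::finite"
  assumes "h > 0"
  shows "emeasure lborel (cube h i) = ennreal (h ^ CARD('d))"
proof -
  have "emeasure lborel (cube h i) = (\<integral>\<^sup>+x. (\<Prod>d\<in>UNIV. indicator {h * of_int (i $ d)<..h * (of_int (i $ d) + 1)} (x $ d)) \<partial>lborel)"
    unfolding nn_integral_indicator[OF cube_lborel, symmetric]
    by (intro nn_integral_cong) (auto simp: cube_def indicator_def)
  also have "\<dots> = (\<Prod>d\<in>(UNIV :: 'd set). ennreal h)"
    using assms by (subst nn_integral_lborel_vec_prod) (simp_all add: algebra_simps)
  finally show ?thesis using assms by (simp add: ennreal_power)
qed

text \<open>The uniform density factors over the coordinates, and an affine substitution carries
  each edge to [-1, 1]; the factor 1/2 is the density of the uniform law there.\<close>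

lemma
  fixes i :: "int^'d::finite" and g :: "'d \<Rightarrow> real \<Rightarrow> real"
  assumes h: "h > 0" and g: "\<And>d. continuous_on UNIV (g d)"
  shows integrable_uniform_cube_prod:
      "integrable (uniform_measure lborel (cube h i)) (\<lambda>u. \<Prod>d\<in>UNIV. g d (((u - center h i) $ d) / (h / 2)))"
    and integral_uniform_cube_prod:
      "(\<integral>u. (\<Prod>d\<in>UNIV. g d (((u - center h i) $ d) / (h / 2))) \<partial>uniform_measure lborel (cube h i))
        = (\<Prod>d\<in>UNIV. integral {-1..1} (g d) / 2)"
proof -
  have [measurable]: "g d \<in> borel_measurable borel" for d
    by (intro borel_measurable_continuous_onI g)
  define k where "k d t = indicator {h * of_int (i $ d)<..h * (of_int (i $ d) + 1)} t / h * g d ((t - h * (of_int (i $ d) + 1 / 2)) / (h / 2))"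
    for d t
  have U: "uniform_measure lborel (cube h i) = density lborel (\<lambda>x. ennreal (indicator (cube h i) x / h ^ CARD('d)))"
    unfolding uniform_measure_def
    by (intro density_cong) (use h in \<open>auto simp: emeasure_lborel_cube indicator_def divide_ennreal simp flip: ennreal_1\<close>)
  have ind: "indicator (cube h i) u = (\<Prod>d\<in>UNIV. indicator {h * of_int (i $ d)<..h * (of_int (i $ d) + 1)} (u $ d) :: real)" for u
    by (auto simp: cube_def indicator_def)
  have k: "indicator (cube h i) u / h ^ CARD('d) * (\<Prod>d\<in>UNIV. g d (((u - center h i) $ d) / (h / 2)))
      = (\<Prod>d\<in>UNIV. k d (u $ d))" for u
    by (simp add: k_def ind center_def prod.distrib prod_dividef)
  have kc: "k d (h * (of_int (i $ d) + 1 / 2) + h / 2 * s) = indicator {-1<..1} s * g d s / h" for d s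
  proof -
    have "-1 < s \<longleftrightarrow> -h < h * s" "s \<le> 1 \<longleftrightarrow> h * s \<le> h"
      using h mult_less_cancel_left_pos[of h "-1" s] mult_le_cancel_left_pos[of h s 1] by auto
    then have "(h * of_int (i $ d) < h * (of_int (i $ d) + 1 / 2) + h / 2 * s) \<longleftrightarrow> -1 < s"
      "(h * (of_int (i $ d) + 1 / 2) + h / 2 * s \<le> h * (of_int (i $ d) + 1)) \<longleftrightarrow> s \<le> 1"
      by (auto simp: distrib_left)
    then show ?thesis using h by (simp add: k_def indicator_def)
  qed
  have ab: "set_integrable lborel {-1..1} (g d)" for d
    by (intro borel_integrable_atLeastAtMost' continuous_on_subset[OF g]) auto
  \<comment> \<open>The edges of a cube are half-open, while the Legendre integrals run over the
    closed interval; the two differ in a single point.\<close>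
  have null: "AE s in lborel. indicator {-1<..1} s * g d s = indicator {-1..1} s *\<^sub>R g d s" for d
    using AE_lborel_singleton[of "-1 :: real"] by eventually_elim (auto simp: indicator_def)
  have int1: "integrable lborel (\<lambda>s. indicator {-1<..1} s * g d s)" for d
    using ab[of d] unfolding set_integrable_def by (subst integrable_cong_AE[OF _ _ null]) auto
  have val1: "(LBINT s. indicator {-1<..1} s * g d s) = integral {-1..1} (g d)" for d
  proof -
    have "(LBINT s. indicator {-1<..1} s * g d s) = (LBINT s:{-1..1}. g d s)"
      unfolding set_lebesgue_integral_def by (intro integral_cong_AE null) auto
    then show ?thesis using set_borel_integral_eq_integral(2)[OF ab] by simp
  qed
  have int: "integrable lborel (k d)" for d
    using h int1[of d] lborel_integrable_real_affine_iff[of "h / 2" "k d" "h * (of_int (i $ d) + 1 / 2)"]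
    by (simp add: kc[simplified])
  have val: "(LBINT t. k d t) = integral {-1..1} (g d) / 2" for d
    using h lborel_integral_real_affine[of "h / 2" "k d" "h * (of_int (i $ d) + 1 / 2)"] val1[of d]
    by (simp add: kc[simplified])
  have nn: "0 \<le> indicator (cube h i) u / h ^ CARD('d)" for u
    using h by simp
  have m: "(\<lambda>u. \<Prod>d\<in>UNIV. g d (((u - center h i) $ d) / (h / 2))) \<in> borel_measurable lborel"
    "(\<lambda>u. indicator (cube h i) u / h ^ CARD('d)) \<in> borel_measurable lborel"
    by measurable
  show "integrable (uniform_measure lborel (cube h i)) (\<lambda>u. \<Prod>d\<in>UNIV. g d (((u - center h i) $ d) / (h / 2)))"
    unfolding U integrable_density[OF m AE_I2[OF nn]] real_scaleR_def k
    by (rule integrable_lborel_vec_prod[of k, OF int])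
  show "(\<integral>u. (\<Prod>d\<in>UNIV. g d (((u - center h i) $ d) / (h / 2))) \<partial>uniform_measure lborel (cube h i))
        = (\<Prod>d\<in>UNIV. integral {-1..1} (g d) / 2)"
    unfolding U integral_density[OF m AE_I2[OF nn]] real_scaleR_def k
    unfolding integral_lborel_vec_prod[of k, OF int] val ..
qed

lemma prob_space_uniform_cube: "h > 0 \<Longrightarrow> prob_space (uniform_measure lborel (cube h i))"
  by (rule prob_space_uniform_measure) (simp_all add: emeasure_lborel_cube)

section \<open>Chi-square quantile and Gaussian tails\<close>

text \<open>\<open>chi2_cdf\<close> numbers its normal variables by the naturals below D; a
  bijection with the index type carries the product measure over.\<close>

lemma chi2_cdf_eq:
  assumes "D = CARD('d::finite)"
  shows "chi2_cdf D t = measure (std_normal_vec :: (real^'d) measure) {x. (\<Sum>d\<in>UNIV. (x $ d)\<^sup>2) \<le> t}"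
proof -
  let ?N = std_normal_distribution
  obtain e where e: "bij_betw e {..<D} (UNIV :: 'd set)"
    using ex_bij_betw_nat_finite[of "UNIV :: 'd set"] assms by (auto simp: atLeast0LessThan)
  let ?P = "PiM {..<D} (\<lambda>_. ?N)" and ?Q = "PiM UNIV (\<lambda>_::'d. ?N)"
  let ?r = "\<lambda>\<omega>. \<lambda>n\<in>{..<D}. \<omega> (e n)"
  have re: "distr ?Q ?P ?r = ?P"
    using distr_PiM_reindex[of UNIV "\<lambda>_. ?N" e "{..<D}"] e prob_space_std_normal
    by (auto simp: bij_betw_def)
  have rm: "?r \<in> measurable ?Q ?P"
    by (rule measurable_restrict) (rule measurable_component_singleton, simp)
  have m: "(\<lambda>x d. x $ d) \<in> measurable (std_normal_vec :: (real^'d) measure) ?Q"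
    by (rule measurable_PiM_single') (auto simp: space_PiM)
  let ?S = "{\<omega>\<in>space ?P. (\<Sum>k<D. (\<omega> k)\<^sup>2) \<le> t}"
  have S: "?S \<in> sets ?P" by measurable
  have "chi2_cdf D t = measure (distr ?Q ?P ?r) ?S"
    by (simp add: chi2_cdf_def re)
  also have "\<dots> = measure (distr (distr std_normal_vec ?Q (\<lambda>x d. x $ d)) ?P ?r) ?S"
    by (simp add: distr_std_normal_vec)
  also have "\<dots> = measure (distr std_normal_vec ?P (\<lambda>x. ?r (\<lambda>d. x $ d))) ?S"
    by (subst distr_distr[OF rm m]) (simp add: comp_def)
  also have "\<dots> = measure (std_normal_vec :: (real^'d) measure) {x. (\<Sum>d\<in>UNIV. (x $ d)\<^sup>2) \<le> t}"
  proof -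
    have "(\<lambda>x. ?r (\<lambda>d. x $ d)) \<in> measurable (std_normal_vec :: (real^'d) measure) ?P"
      using measurable_comp[OF m rm] by (simp add: comp_def)
    moreover have "(\<Sum>k<D. (x $ e k)\<^sup>2) = (\<Sum>d\<in>UNIV. (x $ d)\<^sup>2)" for x :: "real^'d"
      using sum.reindex_bij_betw[OF e, of "\<lambda>d. (x $ d)\<^sup>2"] .
    ultimately show ?thesis
      by (subst measure_distr[OF _ S]) (auto intro!: arg_cong2[where f = measure] simp: space_PiM)
  qed
  finally show ?thesis .
qed

lemma norm_vec_square: "(norm (x :: real^'d::finite))\<^sup>2 = (\<Sum>d\<in>UNIV. (x $ d)\<^sup>2)"
  by (simp add: norm_vec_def L2_set_def sum_nonneg)

text \<open>The infimum defining the quantile is taken over a nonempty set that is bounded below by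
  0, since the distribution function vanishes on negative numbers and tends to 1. Right continuity
  shows that the level 1 - \<alpha> is already reached at the infimum.\<close>

lemma std_normal_vec_tail_chi2_quantile:
  assumes "0 < \<alpha>" "\<alpha> < 1"
  defines "q \<equiv> chi2_quantile CARD('d::finite) \<alpha>"
  shows "0 \<le> q" and "measure std_normal_vec {x :: real^'d. (norm x)\<^sup>2 > q} \<le> \<alpha>"
proof -
  let ?V = "std_normal_vec :: (real^'d) measure"
  interpret V: prob_space ?V by (rule prob_space_std_normal_vec)
  let ?f = "\<lambda>x :: real^'d. (norm x)\<^sup>2"
  interpret R: real_distribution "distr ?V borel ?f"
    by (rule V.real_distribution_distr) simp
  have F: "cdf (distr ?V borel ?f) t = chi2_cdf CARD('d) t" for t
    unfolding chi2_cdf_eq[OF refl, where 'd = 'd] cdf_def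
    by (subst measure_distr) (auto simp: norm_vec_square vimage_def)
  let ?F = "cdf (distr ?V borel ?f)"
  define S where "S = {t. ?F t \<ge> 1 - \<alpha>}"
  have q: "q = Inf S"
    by (simp add: q_def chi2_quantile_def S_def F)
  have neg: "?F t = 0" if "t < 0" for t
  proof -
    have "{x. ?f x \<le> t} = {}"
      using that by (auto simp: not_le intro: less_le_trans)
    then show ?thesis
      unfolding cdf_def by (subst measure_distr) (auto simp: vimage_def)
  qed
  have S0: "0 \<le> t" if "t \<in> S" for t
    using that neg[of t] assms(2) by (force simp: S_def not_less[symmetric])
  have "eventually (\<lambda>t. ?F t > 1 - \<alpha>) at_top"
    using R.cdf_lim_at_top_prob assms(1) by (intro order_tendstoD) auto
  then obtain t0 where "?F t0 > 1 - \<alpha>"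
    by (auto dest: eventually_happens)
  then have Sne: "S \<noteq> {}" by (auto simp: S_def intro: less_imp_le)
  have bdd: "bdd_below S" using S0 by (auto simp: bdd_below_def)
  show "0 \<le> q" unfolding q using Sne S0 by (intro cInf_greatest) auto
  have "?F t \<ge> 1 - \<alpha>" if t: "t > q" for t
  proof -
    obtain s where "s \<in> S" "s < t"
      using t cInf_less_iff[OF Sne bdd, of t] by (auto simp: q)
    then show ?thesis using R.cdf_nondecreasing[of s t] by (auto simp: S_def)
  qed
  then have "eventually (\<lambda>t. ?F t \<ge> 1 - \<alpha>) (at_right q)"
    by (auto simp: eventually_at_right_field intro!: exI[of _ "q + 1"])
  moreover have "(?F \<longlongrightarrow> ?F q) (at_right q)"
    using R.cdf_is_right_cont[of q] by (simp add: continuous_within)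
  ultimately have "?F q \<ge> 1 - \<alpha>"
    by (intro tendsto_lowerbound[where F = "at_right q"]) auto
  moreover have "?F q = measure ?V {x. ?f x \<le> q}"
    unfolding cdf_def by (subst measure_distr) (auto simp: vimage_def)
  moreover have "measure ?V {x. ?f x > q} = 1 - measure ?V {x. ?f x \<le> q}"
    by (subst V.prob_compl[symmetric]) (auto intro!: arg_cong2[where f = measure])
  ultimately show "measure ?V {x. ?f x > q} \<le> \<alpha>" by simp
qed

lemma gauss_density_prod:
  "ennreal (\<Prod>d\<in>UNIV. std_normal_density ((x :: real^'d::finite) $ d))
     = ennreal (1 / (2 * pi) powr (real CARD('d) / 2) * exp (- (norm x)\<^sup>2 / 2))"
proof -
  have "(\<Prod>d\<in>UNIV. std_normal_density (x $ d)) = (1 / sqrt (2 * pi)) ^ CARD('d) * exp (\<Sum>d\<in>UNIV. - (x $ d)\<^sup>2 / 2)"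
    by (simp only: std_normal_density_def prod.distrib exp_sum[OF finite] prod_constant)
  also have "(\<Sum>d\<in>UNIV. - (x $ d)\<^sup>2 / 2) = - (norm x)\<^sup>2 / 2"
    by (simp only: norm_vec_square sum_divide_distrib[symmetric] sum_negf)
  also have "(1 / sqrt (2 * pi)) ^ CARD('d) = 1 / (2 * pi) powr (real CARD('d) / 2)"
    by (simp add: power_one_over powr_half_sqrt[symmetric] powr_powr powr_realpow[symmetric] del: real_sqrt_mult powr_realpow')
  finally show ?thesis by simp
qed

text \<open>The dominating function is C1 times the density of a centred normal law with covariance
  C2 times the identity. Scaling by sqrt C2 turns the complement of the ball of radius sqrt(C2 q)
  into the chi-square event |x|^2 > q.\<close>

lemma gauss_bounded_density_tail:
  fixes f :: "real^'d::finite \<Rightarrow> real"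
  assumes f: "f \<in> borel_measurable borel"
    and le: "\<And>x. f x \<le> C1 / (2 * pi * C2) powr (real CARD('d) / 2) * exp (- (norm x)\<^sup>2 / (2 * C2))"
    and C: "C1 > 0" "C2 > 0" and q: "q \<ge> 0"
  shows "emeasure (density lborel (\<lambda>x. ennreal (f x))) {x. norm x > sqrt (C2 * q)}
    \<le> ennreal (C1 * measure std_normal_vec {x :: real^'d. (norm x)\<^sup>2 > q})"
proof -
  interpret V: prob_space "std_normal_vec :: (real^'d) measure" by (rule prob_space_std_normal_vec)
  note [measurable] = f
  define G where "G x = C1 / (2 * pi * C2) powr (real CARD('d) / 2) * exp (- (norm x)\<^sup>2 / (2 * C2))" for x :: "real^'d"
  define T where "T x = sqrt C2 *\<^sub>R x" for x :: "real^'d"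
  have T: "T = (\<lambda>x. 0 + (\<Sum>j\<in>Basis. (sqrt C2 * (x \<bullet> j)) *\<^sub>R j))"
    by (simp add: T_def fun_eq_iff euclidean_representation flip: scaleR_scaleR scaleR_sum_right)
  have [measurable]: "G \<in> borel_measurable borel" "T \<in> borel_measurable borel"
    unfolding G_def T_def by measurable
  have lb: "(lborel :: (real^'d) measure) = density (distr lborel borel T) (\<lambda>_. ennreal (sqrt C2 ^ CARD('d)))"
    using C by (subst lborel_affine_euclidean[of "\<lambda>_. sqrt C2" 0]) (simp_all add: T)
  have GT: "sqrt C2 ^ CARD('d) * G (T x) = C1 * (1 / (2 * pi) powr (real CARD('d) / 2) * exp (- (norm x)\<^sup>2 / 2))" for x
  proof -
    have "sqrt C2 ^ CARD('d) = C2 powr (real CARD('d) / 2)"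
      using C by (simp add: powr_half_sqrt[symmetric] powr_powr flip: powr_realpow)
    then show ?thesis using C
      by (simp add: G_def T_def power_mult_distrib powr_mult field_simps)
  qed
  have nT: "norm (T x) > sqrt (C2 * q) \<longleftrightarrow> (norm x)\<^sup>2 > q" for x
  proof -
    have "norm (T x) > sqrt (C2 * q) \<longleftrightarrow> sqrt (C2 * q) < sqrt (C2 * (norm x)\<^sup>2)"
      using C by (simp add: T_def real_sqrt_mult)
    then show ?thesis using C by simp
  qed
  have "emeasure (density lborel (\<lambda>x. ennreal (f x))) {x. norm x > sqrt (C2 * q)}
      = (\<integral>\<^sup>+x. ennreal (f x) * indicator {x. norm x > sqrt (C2 * q)} x \<partial>lborel)"
    by (rule emeasure_density) auto
  also have "\<dots> \<le> (\<integral>\<^sup>+x. ennreal (G x) * indicator {x. norm x > sqrt (C2 * q)} x \<partial>lborel)"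
    using le by (intro nn_integral_mono mult_right_mono ennreal_leI) (auto simp: G_def)
  also have "\<dots> = (\<integral>\<^sup>+x. ennreal (sqrt C2 ^ CARD('d)) * (ennreal (G (T x)) * indicator {x. norm x > sqrt (C2 * q)} (T x)) \<partial>lborel)"
    by (subst lb) (simp add: nn_integral_density nn_integral_distr)
  also have "\<dots> = (\<integral>\<^sup>+x. ennreal C1 * (ennreal (\<Prod>d\<in>UNIV. std_normal_density (x $ d)) * indicator {x. (norm x)\<^sup>2 > q} x) \<partial>(lborel :: (real^'d) measure))"
  proof (rule nn_integral_cong)
    fix x :: "real^'d"
    have "ennreal (sqrt C2 ^ CARD('d)) * ennreal (G (T x)) = ennreal (sqrt C2 ^ CARD('d) * G (T x))"
      using C by (intro ennreal_mult[symmetric]) (auto simp: G_def)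
    also have "\<dots> = ennreal C1 * ennreal (\<Prod>d\<in>UNIV. std_normal_density (x $ d))"
      unfolding gauss_density_prod GT using C by (intro ennreal_mult) auto
    finally have "ennreal (sqrt C2 ^ CARD('d)) * ennreal (G (T x)) = ennreal C1 * ennreal (\<Prod>d\<in>UNIV. std_normal_density (x $ d))" .
    moreover have "(indicator {x. norm x > sqrt (C2 * q)} (T x) :: ennreal) = indicator {x. (norm x)\<^sup>2 > q} x"
      by (simp add: indicator_def nT)
    ultimately show "ennreal (sqrt C2 ^ CARD('d)) * (ennreal (G (T x)) * indicator {x. norm x > sqrt (C2 * q)} (T x))
        = ennreal C1 * (ennreal (\<Prod>d\<in>UNIV. std_normal_density (x $ d)) * indicator {x. (norm x)\<^sup>2 > q} x)"
      by (simp add: mult.assoc[symmetric])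
  qed
  also have "\<dots> = ennreal C1 * emeasure std_normal_vec {x :: real^'d. (norm x)\<^sup>2 > q}"
    by (simp add: std_normal_vec_def emeasure_density nn_integral_cmult)
  also have "\<dots> = ennreal (C1 * measure std_normal_vec {x :: real^'d. (norm x)\<^sup>2 > q})"
    using C by (simp add: V.emeasure_eq_measure ennreal_mult)
  finally show ?thesis .
qed

section \<open>Lower tail of the empirical Gram matrix\<close>

lemma exp_minus_le_quadratic:
  fixes x :: real
  assumes "x \<ge> 0"
  shows "exp (- x) \<le> 1 - x + x\<^sup>2 / 2"
proof -
  let ?g = "\<lambda>x::real. 1 - x + x\<^sup>2 / 2 - exp (- x)"
  have "?g 0 \<le> ?g x"
  proof (rule DERIV_nonneg_imp_nondecreasing[OF assms])
    fix t :: real assume "0 \<le> t"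
    have "(?g has_real_derivative (- 1 + t + exp (- t))) (at t)"
      by (auto intro!: derivative_eq_intros)
    moreover have "0 \<le> - 1 + t + exp (- t)"
      using exp_ge_add_one_self[of "-t"] by simp
    ultimately show "\<exists>y. (?g has_real_derivative y) (at t) \<and> 0 \<le> y" by blast
  qed
  then show ?thesis by simp
qed

text \<open>From 0 \<le> Z \<le> B follows Z^2 \<le> B Z, so the second moment is at most B times
  the mean, that is B. The quadratic bound for exp(-x) then controls the Laplace transform by the
  mean alone.\<close>

lemma nn_integral_exp_minus_le:
  fixes Z :: "'a \<Rightarrow> real"
  assumes "prob_space N" and Z: "integrable N Z" and Z1: "(\<integral>x. Z x \<partial>N) = 1"
    and bd: "AE x in N. 0 \<le> Z x \<and> Z x \<le> B" and t: "t \<ge> 0"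
  shows "(\<integral>\<^sup>+x. ennreal (exp (- (t * Z x))) \<partial>N) \<le> ennreal (exp (- t + t\<^sup>2 * B / 2))"
proof -
  interpret prob_space N by fact
  let ?r = "\<lambda>x. 1 + (t\<^sup>2 * B / 2 - t) * Z x"
  have le: "AE x in N. exp (- (t * Z x)) \<le> ?r x"
    using bd
  proof eventually_elim
    case (elim x)
    have "exp (- (t * Z x)) \<le> 1 - t * Z x + (t * Z x)\<^sup>2 / 2"
      using elim t by (intro exp_minus_le_quadratic) simp
    also have "(t * Z x)\<^sup>2 = t\<^sup>2 * Z x * Z x" by (simp add: power2_eq_square)
    also have "1 - t * Z x + t\<^sup>2 * Z x * Z x / 2 \<le> 1 - t * Z x + t\<^sup>2 * Z x * B / 2"
      using elim t by (intro add_left_mono divide_right_mono mult_left_mono) auto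
    finally show ?case by (simp add: algebra_simps)
  qed
  have "(\<integral>\<^sup>+x. ennreal (exp (- (t * Z x))) \<partial>N) \<le> (\<integral>\<^sup>+x. ennreal (?r x) \<partial>N)"
    using le by (intro nn_integral_mono_AE) (auto elim!: eventually_mono intro: ennreal_leI)
  also have "\<dots> = ennreal (\<integral>x. ?r x \<partial>N)"
    using le Z by (intro nn_integral_eq_integral) (auto elim!: eventually_mono intro: order_trans[OF exp_ge_zero])
  also have "(\<integral>x. ?r x \<partial>N) = 1 + (t\<^sup>2 * B / 2 - t)"
    using Z by (simp add: Z1 prob_space)
  also have "ennreal (1 + (t\<^sup>2 * B / 2 - t)) \<le> ennreal (exp (- t + t\<^sup>2 * B / 2))"
    using exp_ge_add_one_self[of "t\<^sup>2 * B / 2 - t"] by (intro ennreal_leI) (simp add: algebra_simps)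
  finally show ?thesis .
qed

text \<open>Chernoff bound for the coordinates in S, which will be the samples of one cube. The
  product runs over all of K; each coordinate outside S contributes the factor 1.\<close>

lemma PiM_lower_tail:
  fixes Z :: "'a \<Rightarrow> real" and M :: "'i \<Rightarrow> 'a measure"
  assumes M: "\<And>p. prob_space (M p)" and K: "finite K" "S \<subseteq> K"
    and N: "\<And>p. p \<in> S \<Longrightarrow> M p = N"
    and Z: "integrable N Z" and Z1: "(\<integral>x. Z x \<partial>N) = 1"
    and bd: "AE x in N. 0 \<le> Z x \<and> Z x \<le> B" and B: "B > 0" and d: "\<delta> \<ge> 0"
  shows "emeasure (PiM K M) {\<omega> \<in> space (PiM K M). (\<Sum>p\<in>S. Z (\<omega> p)) \<le> (1 - \<delta>) * real (card S)}
    \<le> ennreal (exp (- (real (card S) * \<delta>\<^sup>2 / (2 * B))))"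
proof (cases "S = {}")
  case True
  interpret P: prob_space "PiM K M" by (intro prob_space_PiM M)
  show ?thesis using P.emeasure_space_1 by (simp add: True)
next
  case False
  then obtain p0 where "p0 \<in> S" by blast
  then have probN: "prob_space N" using M N by metis
  interpret product_sigma_finite M
    using M by (auto simp: product_sigma_finite_def prob_space_imp_sigma_finite)
  define L where "L = real (card S)"
  \<comment> \<open>The minimiser of the exponent - t \<delta> + t^2 B / 2 per sample, with minimum
    - \<delta>^2 / (2 B).\<close>
  define t where "t = \<delta> / B"
  have t: "t \<ge> 0" using B d by (simp add: t_def)
  have [measurable]: "Z \<in> borel_measurable N" using Z by simp
  have comp[measurable]: "(\<lambda>\<omega>. Z (\<omega> p)) \<in> borel_measurable (PiM K M)" if "p \<in> S" for p
  proof -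
    have "p \<in> K" "Z \<in> borel_measurable (M p)" using K that by (auto simp: N)
    then show ?thesis by (rule measurable_compose[OF measurable_component_singleton])
  qed
  define g where "g p x = (if p \<in> S then ennreal (exp (- (t * Z x))) else 1)" for p x
  have gm: "g p \<in> borel_measurable (M p)" for p
    using N[of p] by (cases "p \<in> S") (auto simp: g_def[abs_def])
  have fS: "finite S" using K finite_subset by blast
  have split: "exp (t * ((1 - \<delta>) * L - (\<Sum>p\<in>S. Z (\<omega> p)))) = exp (t * ((1 - \<delta>) * L)) * (\<Prod>p\<in>S. exp (- (t * Z (\<omega> p))))" for \<omega>
    using fS by (simp add: right_diff_distrib sum_distrib_left exp_diff exp_minus exp_sum divide_inverse prod_inversef[symmetric])
  have "emeasure (PiM K M) {\<omega> \<in> space (PiM K M). (\<Sum>p\<in>S. Z (\<omega> p)) \<le> (1 - \<delta>) * L}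
      = (\<integral>\<^sup>+\<omega>. indicator {\<omega> \<in> space (PiM K M). (\<Sum>p\<in>S. Z (\<omega> p)) \<le> (1 - \<delta>) * L} \<omega> \<partial>PiM K M)"
    by (rule nn_integral_indicator[symmetric]) measurable
  also have "\<dots> \<le> (\<integral>\<^sup>+\<omega>. ennreal (exp (t * ((1 - \<delta>) * L - (\<Sum>p\<in>S. Z (\<omega> p))))) \<partial>PiM K M)"
    using t by (intro nn_integral_mono) (auto simp: indicator_def intro!: ennreal_leI simp flip: ennreal_1)
  also have "\<dots> = (\<integral>\<^sup>+\<omega>. ennreal (exp (t * ((1 - \<delta>) * L))) * (\<Prod>p\<in>K. g p (\<omega> p)) \<partial>PiM K M)"
  proof (intro nn_integral_cong)
    fix \<omega>
    have "(\<Prod>p\<in>K. g p (\<omega> p)) = (\<Prod>p\<in>S. ennreal (exp (- (t * Z (\<omega> p)))))"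
      by (rule prod.mono_neutral_cong_right) (use K in \<open>auto simp: g_def\<close>)
    then show "ennreal (exp (t * ((1 - \<delta>) * L - (\<Sum>p\<in>S. Z (\<omega> p))))) = ennreal (exp (t * ((1 - \<delta>) * L))) * (\<Prod>p\<in>K. g p (\<omega> p))"
      by (simp add: split ennreal_mult prod_ennreal prod_nonneg)
  qed
  also have "\<dots> = ennreal (exp (t * ((1 - \<delta>) * L))) * (\<Prod>p\<in>K. \<integral>\<^sup>+x. g p x \<partial>M p)"
    using K gm by (subst nn_integral_cmult)
      (auto simp: product_nn_integral_prod intro!: borel_measurable_prod_ennreal measurable_compose[OF measurable_component_singleton _, where g = "g _"])
  also have "(\<Prod>p\<in>K. \<integral>\<^sup>+x. g p x \<partial>M p) \<le> (\<Prod>p\<in>K. if p \<in> S then ennreal (exp (- t + t\<^sup>2 * B / 2)) else 1)"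
  proof (rule prod_mono_ennreal)
    fix p
    show "(\<integral>\<^sup>+x. g p x \<partial>M p) \<le> (if p \<in> S then ennreal (exp (- t + t\<^sup>2 * B / 2)) else 1)"
    proof (cases "p \<in> S")
      case True
      then show ?thesis
        using nn_integral_exp_minus_le[OF probN Z Z1 bd t] N by (simp add: g_def)
    next
      case False
      then show ?thesis
        using prob_space.emeasure_space_1[OF M[of p]] by (simp add: g_def)
    qed
  qed
  also have "(\<Prod>p\<in>K. if p \<in> S then ennreal (exp (- t + t\<^sup>2 * B / 2)) else 1) = ennreal (exp (L * (- t + t\<^sup>2 * B / 2)))"
  proof -
    have "(\<Prod>p\<in>K. if p \<in> S then ennreal (exp (- t + t\<^sup>2 * B / 2)) else 1) = (\<Prod>p\<in>S. ennreal (exp (- t + t\<^sup>2 * B / 2)))"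
      by (rule prod.mono_neutral_cong_right) (use K in auto)
    then show ?thesis by (simp add: ennreal_power exp_of_nat_mult L_def)
  qed
  also have "ennreal (exp (t * ((1 - \<delta>) * L))) * ennreal (exp (L * (- t + t\<^sup>2 * B / 2)))
      = ennreal (exp (t * ((1 - \<delta>) * L) + L * (- t + t\<^sup>2 * B / 2)))"
    by (simp add: exp_add ennreal_mult)
  also have "t * ((1 - \<delta>) * L) + L * (- t + t\<^sup>2 * B / 2) = - (L * \<delta>\<^sup>2 / (2 * B))"
    using B by (simp add: t_def field_simps power2_eq_square)
  finally show ?thesis by (simp add: L_def mult_left_mono)
qed

section \<open>The Legendre basis under the uniform law on a cube\<close>

lemma finite_multi_idx [simp]: "finite (multi_idx Q :: ('d::finite \<Rightarrow> nat) set)"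
proof (rule finite_subset)
  show "(multi_idx Q :: ('d \<Rightarrow> nat) set) \<subseteq> PiE UNIV (\<lambda>_. {..Q})"
  proof
    fix j :: "'d \<Rightarrow> nat" assume "j \<in> multi_idx Q"
    moreover have "j d \<le> l1 j" for d unfolding l1_def by (rule member_le_sum) auto
    ultimately show "j \<in> PiE UNIV (\<lambda>_. {..Q})"
      by (auto simp: multi_idx_def PiE_UNIV_domain intro: order_trans)
  qed
qed (auto intro: finite_PiE)

lemma zero_in_multi_idx [simp]: "(\<lambda>_. 0) \<in> multi_idx Q"
  by (simp add: multi_idx_def l1_def)

text \<open>The sum of the squared basis functions at a corner of the cube where all scaled
  coordinates are 1, which by \<open>abs_legendre_le_1\<close> dominates that sum on the whole cube.
  It is the bound B in the Chernoff estimate.\<close>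

definition basis_bound :: "'d::finite itself \<Rightarrow> nat \<Rightarrow> real" where
  "basis_bound _ Q = (\<Sum>j\<in>(multi_idx Q :: ('d \<Rightarrow> nat) set). \<Prod>d\<in>UNIV. real (2 * j d + 1))"

lemma basis_bound_ge_1: "1 \<le> basis_bound TYPE('d::finite) Q"
proof -
  have "(\<Prod>d\<in>UNIV. real (2 * (\<lambda>_ :: 'd. 0) d + 1)) \<le> basis_bound TYPE('d) Q"
    unfolding basis_bound_def by (rule member_le_sum) (auto intro: prod_nonneg)
  then show ?thesis by simp
qed

lemma cstar_paths_eq: "cstar_paths TYPE('d::finite) Q = 2/3 + 8/3 * basis_bound TYPE('d) Q"
  by (simp add: cstar_paths_def basis_bound_def)

lemma continuous_on_legendre [continuous_intros]: "continuous_on S f \<Longrightarrow> continuous_on S (\<lambda>x. legendre q (f x))"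
  unfolding legendre_eq_poly by (intro continuous_intros)

lemma continuous_on_eta [continuous_intros]:
  "h \<noteq> 0 \<Longrightarrow> continuous_on S f \<Longrightarrow> continuous_on S (\<lambda>x. eta h i j (f x))"
  unfolding eta_def by (intro continuous_intros) auto

text \<open>In each coordinate the squared norm 2 / (2 j + 1), the factor 1/2 of the uniform law and
  the normalisation 2 j + 1 multiply to 1.\<close>

lemma eta_orthonormal:
  assumes h: "h > 0"
  shows "integrable (uniform_measure lborel (cube h i)) (\<lambda>u. eta h i j u * eta h i k u)"
    and "(\<integral>u. eta h i j u * eta h i k u \<partial>uniform_measure lborel (cube h i)) = (if j = k then 1 else 0)"
proof -
  define g where "g d t = sqrt (2 * real (j d) + 1) * sqrt (2 * real (k d) + 1) * (legendre (j d) t * legendre (k d) t)" for d t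
  have eq: "eta h i j u * eta h i k u = (\<Prod>d\<in>UNIV. g d (((u - center h i) $ d) / (h / 2)))" for u
    unfolding eta_def g_def by (simp only: prod.distrib[symmetric] mult_ac)
  have gc: "continuous_on UNIV (g d)" for d
    unfolding g_def by (intro continuous_intros)
  show "integrable (uniform_measure lborel (cube h i)) (\<lambda>u. eta h i j u * eta h i k u)"
    unfolding eq by (rule integrable_uniform_cube_prod[OF h gc])
  have "integral {-1..1} (g d) / 2 = (if j d = k d then 1 else 0)" for d
  proof -
    have "0 < 2 * real (k d) + 1" by linarith
    then show ?thesis by (simp add: g_def[abs_def] legendre_orthogonal) (simp add: divide_eq_eq)
  qed
  then have "(\<integral>u. eta h i j u * eta h i k u \<partial>uniform_measure lborel (cube h i)) = (\<Prod>d\<in>UNIV. if j d = k d then 1 else 0)"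
    unfolding eq integral_uniform_cube_prod[OF h gc] by simp
  also have "\<dots> = (if j = k then 1 else 0)"
    by (auto simp: fun_eq_iff)
  finally show "(\<integral>u. eta h i j u * eta h i k u \<partial>uniform_measure lborel (cube h i)) = (if j = k then 1 else 0)" .
qed

lemma cube_scaled:
  assumes "h > 0" "u \<in> cube h i"
  shows "\<bar>((u - center h i) $ d) / (h / 2)\<bar> \<le> 1"
proof -
  have "h * of_int (i $ d) < u $ d" "u $ d \<le> h * (of_int (i $ d) + 1)"
    using assms(2) by (auto simp: cube_def)
  then show ?thesis
    using assms(1) by (simp add: center_def abs_le_iff field_simps)
qed

lemma eta_square_le:
  assumes "h > 0" "u \<in> cube h i"
  shows "(eta h i j u)\<^sup>2 \<le> (\<Prod>d\<in>UNIV. real (2 * j d + 1))"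
proof -
  have "(eta h i j u)\<^sup>2 = (\<Prod>d\<in>UNIV. (2 * real (j d) + 1) * (legendre (j d) (((u - center h i) $ d) / (h / 2)))\<^sup>2)"
    by (simp add: eta_def power_mult_distrib prod_power_distrib)
  also have "\<dots> \<le> (\<Prod>d\<in>UNIV. (2 * real (j d) + 1) * 1)"
    using abs_legendre_le_1[OF cube_scaled[OF assms]]
    by (intro prod_mono conjI mult_left_mono) (auto simp: abs_square_le_1)
  finally show ?thesis by (simp add: add.commute)
qed

lemma eta_linear_form_square_le:
  fixes i :: "int^'d::finite"
  assumes "h > 0" "u \<in> cube h i" and w: "(\<Sum>j\<in>multi_idx Q. (w j)\<^sup>2) = 1"
  shows "(\<Sum>j\<in>multi_idx Q. w j * eta h i j u)\<^sup>2 \<le> basis_bound TYPE('d) Q"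
proof -
  have "(\<Sum>j\<in>multi_idx Q. w j * eta h i j u)\<^sup>2 \<le> (\<Sum>j\<in>multi_idx Q. (w j)\<^sup>2) * (\<Sum>j\<in>multi_idx Q. (eta h i j u)\<^sup>2)"
    by (rule Cauchy_Schwarz_ineq_sum)
  also have "\<dots> \<le> basis_bound TYPE('d) Q"
    unfolding basis_bound_def w using eta_square_le[OF assms(1,2)] by (simp only: mult_1_left sum_mono)
  finally show ?thesis .
qed

abbreviation sample_law :: "real \<Rightarrow> int^'d::finite \<Rightarrow> ((real^'d) \<times> (real^'d)) measure" where
  "sample_law h i \<equiv> uniform_measure lborel (cube h i) \<Otimes>\<^sub>M std_normal_vec"

lemma prob_space_sample_law: "h > 0 \<Longrightarrow> prob_space (sample_law h i)"
  by (intro prob_space_pair prob_space_uniform_cube prob_space_std_normal_vec)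

lemma distr_fst_sample_law:
  "h > 0 \<Longrightarrow> distr (sample_law h i) (uniform_measure lborel (cube h i)) fst = uniform_measure lborel (cube h i)"
  by (rule prob_space.distr_pair_fst[OF prob_space_std_normal_vec])

lemma AE_sample_law_cube:
  assumes "h > 0"
  shows "AE p in sample_law h i. fst p \<in> cube h i"
proof (rule AE_distrD[of fst _ "uniform_measure lborel (cube h i)"])
  show "AE x in distr (sample_law h i) (uniform_measure lborel (cube h i)) fst. x \<in> cube h i"
    unfolding distr_fst_sample_law[OF assms] by (rule AE_uniform_measureI) auto
qed simp

text \<open>By orthonormality the expected Gram matrix is the identity, so every unit direction has
  second moment 1, the mean required in \<open>PiM_lower_tail\<close>.\<close>

lemma eta_linear_form_moment:
  fixes i :: "int^'d::finite"
  assumes h: "h > 0" and w: "(\<Sum>j\<in>multi_idx Q. (w j)\<^sup>2) = 1"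
  shows "integrable (sample_law h i) (\<lambda>p. (\<Sum>j\<in>multi_idx Q. w j * eta h i j (fst p))\<^sup>2)"
    and "(\<integral>p. (\<Sum>j\<in>multi_idx Q. w j * eta h i j (fst p))\<^sup>2 \<partial>sample_law h i) = 1"
proof -
  let ?U = "uniform_measure lborel (cube h i)" and ?J = "multi_idx Q :: ('d \<Rightarrow> nat) set"
  let ?Z = "\<lambda>u. (\<Sum>j\<in>?J. w j * eta h i j u)\<^sup>2"
  have Z: "?Z u = (\<Sum>j\<in>?J. \<Sum>k\<in>?J. (w j * w k) * (eta h i j u * eta h i k u))" for u
    by (simp add: power2_eq_square sum_product mult_ac)
  have int: "integrable ?U ?Z"
    unfolding Z by (intro Bochner_Integration.integrable_sum integrable_mult_right eta_orthonormal(1)[OF h])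
  have "(\<integral>u. ?Z u \<partial>?U) = (\<Sum>j\<in>?J. \<Sum>k\<in>?J. (w j * w k) * (if j = k then 1 else 0))"
    unfolding Z
    by (simp add: Bochner_Integration.integral_sum Bochner_Integration.integrable_sum integrable_mult_right
          eta_orthonormal[OF h] del: mult_cancel_left mult_cancel_right)
  also have "\<dots> = (\<Sum>j\<in>?J. \<Sum>k\<in>?J. if k = j then (w j)\<^sup>2 else 0)"
    by (intro sum.cong) (auto simp: power2_eq_square)
  also have "\<dots> = 1" using w by simp
  finally have val: "(\<integral>u. ?Z u \<partial>?U) = 1" .
  have f: "fst \<in> measurable (sample_law h i) ?U" by simp
  have m: "?Z \<in> borel_measurable ?U" using int by simp
  show "integrable (sample_law h i) (\<lambda>p. ?Z (fst p))"
    using int integrable_distr_eq[OF f m] by (simp add: distr_fst_sample_law[OF h])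
  show "(\<integral>p. ?Z (fst p) \<partial>sample_law h i) = 1"
    using val integral_distr[OF f m] by (simp add: distr_fst_sample_law[OF h])
qed

section \<open>Finite net of directions and the failure event\<close>

text \<open>Rounding the coordinates down to multiples of \<epsilon> gives finitely many cells; one
  representative is kept for each occupied cell. Representatives are taken from the sphere itself,
  so that the moment computation applies to them.\<close>

lemma unit_sphere_net:
  fixes J :: "'j set"
  assumes J: "finite J" and e: "\<epsilon> > 0"
  shows "\<exists>W. finite W \<and> (\<forall>w\<in>W. (\<Sum>j\<in>J. (w j)\<^sup>2) = 1) \<and>
     (\<forall>v :: 'j \<Rightarrow> real. (\<Sum>j\<in>J. (v j)\<^sup>2) = 1 \<longrightarrow> (\<exists>w\<in>W. \<forall>j\<in>J. \<bar>v j - w j\<bar> \<le> \<epsilon>))"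
proof -
  define S where "S = {v :: 'j \<Rightarrow> real. (\<Sum>j\<in>J. (v j)\<^sup>2) = 1}"
  define c where "c v = (\<lambda>j\<in>J. \<lfloor>v j / \<epsilon>\<rfloor>)" for v :: "'j \<Rightarrow> real"
  have "c ` S \<subseteq> PiE J (\<lambda>_. {\<lfloor>-1 / \<epsilon>\<rfloor>..\<lfloor>1 / \<epsilon>\<rfloor>})"
  proof
    fix k assume "k \<in> c ` S"
    then obtain v where v: "v \<in> S" "k = c v" by blast
    have "\<bar>v j\<bar> \<le> 1" if "j \<in> J" for j
    proof -
      have "(v j)\<^sup>2 \<le> (\<Sum>j\<in>J. (v j)\<^sup>2)" using J that by (intro member_le_sum) auto
      then show ?thesis using v by (simp add: abs_square_le_1 S_def)
    qed
    then have "-1 / \<epsilon> \<le> v j / \<epsilon>" "v j / \<epsilon> \<le> 1 / \<epsilon>" if "j \<in> J" for j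
      using divide_right_mono[of "-1" "v j" \<epsilon>] divide_right_mono[of "v j" 1 \<epsilon>] e that
      by (auto simp: abs_le_iff minus_le_iff)
    then show "k \<in> PiE J (\<lambda>_. {\<lfloor>-1 / \<epsilon>\<rfloor>..\<lfloor>1 / \<epsilon>\<rfloor>})"
      by (auto simp: v c_def intro!: floor_mono)
  qed
  then have "finite (c ` S)"
    by (rule finite_subset) (intro finite_PiE J, auto)
  then obtain W where W: "W \<subseteq> S" "finite W" "c ` W = c ` S"
    by (metis finite_subset_image subset_refl)
  have "\<exists>w\<in>W. \<forall>j\<in>J. \<bar>v j - w j\<bar> \<le> \<epsilon>" if v: "v \<in> S" for v
  proof -
    have "c v \<in> c ` W" using W(3) v by blast
    then obtain w where w: "w \<in> W" "c v = c w" by blast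
    have "\<bar>v j - w j\<bar> \<le> \<epsilon>" if "j \<in> J" for j
    proof -
      have "\<lfloor>v j / \<epsilon>\<rfloor> = \<lfloor>w j / \<epsilon>\<rfloor>"
        using fun_cong[OF w(2), of j] that by (simp add: c_def)
      then have "\<bar>v j / \<epsilon> - w j / \<epsilon>\<bar> \<le> 1" by linarith
      then have "\<bar>v j - w j\<bar> / \<epsilon> \<le> 1" using e by (simp flip: diff_divide_distrib)
      then show ?thesis using e by simp
    qed
    with w show ?thesis by blast
  qed
  with W show ?thesis by (intro exI[of _ W]) (auto simp: S_def)
qed

text \<open>Only the uniform components of the samples enter, so the event is the same for all b,
  \<sigma> and y, and independence and orthonormality apply without correction terms.\<close>

definition net_bad :: "nat \<Rightarrow> real \<Rightarrow> real \<Rightarrow> (('d::finite \<Rightarrow> nat) \<Rightarrow> real) set \<Rightarrow> nat \<Rightarrow> int^'d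
    \<Rightarrow> ((int^'d) \<times> nat \<Rightarrow> (real^'d) \<times> (real^'d)) \<Rightarrow> bool" where
  "net_bad Q h \<delta> W L i \<omega> \<longleftrightarrow>
     (\<exists>w\<in>W. (\<Sum>l<L. (\<Sum>j\<in>multi_idx Q. w j * eta h i j (fst (\<omega> (i, l))))\<^sup>2) \<le> (1 - \<delta>) * real L)"

text \<open>Union bound over the net. Its size will be a constant, since \<epsilon> is chosen
  without reference to \<Delta>.\<close>

lemma net_bad_prob:
  fixes i :: "int^'d::finite"
  assumes h: "h > 0" and I: "finite I" "i \<in> I" and W: "finite W"
    and w1: "\<And>w. w \<in> W \<Longrightarrow> (\<Sum>j\<in>multi_idx Q. (w j)\<^sup>2) = 1" and d: "\<delta> \<ge> 0"
  shows "{\<omega> \<in> space (alg1_samples I h L). net_bad Q h \<delta> W L i \<omega>} \<in> sets (alg1_samples I h L)"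
    and "emeasure (alg1_samples I h L) {\<omega> \<in> space (alg1_samples I h L). net_bad Q h \<delta> W L i \<omega>}
      \<le> ennreal (real (card W) * exp (- (real L * \<delta>\<^sup>2 / (2 * basis_bound TYPE('d) Q))))"
proof -
  let ?B = "basis_bound TYPE('d) Q"
  let ?P = "alg1_samples I h L"
  let ?E = "\<lambda>w. {\<omega> \<in> space ?P. (\<Sum>l<L. (\<Sum>j\<in>multi_idx Q. w j * eta h i j (fst (\<omega> (i, l))))\<^sup>2) \<le> (1 - \<delta>) * real L}"
  define M where "M = (\<lambda>(i :: int^'d, l :: nat). sample_law h i)"
  have P: "?P = PiM (I \<times> {..<L}) M" by (simp add: alg1_samples_def M_def)
  have prM: "prob_space (M p)" for p
    using prob_space_sample_law[OF h] by (auto simp: M_def split: prod.split)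
  have Mil: "M (i, l) = sample_law h i" for l by (simp add: M_def)
  let ?S = "{i} \<times> {..<L}"
  have sumS: "(\<Sum>p\<in>?S. F p) = (\<Sum>l<L. F (i, l))" for F :: "_ \<Rightarrow> real"
  proof -
    have "?S = Pair i ` {..<L}" by auto
    then show ?thesis by (simp add: sum.reindex inj_on_def)
  qed
  have E: "?E w \<in> sets ?P" for w
  proof -
    have f: "(\<lambda>x. (\<Sum>j\<in>multi_idx Q. w j * eta h i j (fst x))\<^sup>2) \<in> borel_measurable (sample_law h i)"
    proof -
      have "(\<lambda>u. (\<Sum>j\<in>multi_idx Q. w j * eta h i j u)\<^sup>2) \<in> borel_measurable borel"
        using h by (intro borel_measurable_continuous_onI continuous_intros) auto
      from measurable_compose[OF _ this, of fst "sample_law h i"] show ?thesis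
        by (simp add: measurable_fst'')
    qed
    have "(\<lambda>\<omega>. (\<Sum>j\<in>multi_idx Q. w j * eta h i j (fst (\<omega> (i, l))))\<^sup>2) \<in> borel_measurable ?P" if "l < L" for l
      using measurable_compose[OF measurable_component_singleton[of "(i, l)" "I \<times> {..<L}" M] f[folded Mil[of l]]] I that
      by (simp add: P)
    then have "(\<lambda>\<omega>. \<Sum>l<L. (\<Sum>j\<in>multi_idx Q. w j * eta h i j (fst (\<omega> (i, l))))\<^sup>2) \<in> borel_measurable ?P"
      by (intro borel_measurable_sum) auto
    then show ?thesis by measurable
  qed
  have bad: "{\<omega> \<in> space ?P. net_bad Q h \<delta> W L i \<omega>} = (\<Union>w\<in>W. ?E w)"
    by (auto simp: net_bad_def)
  show "{\<omega> \<in> space ?P. net_bad Q h \<delta> W L i \<omega>} \<in> sets ?P"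
    unfolding bad using W E by blast
  have le: "emeasure ?P (?E w) \<le> ennreal (exp (- (real L * \<delta>\<^sup>2 / (2 * ?B))))" if "w \<in> W" for w
  proof -
    let ?Z = "\<lambda>p. (\<Sum>j\<in>multi_idx Q. w j * eta h i j (fst p))\<^sup>2"
    have bdZ: "AE p in sample_law h i. 0 \<le> ?Z p \<and> ?Z p \<le> ?B"
      using AE_sample_law_cube[OF h, of i]
      by eventually_elim (use eta_linear_form_square_le[OF h _ w1[OF that]] in auto)
    have "emeasure (PiM (I \<times> {..<L}) M) {\<omega> \<in> space (PiM (I \<times> {..<L}) M). (\<Sum>p\<in>?S. ?Z (\<omega> p)) \<le> (1 - \<delta>) * real (card ?S)}
        \<le> ennreal (exp (- (real (card ?S) * \<delta>\<^sup>2 / (2 * ?B))))"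
      by (rule PiM_lower_tail[where N = "sample_law h i"])
         (use prM I Mil eta_linear_form_moment[OF h w1[OF that], of i] bdZ d basis_bound_ge_1[where 'd = 'd, of Q] in auto)
    then show ?thesis
      unfolding P sumS by (simp add: card_cartesian_product)
  qed
  have "emeasure ?P (\<Union>w\<in>W. ?E w) \<le> (\<Sum>w\<in>W. emeasure ?P (?E w))"
    using W E by (intro emeasure_subadditive_finite) auto
  also have "\<dots> \<le> (\<Sum>w\<in>W. ennreal (exp (- (real L * \<delta>\<^sup>2 / (2 * ?B)))))"
    by (intro sum_mono le)
  also have "\<dots> = ennreal (real (card W) * exp (- (real L * \<delta>\<^sup>2 / (2 * ?B))))"
    by (simp add: ennreal_mult ennreal_of_nat_eq_real_of_nat)
  finally show "emeasure ?P {\<omega> \<in> space ?P. net_bad Q h \<delta> W L i \<omega>}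
      \<le> ennreal (real (card W) * exp (- (real L * \<delta>\<^sup>2 / (2 * ?B))))"
    unfolding bad .
qed

section \<open>Gaussian expectations with Hermite weights\<close>

text \<open>A common integrable majorant: its product with the normal density is a multiple of a
  normal density of variance 2 in each coordinate. The rate 1/4 is a budget: 1/12 goes to the
  Hermite factor, and the remaining 1/6 covers either a power of the norm or the gain from
  truncation.\<close>

definition gauss_weight :: "real^'d::finite \<Rightarrow> real" where
  "gauss_weight \<xi> = exp ((norm \<xi>)\<^sup>2 / 4)"

lemma gauss_weight_prod: "gauss_weight \<xi> = (\<Prod>d\<in>UNIV. exp ((\<xi> $ d)\<^sup>2 / 4))"
  by (simp add: gauss_weight_def norm_vec_square sum_divide_distrib exp_sum)

lemma integrable_gauss_weight: "integrable (std_normal_vec :: (real^'d::finite) measure) gauss_weight"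
proof -
  have "std_normal_density t * exp (t\<^sup>2 / 4) = sqrt 2 * normal_density 0 (sqrt 2) t" for t
  proof -
    have "- t\<^sup>2 / 2 + t\<^sup>2 / 4 = - t\<^sup>2 / 4" by simp
    then have "exp (- t\<^sup>2 / 2) * exp (t\<^sup>2 / 4) = exp (- t\<^sup>2 / 4)"
      by (simp only: exp_add[symmetric])
    then show ?thesis
      by (simp add: normal_density_def real_sqrt_mult field_simps)
  qed
  then have "integrable lborel (\<lambda>t. std_normal_density t * exp (t\<^sup>2 / 4))"
    by simp
  from integrable_std_normal_vec_prod[where g = "\<lambda>_ :: 'd. \<lambda>t. exp (t\<^sup>2 / 4)", OF _ this]
  show ?thesis by (simp add: gauss_weight_prod[abs_def])
qed

definition gauss_const :: "'d::finite itself \<Rightarrow> real" where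
  "gauss_const _ = (\<integral>\<xi>. gauss_weight \<xi> \<partial>(std_normal_vec :: (real^'d) measure))"

lemma gauss_const_nonneg: "0 \<le> gauss_const TYPE('d::finite)"
  unfolding gauss_const_def by (rule integral_nonneg_AE) (simp add: gauss_weight_def)

lemma
  fixes F :: "real^'d::finite \<Rightarrow> real"
  assumes "F \<in> borel_measurable borel" and le: "\<And>\<xi>. \<bar>F \<xi>\<bar> \<le> c * gauss_weight \<xi>"
  shows integrable_gauss_dominated: "integrable std_normal_vec F"
    and integral_gauss_dominated: "\<bar>\<integral>\<xi>. F \<xi> \<partial>std_normal_vec\<bar> \<le> c * gauss_const TYPE('d)"
proof -
  have w: "integrable std_normal_vec (\<lambda>\<xi> :: real^'d. c * gauss_weight \<xi>)"
    by (intro integrable_mult_right integrable_gauss_weight)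
  have m: "F \<in> borel_measurable std_normal_vec" using assms(1) by simp
  show int: "integrable std_normal_vec F"
    by (rule Bochner_Integration.integrable_bound[OF w m])
      (intro AE_I2, unfold real_norm_def, rule order_trans[OF le abs_ge_self])
  have "\<bar>\<integral>\<xi>. F \<xi> \<partial>std_normal_vec\<bar> \<le> (\<integral>\<xi>. \<bar>F \<xi>\<bar> \<partial>std_normal_vec)"
    using integral_norm_bound[of std_normal_vec F] by simp
  also have "\<dots> \<le> (\<integral>\<xi>. c * gauss_weight \<xi> \<partial>(std_normal_vec :: (real^'d) measure))"
    using int w le by (intro integral_mono) auto
  also have "\<dots> = c * gauss_const TYPE('d)"
    by (simp add: gauss_const_def)
  finally show "\<bar>\<integral>\<xi>. F \<xi> \<partial>std_normal_vec\<bar> \<le> c * gauss_const TYPE('d)" .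
qed

definition hermite_prod :: "('d::finite \<Rightarrow> nat) \<Rightarrow> real^'d \<Rightarrow> real" where
  "hermite_prod \<iota> x = (\<Prod>d\<in>UNIV. hermite (\<iota> d) (x $ d))"

lemma hermite_multi_eq: "hermite_multi \<Delta> \<iota> x = \<Delta> powr (- real (l1 \<iota>) / 2) * hermite_prod \<iota> x"
  by (simp add: hermite_multi_def hermite_prod_def)

lemma continuous_on_hermite_prod [continuous_intros]:
  "continuous_on S f \<Longrightarrow> continuous_on S (\<lambda>x. hermite_prod \<iota> (f x))"
  unfolding hermite_prod_def hermite_eq_poly by (intro continuous_intros)

text \<open>Stating the bound for a vector dominated coordinatewise by \<xi> covers \<xi> and its
  truncation at once, with the same majorant.\<close>

lemma hermite_prod_bound:
  fixes \<iota> :: "'d::finite \<Rightarrow> nat"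
  shows "\<exists>H>0. \<forall>\<xi> \<zeta> :: real^'d. (\<forall>d. \<bar>\<zeta> $ d\<bar> \<le> \<bar>\<xi> $ d\<bar>) \<longrightarrow> \<bar>hermite_prod \<iota> \<zeta>\<bar> \<le> H * exp ((norm \<xi>)\<^sup>2 / 12)"
proof -
  have "\<forall>d. \<exists>C>0. \<forall>t. \<bar>hermite (\<iota> d) t\<bar> \<le> C * exp (1 / 12 * t\<^sup>2)"
    by (intro allI hermite_exp_bound) simp
  then obtain C where C: "\<And>d. C d > 0" "\<And>d t. \<bar>hermite (\<iota> d) t\<bar> \<le> C d * exp (1 / 12 * t\<^sup>2)"
    by metis
  have "\<bar>hermite_prod \<iota> \<zeta>\<bar> \<le> (\<Prod>d\<in>UNIV. C d) * exp ((norm \<xi>)\<^sup>2 / 12)"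
    if le: "\<forall>d. \<bar>\<zeta> $ d\<bar> \<le> \<bar>\<xi> $ d\<bar>" for \<xi> \<zeta> :: "real^'d"
  proof -
    have "\<bar>hermite_prod \<iota> \<zeta>\<bar> = (\<Prod>d\<in>UNIV. \<bar>hermite (\<iota> d) (\<zeta> $ d)\<bar>)"
      by (simp add: hermite_prod_def abs_prod)
    also have "\<dots> \<le> (\<Prod>d\<in>UNIV. C d * exp ((\<xi> $ d)\<^sup>2 / 12))"
    proof (intro prod_mono conjI)
      fix d
      have "\<bar>hermite (\<iota> d) (\<zeta> $ d)\<bar> \<le> C d * exp (1 / 12 * (\<zeta> $ d)\<^sup>2)" by (rule C)
      also have "\<dots> \<le> C d * exp ((\<xi> $ d)\<^sup>2 / 12)"
        using le C(1)[of d] by (intro mult_left_mono) (auto simp: abs_le_square_iff less_imp_le)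
      finally show "\<bar>hermite (\<iota> d) (\<zeta> $ d)\<bar> \<le> C d * exp ((\<xi> $ d)\<^sup>2 / 12)" .
    qed simp
    also have "\<dots> = (\<Prod>d\<in>UNIV. C d) * exp ((norm \<xi>)\<^sup>2 / 12)"
      by (simp add: prod.distrib norm_vec_square sum_divide_distrib exp_sum)
    finally show ?thesis .
  qed
  moreover have "(\<Prod>d\<in>UNIV. C d) > 0" using C(1) by (simp add: prod_pos)
  ultimately show ?thesis by blast
qed

definition hermite_const :: "('d::finite \<Rightarrow> nat) \<Rightarrow> real" where
  "hermite_const \<iota> = (SOME H. H > 0 \<and> (\<forall>\<xi> \<zeta> :: real^'d. (\<forall>d. \<bar>\<zeta> $ d\<bar> \<le> \<bar>\<xi> $ d\<bar>) \<longrightarrow>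
     \<bar>hermite_prod \<iota> \<zeta>\<bar> \<le> H * exp ((norm \<xi>)\<^sup>2 / 12)))"

lemma
  fixes \<iota> :: "'d::finite \<Rightarrow> nat"
  shows hermite_const_pos: "hermite_const \<iota> > 0"
    and abs_hermite_prod_le:
      "(\<And>d. \<bar>\<zeta> $ d\<bar> \<le> \<bar>\<xi> $ d\<bar>) \<Longrightarrow> \<bar>hermite_prod \<iota> \<zeta>\<bar> \<le> hermite_const \<iota> * exp ((norm \<xi>)\<^sup>2 / 12)"
  using someI_ex[OF hermite_prod_bound[of \<iota>]] by (auto simp: hermite_const_def)

text \<open>The monomial with exponents m is an accumulator. Expanding one linear form into
  coordinates shortens the list by one and raises |m| by one, so the hypothesis is preserved. With
  the list exhausted, some m d lies below \<iota> d, and the integral over that coordinate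
  vanishes.\<close>

lemma hermite_prod_orthogonal_linear:
  fixes \<iota> m :: "'d::finite \<Rightarrow> nat" and S :: "real^'d^'e"
  assumes "l1 m + length is < l1 \<iota>"
  shows "has_bochner_integral std_normal_vec
    (\<lambda>\<xi>. (\<Prod>d\<in>UNIV. hermite (\<iota> d) (\<xi> $ d) * (\<xi> $ d) ^ m d) * (\<Prod>i\<leftarrow>is. (S *v \<xi>) $ i)) 0"
  using assms
proof (induction "is" arbitrary: m)
  case Nil
  define g where "g d t = hermite (\<iota> d) t * t ^ m d" for d t
  have gp: "g d t = poly (hermite_poly (\<iota> d) * monom 1 (m d)) t" for d t
    by (simp add: g_def hermite_eq_poly poly_monom)
  have int: "integrable lborel (\<lambda>t. std_normal_density t * g d t)" for d
    unfolding gp by (rule integrable_std_normal_poly)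
  have m: "g d \<in> borel_measurable borel" for d
    unfolding gp[abs_def] by (intro borel_measurable_continuous_onI continuous_intros)
  have "\<exists>d. m d < \<iota> d"
  proof (rule ccontr)
    assume "\<not> (\<exists>d. m d < \<iota> d)"
    then have "l1 \<iota> \<le> l1 m" unfolding l1_def by (intro sum_mono) (simp add: not_less)
    then show False using Nil by simp
  qed
  then obtain d where "m d < \<iota> d" ..
  then have "(LBINT t. std_normal_density t * g d t) = 0"
    unfolding g_def by (rule hermite_orthogonal_power)
  then have "(\<Prod>d\<in>UNIV. LBINT t. std_normal_density t * g d t) = 0"
    by (intro prod_zero) auto
  then show ?case
    using integrable_std_normal_vec_prod[where g = g, OF m int]
      integral_std_normal_vec_prod[where g = g, OF m int]
    by (simp add: has_bochner_integral_iff g_def)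
next
  case (Cons i "is")
  have "(\<Prod>d\<in>UNIV. hermite (\<iota> d) (\<xi> $ d) * (\<xi> $ d) ^ m d) * (\<Prod>i\<leftarrow>i # is. (S *v \<xi>) $ i)
     = (\<Sum>e\<in>UNIV. S $ i $ e * ((\<Prod>d\<in>UNIV. hermite (\<iota> d) (\<xi> $ d) * (\<xi> $ d) ^ (m(e := Suc (m e))) d) * (\<Prod>i\<leftarrow>is. (S *v \<xi>) $ i)))" for \<xi>
  proof -
    have "(\<Prod>d\<in>UNIV. hermite (\<iota> d) (\<xi> $ d) * (\<xi> $ d) ^ (m(e := Suc (m e))) d)
        = (\<Prod>d\<in>UNIV. hermite (\<iota> d) (\<xi> $ d) * (\<xi> $ d) ^ m d) * (\<xi> $ e)" for e
    proof -
      have "(\<Prod>d\<in>UNIV. hermite (\<iota> d) (\<xi> $ d) * (\<xi> $ d) ^ (m(e := Suc (m e))) d)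
          = (\<Prod>d\<in>UNIV. (hermite (\<iota> d) (\<xi> $ d) * (\<xi> $ d) ^ m d) * (if d = e then \<xi> $ e else 1))"
        by (intro prod.cong) auto
      then show ?thesis by (simp add: prod.distrib)
    qed
    then show ?thesis
      by (simp add: matrix_vector_mult_def sum_distrib_left sum_distrib_right mult_ac)
  qed
  moreover have "has_bochner_integral std_normal_vec (\<lambda>\<xi>. \<Sum>e\<in>UNIV. S $ i $ e *
     ((\<Prod>d\<in>UNIV. hermite (\<iota> d) (\<xi> $ d) * (\<xi> $ d) ^ (m(e := Suc (m e))) d) * (\<Prod>i\<leftarrow>is. (S *v \<xi>) $ i))) (\<Sum>e\<in>UNIV. S $ i $ e * 0)"
  proof (intro has_bochner_integral_sum has_bochner_integral_mult_right Cons.IH)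
    fix e :: 'd
    have "l1 (m(e := Suc (m e))) = Suc (l1 m)"
    proof -
      have "l1 (m(e := Suc (m e))) = (\<Sum>d\<in>UNIV. m d + (if d = e then 1 else 0))"
        unfolding l1_def by (intro sum.cong) auto
      then show ?thesis by (simp add: sum.distrib l1_def)
    qed
    then show "l1 (m(e := Suc (m e))) + length is < l1 \<iota>" using Cons.prems by simp
  qed
  ultimately show ?case by simp
qed

lemma hermite_prod_orthogonal_taylor:
  fixes S :: "real^'d::finite^'d"
  shows "has_bochner_integral std_normal_vec (\<lambda>\<xi>. hermite_prod \<iota> \<xi> * taylor_poly (l1 \<iota>) y z (S *v \<xi>)) 0"
proof -
  have "has_bochner_integral std_normal_vec
     (\<lambda>\<xi>. \<Sum>k<l1 \<iota>. \<Sum>is | length is = k. (pdiff y is z / fact k) *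
        ((\<Prod>d\<in>UNIV. hermite (\<iota> d) (\<xi> $ d) * (\<xi> $ d) ^ (\<lambda>_. 0) d) * (\<Prod>i\<leftarrow>is. (S *v \<xi>) $ i)))
     (\<Sum>k<l1 \<iota>. \<Sum>is | length (is :: 'd list) = k. (pdiff y is z / fact k) * 0)"
    by (intro has_bochner_integral_sum has_bochner_integral_mult_right hermite_prod_orthogonal_linear)
       (auto simp: l1_def)
  then show ?thesis
    by (simp add: taylor_poly_def dir_deriv_def hermite_prod_def sum_distrib_left sum_divide_distrib mult_ac)
qed

lemma norm_matrix_vector_le:
  fixes S :: "real^'d::finite^'e::finite"
  assumes "onorm (\<lambda>v. S *v v) \<le> c"
  shows "norm (S *v x) \<le> c * norm x"
proof -
  have "norm (S *v x) \<le> onorm (\<lambda>v. S *v v) * norm x"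
    by (rule onorm) (rule matrix_vector_mul_bounded_linear)
  also have "\<dots> \<le> c * norm x" using assms by (intro mult_right_mono) auto
  finally show ?thesis .
qed

lemma exp_norm_le_weight:
  "exp ((norm \<xi>)\<^sup>2 / 12) \<le> gauss_weight \<xi>"
  "exp ((norm \<xi>)\<^sup>2 / 12) * exp ((norm \<xi>)\<^sup>2 / 12) \<le> gauss_weight \<xi>"
  "exp ((norm \<xi>)\<^sup>2 / 12) * exp ((norm \<xi>)\<^sup>2 / 6) \<le> gauss_weight \<xi>"
  by (simp_all add: gauss_weight_def flip: exp_add)

lemma continuous_on_taylor_poly:
  assumes "continuous_on S g"
  shows "continuous_on S (\<lambda>x. taylor_poly n f z (g x))"
proof -
  have "continuous_on S (\<lambda>x. \<Prod>i\<leftarrow>is. g x $ i)" for "is"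
    by (induction "is") (auto intro!: continuous_intros assms)
  then show ?thesis
    unfolding taylor_poly_def dir_deriv_def by (intro continuous_intros) auto
qed

text \<open>The Hermite weight kills the Taylor polynomial of degree below \<open>|\<iota>|\<close>; the remainder gains
  the factor \<open>\<Delta>\<^bsup>|\<iota>|/2\<^esup>\<close> that compensates the normalisation of the weight.\<close>

lemma cond_target_bound:
  fixes \<iota> :: "'d::finite \<Rightarrow> nat" and M c :: real
  shows "\<exists>C>0. \<forall>y \<Delta> b \<sigma> x k. Cb k y \<and> l1 \<iota> \<le> k \<and> (\<forall>is x. length is \<le> k \<longrightarrow> \<bar>pdiff y is x\<bar> \<le> M)
     \<and> 0 < \<Delta> \<and> onorm (\<lambda>v. \<sigma> x *v v) \<le> c \<longrightarrow> \<bar>cond_target y \<Delta> \<iota> b \<sigma> x\<bar> \<le> C"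
proof -
  let ?n = "l1 \<iota>"
  let ?H = "hermite_const \<iota>"
  note H = hermite_const_pos[of \<iota>] abs_hermite_prod_le[of \<xi> \<xi> \<iota> for \<xi>, OF order_refl]
  \<comment> \<open>Absorbs the power of |\<xi>| in the Taylor remainder into the rate 1/12; the
    Hermite factor takes another 1/12.\<close>
  obtain K where K: "K > 0" "\<And>t :: real. \<bar>t ^ ?n\<bar> \<le> K * exp (1 / 12 * t\<^sup>2)"
    using poly_exp_bound[of "1 / 12" "monom 1 ?n"] by (auto simp: poly_monom)
  define c0 where "c0 = ?H * (\<bar>M\<bar> * (real CARD('d) * \<bar>c\<bar>) ^ ?n * K)"
  define C where "C = c0 * gauss_const TYPE('d) + 1"
  have c0: "c0 \<ge> 0" using H K by (simp add: c0_def)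
  have "\<bar>cond_target y \<Delta> \<iota> b \<sigma> x\<bar> \<le> C"
    if Cb: "Cb k y" and n: "?n \<le> k" and M: "\<forall>is x. length is \<le> k \<longrightarrow> \<bar>pdiff y is x\<bar> \<le> M"
      and D: "0 < \<Delta>" and \<sigma>: "onorm (\<lambda>v. \<sigma> x *v v) \<le> c" for y \<Delta> b \<sigma> x k
  proof -
    define z where "z = x + \<Delta> *\<^sub>R b x"
    define S where "S = sqrt \<Delta> *\<^sub>R \<sigma> x"
    have S: "sqrt \<Delta> *\<^sub>R (\<sigma> x *v \<xi>) = S *v \<xi>" for \<xi>
      by (simp add: S_def scaleR_matrix_vector_assoc)
    have nS: "norm (S *v \<xi>) \<le> sqrt \<Delta> * (\<bar>c\<bar> * norm \<xi>)" for \<xi>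
    proof -
      have "norm (\<sigma> x *v \<xi>) \<le> \<bar>c\<bar> * norm \<xi>" using \<sigma> by (intro norm_matrix_vector_le) simp
      then show ?thesis using D by (simp add: S[symmetric])
    qed
    define R where "R \<xi> = y (z + S *v \<xi>) - taylor_poly ?n y z (S *v \<xi>)" for \<xi>
    have M0: "0 \<le> M" using M[rule_format, of "[]" 0] by simp
    have Rle: "\<bar>R \<xi>\<bar> \<le> \<Delta> powr (real ?n / 2) * (\<bar>M\<bar> * (real CARD('d) * \<bar>c\<bar>) ^ ?n * K) * exp ((norm \<xi>)\<^sup>2 / 12)" for \<xi>
    proof -
      have "\<bar>R \<xi>\<bar> \<le> M * (real CARD('d) * norm (S *v \<xi>)) ^ ?n"
        unfolding R_def using M n by (intro taylor_poly_error[OF Cb n]) auto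
      also have "\<dots> \<le> M * (real CARD('d) * (sqrt \<Delta> * (\<bar>c\<bar> * norm \<xi>))) ^ ?n"
        using M0 nS by (intro mult_left_mono power_mono) auto
      also have "\<dots> = sqrt \<Delta> ^ ?n * (\<bar>M\<bar> * (real CARD('d) * \<bar>c\<bar>) ^ ?n) * norm \<xi> ^ ?n"
        using M0 by (simp add: power_mult_distrib)
      also have "\<dots> \<le> sqrt \<Delta> ^ ?n * (\<bar>M\<bar> * (real CARD('d) * \<bar>c\<bar>) ^ ?n) * (K * exp ((norm \<xi>)\<^sup>2 / 12))"
        using K(2)[of "norm \<xi>"] D by (intro mult_left_mono) (auto simp: power_abs)
      also have "sqrt \<Delta> ^ ?n = \<Delta> powr (real ?n / 2)"
        using D by (simp add: powr_half_sqrt[symmetric] powr_powr flip: powr_realpow)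
      finally show ?thesis by (simp add: mult_ac)
    qed
    have contS: "continuous_on UNIV (\<lambda>\<xi>. S *v \<xi>)"
      by (intro linear_continuous_on matrix_vector_mul_bounded_linear)
    have yc: "continuous_on UNIV y" using Cb_continuous[OF Cb, of "[]"] by simp
    have Rm: "(\<lambda>\<xi>. hermite_prod \<iota> \<xi> * R \<xi>) \<in> borel_measurable borel"
      unfolding R_def
      by (intro borel_measurable_continuous_onI continuous_intros continuous_on_compose2[OF yc]
           continuous_on_taylor_poly contS) auto
    have dom: "\<bar>hermite_prod \<iota> \<xi> * R \<xi>\<bar> \<le> \<Delta> powr (real ?n / 2) * c0 * gauss_weight \<xi>" for \<xi>
    proof -
      let ?r = "\<Delta> powr (real ?n / 2) * (\<bar>M\<bar> * (real CARD('d) * \<bar>c\<bar>) ^ ?n * K)"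
      have "\<bar>hermite_prod \<iota> \<xi> * R \<xi>\<bar> \<le> (?H * exp ((norm \<xi>)\<^sup>2 / 12)) * (?r * exp ((norm \<xi>)\<^sup>2 / 12))"
        unfolding abs_mult using H by (intro mult_mono H Rle) auto
      also have "\<dots> = ?H * ?r * (exp ((norm \<xi>)\<^sup>2 / 12) * exp ((norm \<xi>)\<^sup>2 / 12))"
        by (simp only: mult_ac)
      also have "\<dots> \<le> ?H * ?r * gauss_weight \<xi>"
        using H K by (intro mult_left_mono exp_norm_le_weight) auto
      finally show ?thesis by (simp add: c0_def mult_ac)
    qed
    note intR = integrable_gauss_dominated[OF Rm dom] and bdR = integral_gauss_dominated[OF Rm dom]
    note T = hermite_prod_orthogonal_taylor[of \<iota> y z S, unfolded has_bochner_integral_iff]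
    have "cond_target y \<Delta> \<iota> b \<sigma> x = (\<integral>\<xi>. \<Delta> powr (- real ?n / 2) * (hermite_prod \<iota> \<xi> * R \<xi> + hermite_prod \<iota> \<xi> * taylor_poly ?n y z (S *v \<xi>)) \<partial>std_normal_vec)"
      unfolding cond_target_def hermite_multi_eq
      by (intro Bochner_Integration.integral_cong) (simp_all add: R_def S z_def algebra_simps)
    also have "\<dots> = \<Delta> powr (- real ?n / 2) * (\<integral>\<xi>. hermite_prod \<iota> \<xi> * R \<xi> \<partial>std_normal_vec)"
      using intR T by simp
    finally have "\<bar>cond_target y \<Delta> \<iota> b \<sigma> x\<bar> = \<Delta> powr (- real ?n / 2) * \<bar>\<integral>\<xi>. hermite_prod \<iota> \<xi> * R \<xi> \<partial>std_normal_vec\<bar>"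
      by (simp add: abs_mult)
    also have "\<dots> \<le> \<Delta> powr (- real ?n / 2) * (\<Delta> powr (real ?n / 2) * c0 * gauss_const TYPE('d))"
      by (intro mult_left_mono bdR) auto
    also have "\<dots> = c0 * gauss_const TYPE('d)"
      using D by (simp add: powr_minus)
    finally show ?thesis by (simp add: C_def)
  qed
  moreover have "C > 0" using c0 gauss_const_nonneg[where 'd = 'd] by (simp add: C_def add_nonneg_pos)
  ultimately show ?thesis by blast
qed

section \<open>Reference basis, regression error and truncation error\<close>

text \<open>The regression basis in coordinates where every cube becomes (-1, 1]^D. Bounds and
  moduli of continuity found here hold for all cubes and all h simultaneously.\<close>

definition ref_basis :: "('d::finite \<Rightarrow> nat) \<Rightarrow> real^'d \<Rightarrow> real" where
  "ref_basis j z = (\<Prod>d\<in>UNIV. sqrt (2 * real (j d) + 1) * legendre (j d) (z $ d))"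

lemma eta_ref_basis: "eta h i j x = ref_basis j ((2 / h) *\<^sub>R (x - center h i))"
  by (simp add: eta_def ref_basis_def mult.commute)

lemma continuous_on_ref_basis: "continuous_on S (ref_basis j)"
  unfolding ref_basis_def by (intro continuous_intros)

lemma ref_basis_bounded:
  "\<exists>E\<ge>1. \<forall>j\<in>(multi_idx Q :: ('d::finite \<Rightarrow> nat) set). \<forall>z. norm z \<le> R \<longrightarrow> \<bar>ref_basis j z\<bar> \<le> E"
proof -
  have "\<exists>C. \<forall>z :: real^'d. norm z \<le> R \<longrightarrow> \<bar>ref_basis j z\<bar> \<le> C" for j
  proof -
    have "bounded (ref_basis j ` cball (0 :: real^'d) R)"
      by (intro compact_imp_bounded compact_continuous_image continuous_on_ref_basis compact_cball)
    then obtain C where "\<forall>z\<in>cball (0 :: real^'d) R. \<bar>ref_basis j z\<bar> \<le> C"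
      by (auto simp: bounded_iff)
    then show ?thesis by (intro exI[of _ C]) simp
  qed
  then obtain C where C: "\<And>j z. norm z \<le> R \<Longrightarrow> \<bar>ref_basis j (z :: real^'d)\<bar> \<le> C j" by metis
  have "\<bar>ref_basis j z\<bar> \<le> 1 + (\<Sum>j\<in>multi_idx Q. \<bar>C j\<bar>)" if "j \<in> multi_idx Q" "norm z \<le> R" for j and z :: "real^'d"
  proof -
    have "\<bar>ref_basis j z\<bar> \<le> \<bar>C j\<bar>" using C[OF that(2), of j] by simp
    also have "\<dots> \<le> (\<Sum>j\<in>multi_idx Q. \<bar>C j\<bar>)" using that(1) by (intro member_le_sum) auto
    finally show ?thesis by simp
  qed
  moreover have "1 \<le> 1 + (\<Sum>j\<in>(multi_idx Q :: ('d \<Rightarrow> nat) set). \<bar>C j\<bar>)" by (simp add: sum_nonneg)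
  ultimately show ?thesis by blast
qed

lemma ref_basis_uniformly_continuous:
  assumes "\<epsilon> > 0"
  shows "\<exists>\<kappa>>0. \<kappa> \<le> 1 \<and> (\<forall>j\<in>(multi_idx Q :: ('d::finite \<Rightarrow> nat) set). \<forall>z z'. norm z \<le> R \<longrightarrow> norm z' \<le> R \<longrightarrow>
     norm (z - z') \<le> \<kappa> \<longrightarrow> \<bar>ref_basis j z - ref_basis j z'\<bar> \<le> \<epsilon>)"
proof -
  have "\<exists>\<kappa>>0. \<forall>z z' :: real^'d. norm z \<le> R \<longrightarrow> norm z' \<le> R \<longrightarrow> norm (z - z') < \<kappa> \<longrightarrow> \<bar>ref_basis j z - ref_basis j z'\<bar> \<le> \<epsilon>" for j
  proof -
    have "uniformly_continuous_on (cball (0 :: real^'d) R) (ref_basis j)"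
      by (intro compact_uniformly_continuous continuous_on_ref_basis compact_cball)
    then obtain \<kappa> where "\<kappa> > 0" "\<And>z z'. z \<in> cball (0 :: real^'d) R \<Longrightarrow> z' \<in> cball 0 R \<Longrightarrow> dist z' z < \<kappa> \<Longrightarrow>
        dist (ref_basis j z') (ref_basis j z) < \<epsilon>"
      using assms unfolding uniformly_continuous_on_def by metis
    then show ?thesis
      by (intro exI[of _ \<kappa>]) (auto simp: dist_norm less_imp_le)
  qed
  then obtain k where k: "\<And>j. k j > 0" "\<And>j z z' :: real^'d. norm z \<le> R \<Longrightarrow> norm z' \<le> R \<Longrightarrow>
      norm (z - z') < k j \<Longrightarrow> \<bar>ref_basis j z - ref_basis j z'\<bar> \<le> \<epsilon>"
    by metis
  \<comment> \<open>The inserted 1 keeps \<open>\<kappa>\<close> at most 1, and halving turns the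
    strict inequality of uniform continuity into a weak one.\<close>
  define \<kappa> where "\<kappa> = Min (insert 1 (k ` multi_idx Q)) / 2"
  have fin: "finite (insert 1 (k ` multi_idx Q))" by simp
  have "Min (insert 1 (k ` multi_idx Q)) > 0"
    using k(1) by (subst Min_gr_iff[OF fin]) auto
  then have \<kappa>: "\<kappa> > 0" "2 * \<kappa> \<le> 1" "\<And>j. j \<in> multi_idx Q \<Longrightarrow> 2 * \<kappa> \<le> k j"
    using Min_le[OF fin] by (auto simp: \<kappa>_def)
  show ?thesis
  proof (intro exI[of _ \<kappa>] conjI ballI allI impI)
    fix j :: "'d \<Rightarrow> nat" and z z' :: "real^'d"
    assume "j \<in> multi_idx Q" "norm z \<le> R" "norm z' \<le> R" "norm (z - z') \<le> \<kappa>"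
    then show "\<bar>ref_basis j z - ref_basis j z'\<bar> \<le> \<epsilon>"
      using \<kappa>(1) \<kappa>(3)[of j] by (intro k(2)) auto
  qed (use \<kappa> in auto)
qed

definition ref_span :: "nat \<Rightarrow> (real^'d::finite \<Rightarrow> real) \<Rightarrow> bool" where
  "ref_span Q f \<longleftrightarrow> (\<exists>\<alpha>. \<forall>z. f z = (\<Sum>j\<in>multi_idx Q. \<alpha> j * ref_basis j z))"

lemma ref_span_sum:
  assumes "\<And>k. k \<in> K \<Longrightarrow> ref_span Q (f k)"
  shows "ref_span Q (\<lambda>z. \<Sum>k\<in>K. c k * f k z)"
proof -
  have "\<forall>k\<in>K. \<exists>\<alpha>. \<forall>z. f k z = (\<Sum>j\<in>multi_idx Q. \<alpha> j * ref_basis j z)"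
    using assms by (simp add: ref_span_def)
  then obtain \<alpha> where \<alpha>: "\<And>k z. k \<in> K \<Longrightarrow> f k z = (\<Sum>j\<in>multi_idx Q. \<alpha> k j * ref_basis j z)"
    by metis
  have "(\<Sum>k\<in>K. c k * f k z) = (\<Sum>j\<in>multi_idx Q. (\<Sum>k\<in>K. c k * \<alpha> k j) * ref_basis j z)" for z
  proof -
    have "(\<Sum>k\<in>K. c k * f k z) = (\<Sum>k\<in>K. \<Sum>j\<in>multi_idx Q. c k * \<alpha> k j * ref_basis j z)"
      using \<alpha> by (intro sum.cong) (simp_all add: sum_distrib_left mult.assoc)
    also have "\<dots> = (\<Sum>j\<in>multi_idx Q. \<Sum>k\<in>K. c k * \<alpha> k j * ref_basis j z)"
      by (rule sum.swap)
    finally show ?thesis by (simp add: sum_distrib_right)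
  qed
  then show ?thesis
    unfolding ref_span_def by (intro exI[of _ "\<lambda>j. \<Sum>k\<in>K. c k * \<alpha> k j"] allI)
qed

lemma ref_span_basis: "j \<in> multi_idx Q \<Longrightarrow> ref_span Q (ref_basis j)"
  unfolding ref_span_def
  by (intro exI[of _ "\<lambda>k. if k = j then 1 else 0"]) (simp add: if_distrib[of "\<lambda>x. x * _"] cong: if_cong)

text \<open>Expanding each one-dimensional power in Legendre polynomials of no larger degree and
  multiplying out never raises the total degree, so the index set |j| \<le> Q suffices.\<close>

lemma ref_span_monomial:
  fixes m :: "'d::finite \<Rightarrow> nat"
  assumes "l1 m \<le> Q"
  shows "ref_span Q (\<lambda>z. \<Prod>d\<in>UNIV. (z $ d) ^ m d)"
proof -
  obtain c where c: "\<And>k t. t ^ k = (\<Sum>q\<le>k. c k q * legendre q t)"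
    using power_in_legendre_span by metis
  let ?K = "PiE UNIV (\<lambda>d :: 'd. {..m d})"
  define s where "s j = (\<Prod>d\<in>UNIV. c (m d) (j d) / sqrt (2 * real (j d) + 1))" for j :: "'d \<Rightarrow> nat"
  have "(\<Prod>d\<in>UNIV. (z $ d) ^ m d) = (\<Sum>j\<in>?K. s j * ref_basis j z)" for z :: "real^'d"
  proof -
    have "(\<Prod>d\<in>UNIV. (z $ d) ^ m d) = (\<Prod>d\<in>UNIV. \<Sum>q\<le>m d. c (m d) q * legendre q (z $ d))"
      by (intro prod.cong refl c)
    also have "\<dots> = (\<Sum>j\<in>?K. \<Prod>d\<in>UNIV. c (m d) (j d) * legendre (j d) (z $ d))"
      by (rule prod_sum_PiE) auto
    also have "\<dots> = (\<Sum>j\<in>?K. s j * ref_basis j z)"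
    proof (intro sum.cong refl)
      fix j :: "'d \<Rightarrow> nat"
      have "sqrt (2 * real (j d) + 1) \<noteq> 0" for d
      proof -
        have "2 * real (j d) + 1 > 0" by linarith
        then show ?thesis by simp
      qed
      then show "(\<Prod>d\<in>UNIV. c (m d) (j d) * legendre (j d) (z $ d)) = s j * ref_basis j z"
        unfolding s_def ref_basis_def prod.distrib[symmetric] by (intro prod.cong) auto
    qed
    finally show ?thesis .
  qed
  moreover have "?K \<subseteq> multi_idx Q"
  proof
    fix j :: "'d \<Rightarrow> nat" assume "j \<in> ?K"
    then have "l1 j \<le> l1 m" unfolding l1_def by (intro sum_mono) (auto simp: PiE_UNIV_domain Pi_iff)
    with assms show "j \<in> multi_idx Q" by (simp add: multi_idx_def)
  qed
  then have "ref_span Q (\<lambda>z. \<Sum>j\<in>?K. s j * ref_basis j z)"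
    by (intro ref_span_sum ref_span_basis) auto
  ultimately show ?thesis by simp
qed

lemma prod_list_count: "(\<Prod>i\<leftarrow>is. (z :: real^'d::finite) $ i) = (\<Prod>d\<in>UNIV. (z $ d) ^ count_list is d)"
proof (induction "is")
  case (Cons i "is")
  have "(\<Prod>d\<in>UNIV. (z $ d) ^ count_list (i # is) d) = (\<Prod>d\<in>UNIV. (z $ d) ^ count_list is d * (if d = i then z $ i else 1))"
    by (intro prod.cong) auto
  then show ?case using Cons by (simp add: prod.distrib)
qed simp

lemma l1_count_list: "l1 (count_list is) = length (is :: 'd::finite list)"
  by (simp add: l1_def sum_count_set[of "is" UNIV])

text \<open>Rescaling by h/2 only changes the coefficients of a polynomial. The Taylor polynomial
  thus becomes an admissible competitor in the least-squares problem of its cube.\<close>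

lemma taylor_poly_eta_span:
  fixes y :: "real^'d::finite \<Rightarrow> real"
  assumes h: "h \<noteq> 0"
  shows "\<exists>\<alpha>. \<forall>x. taylor_poly (Suc Q) y (center h i) (x - center h i) = (\<Sum>j\<in>multi_idx Q. \<alpha> j * eta h i j x)"
proof -
  let ?a = "center h i"
  have 1: "ref_span Q (\<lambda>z. \<Sum>is | length is = k. pdiff y is ?a * (\<Prod>i\<leftarrow>is. z $ i))" if "k \<le> Q" for k
    unfolding prod_list_count using that
    by (intro ref_span_sum ref_span_monomial) (simp add: l1_count_list)
  have "ref_span Q (\<lambda>z. \<Sum>k<Suc Q. ((h / 2) ^ k / fact k) * (\<Sum>is | length is = k. pdiff y is ?a * (\<Prod>i\<leftarrow>is. z $ i)))"
    by (intro ref_span_sum 1) simp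
  then obtain \<alpha> where \<alpha>: "\<And>z. (\<Sum>k<Suc Q. ((h / 2) ^ k / fact k) * (\<Sum>is | length is = k. pdiff y is ?a * (\<Prod>i\<leftarrow>is. z $ i)))
      = (\<Sum>j\<in>multi_idx Q. \<alpha> j * ref_basis j z)"
    unfolding ref_span_def by blast
  have "taylor_poly (Suc Q) y ?a (x - ?a) = (\<Sum>j\<in>multi_idx Q. \<alpha> j * eta h i j x)" for x
  proof -
    define z where "z = (2 / h) *\<^sub>R (x - ?a)"
    have z: "(x - ?a) = (h / 2) *\<^sub>R z" using h by (simp add: z_def)
    have p: "(\<Prod>i\<leftarrow>is. (x - ?a) $ i) = (h / 2) ^ length is * (\<Prod>i\<leftarrow>is. z $ i)" for "is"
      unfolding z by (induction "is") simp_all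
    have "taylor_poly (Suc Q) y ?a (x - ?a)
       = (\<Sum>k<Suc Q. ((h / 2) ^ k / fact k) * (\<Sum>is | length is = k. pdiff y is ?a * (\<Prod>i\<leftarrow>is. z $ i)))"
      unfolding taylor_poly_def dir_deriv_def
      by (intro sum.cong refl) (simp add: p sum_distrib_left sum_divide_distrib mult_ac)
    also have "\<dots> = (\<Sum>j\<in>multi_idx Q. \<alpha> j * eta h i j x)"
      by (simp only: \<alpha> eta_ref_basis z_def)
    finally show ?thesis .
  qed
  then show ?thesis by blast
qed

section \<open>Regression error and stability of the Gram matrix\<close>

text \<open>The coercivity constant and the residual sum of the competitor both scale with L, so L
  cancels and only the uniform residual and \<tau> remain.\<close>

lemma pinv_apply_coefficient_error:
  assumes J: "finite J" "j \<in> J" and \<tau>: "\<tau> > 0" and L: "L > 0"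
    and q: "\<And>v. \<tau> * real L * (\<Sum>j\<in>J. (v j)\<^sup>2) \<le> quad_form L J A v"
    and res: "\<And>l. l < L \<Longrightarrow> \<bar>Y l - (\<Sum>j\<in>J. A l j * \<beta> j)\<bar> \<le> e" and e: "e \<ge> 0"
  shows "\<bar>pinv_apply L J A Y j - \<beta> j\<bar> \<le> e / sqrt \<tau>"
proof -
  have "(\<tau> * real L) * (pinv_apply L J A Y j - \<beta> j)\<^sup>2 \<le> (\<tau> * real L) * (\<Sum>j\<in>J. (pinv_apply L J A Y j - \<beta> j)\<^sup>2)"
    using J \<tau> by (intro mult_left_mono member_le_sum) auto
  also have "\<dots> \<le> rss L J A Y \<beta>"
    by (rule pinv_apply_error) (use J \<tau> L q in auto)
  also have "\<dots> \<le> (\<Sum>l<L. e\<^sup>2)"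
    unfolding rss_def using res e by (intro sum_mono) (auto simp flip: abs_le_square_iff)
  finally have "real L * (\<tau> * (pinv_apply L J A Y j - \<beta> j)\<^sup>2) \<le> real L * e\<^sup>2"
    by (simp add: mult_ac)
  then have "\<tau> * (pinv_apply L J A Y j - \<beta> j)\<^sup>2 \<le> e\<^sup>2"
    using L by simp
  then have "(pinv_apply L J A Y j - \<beta> j)\<^sup>2 \<le> (e / sqrt \<tau>)\<^sup>2"
    using \<tau> by (simp add: power_divide field_simps)
  then show ?thesis
    using e \<tau> by (simp add: power2_le_iff_abs_le)
qed

text \<open>Let K be the number of columns. Replacing v by a net vector and the rows of AX by those
  of AU changes each linear form by at most 2 K E \<epsilon>, while the form on the net is at most K
  E. Hence its square falls by at most 4 K^2 E^2 \<epsilon> per sample. Homogeneity extends the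
  bound from the sphere to all v.\<close>

lemma quad_form_lower_from_net:
  fixes AX AU :: "nat \<Rightarrow> 'j \<Rightarrow> real"
  assumes J: "finite J" and E: "E \<ge> 1" "\<And>l j. l < L \<Longrightarrow> j \<in> J \<Longrightarrow> \<bar>AU l j\<bar> \<le> E"
    and X: "\<And>l j. l < L \<Longrightarrow> j \<in> J \<Longrightarrow> \<bar>AX l j - AU l j\<bar> \<le> \<epsilon>" and \<epsilon>: "\<epsilon> \<ge> 0"
    and W: "\<And>w. w \<in> W \<Longrightarrow> (\<Sum>j\<in>J. (w j)\<^sup>2) = 1"
      "\<And>v. (\<Sum>j\<in>J. (v j)\<^sup>2) = 1 \<Longrightarrow> \<exists>w\<in>W. \<forall>j\<in>J. \<bar>v j - w j\<bar> \<le> \<epsilon>"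
      "\<And>w. w \<in> W \<Longrightarrow> (1 - \<delta>) * real L \<le> (\<Sum>l<L. (\<Sum>j\<in>J. w j * AU l j)\<^sup>2)"
    and slack: "4 * (real (card J))\<^sup>2 * E\<^sup>2 * \<epsilon> \<le> 1 - \<delta> - \<tau>"
  shows "\<tau> * real L * (\<Sum>j\<in>J. (v j)\<^sup>2) \<le> quad_form L J AX v"
proof -
  let ?K = "real (card J)"
  have unit: "\<tau> * real L \<le> quad_form L J AX v" if v: "(\<Sum>j\<in>J. (v j)\<^sup>2) = 1" for v
  proof -
    obtain w where w: "w \<in> W" "\<And>j. j \<in> J \<Longrightarrow> \<bar>v j - w j\<bar> \<le> \<epsilon>" using W(2)[OF v] by blast
    have le1: "\<bar>u j\<bar> \<le> 1" if "(\<Sum>j\<in>J. (u j)\<^sup>2) = 1" "j \<in> J" for u :: "'j \<Rightarrow> real" and j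
    proof -
      have "(u j)\<^sup>2 \<le> (\<Sum>j\<in>J. (u j)\<^sup>2)" using J that by (intro member_le_sum) auto
      then show ?thesis using that by (simp add: abs_square_le_1)
    qed
    have sample: "(\<Sum>j\<in>J. w j * AU l j)\<^sup>2 - 4 * ?K\<^sup>2 * E\<^sup>2 * \<epsilon> \<le> (\<Sum>j\<in>J. AX l j * v j)\<^sup>2" if l: "l < L" for l
    proof -
      define a where "a = (\<Sum>j\<in>J. AX l j * v j)"
      define c where "c = (\<Sum>j\<in>J. w j * AU l j)"
      have "\<bar>a - c\<bar> = \<bar>\<Sum>j\<in>J. (AX l j - AU l j) * v j + AU l j * (v j - w j)\<bar>"
        unfolding a_def c_def by (subst sum_subtractf[symmetric]) (simp add: algebra_simps)
      also have "\<dots> \<le> (\<Sum>j\<in>J. \<epsilon> * 1 + E * \<epsilon>)"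
      proof (rule order_trans[OF sum_abs sum_mono])
        fix j assume j: "j \<in> J"
        have "\<bar>(AX l j - AU l j) * v j\<bar> \<le> \<epsilon> * 1"
          unfolding abs_mult using X[OF l j] le1[OF v j] \<epsilon> by (intro mult_mono) auto
        moreover have "\<bar>AU l j * (v j - w j)\<bar> \<le> E * \<epsilon>"
          unfolding abs_mult using E(1) E(2)[OF l j] w(2)[OF j] by (intro mult_mono) auto
        ultimately show "\<bar>(AX l j - AU l j) * v j + AU l j * (v j - w j)\<bar> \<le> \<epsilon> * 1 + E * \<epsilon>" by linarith
      qed
      also have "\<dots> = ?K * (\<epsilon> * 1 + E * \<epsilon>)" by simp
      also have "\<dots> \<le> ?K * (E * \<epsilon> + E * \<epsilon>)"
        using E(1) \<epsilon> mult_right_mono[of 1 E \<epsilon>] by (intro mult_left_mono) auto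
      finally have ac: "\<bar>a - c\<bar> \<le> 2 * ?K * E * \<epsilon>" by (simp add: mult_ac)
      have "\<bar>c\<bar> \<le> (\<Sum>j\<in>J. 1 * E)"
        unfolding c_def
      proof (rule order_trans[OF sum_abs sum_mono])
        fix j assume j: "j \<in> J"
        show "\<bar>w j * AU l j\<bar> \<le> 1 * E"
          unfolding abs_mult using E(2)[OF l j] le1[OF W(1)[OF w(1)] j] by (intro mult_mono) auto
      qed
      then have c: "\<bar>c\<bar> \<le> ?K * E" by simp
      \<comment> \<open>Expanding around \<open>c\<close> leaves a quadratic term of favourable
        sign, so a bound on \<open>c\<close> suffices and none on \<open>a\<close> enters.\<close>
      have "c\<^sup>2 - a\<^sup>2 = 2 * c * (c - a) - (a - c)\<^sup>2" by (simp add: power2_eq_square algebra_simps)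
      also have "\<dots> \<le> 2 * c * (c - a)" by simp
      also have "\<dots> \<le> 2 * (\<bar>c\<bar> * \<bar>a - c\<bar>)"
        by (metis abs_ge_self abs_minus_commute abs_mult mult.assoc mult_left_mono zero_le_numeral)
      also have "\<dots> \<le> 2 * ((?K * E) * (2 * ?K * E * \<epsilon>))"
        using ac c E(1) by (intro mult_left_mono mult_mono) auto
      also have "\<dots> = 4 * ?K\<^sup>2 * E\<^sup>2 * \<epsilon>" by (simp add: power2_eq_square)
      finally show ?thesis by (simp add: a_def c_def)
    qed
    have "\<tau> * real L \<le> (1 - \<delta>) * real L - real L * (4 * ?K\<^sup>2 * E\<^sup>2 * \<epsilon>)"
      using mult_left_mono[OF slack, of "real L"] by (simp add: algebra_simps)
    also have "\<dots> \<le> (\<Sum>l<L. (\<Sum>j\<in>J. w j * AU l j)\<^sup>2) - real L * (4 * ?K\<^sup>2 * E\<^sup>2 * \<epsilon>)"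
      using W(3)[OF w(1)] by simp
    also have "\<dots> = (\<Sum>l<L. (\<Sum>j\<in>J. w j * AU l j)\<^sup>2 - 4 * ?K\<^sup>2 * E\<^sup>2 * \<epsilon>)"
      by (simp add: sum_subtractf)
    also have "\<dots> \<le> quad_form L J AX v"
      unfolding quad_form_def by (intro sum_mono sample) simp
    finally show ?thesis .
  qed
  show ?thesis
  proof (cases "(\<Sum>j\<in>J. (v j)\<^sup>2) = 0")
    case True
    then show ?thesis by (simp add: quad_form_nonneg)
  next
    case False
    define s where "s = sqrt (\<Sum>j\<in>J. (v j)\<^sup>2)"
    have s: "s > 0" "s\<^sup>2 = (\<Sum>j\<in>J. (v j)\<^sup>2)"
      using False by (auto simp: s_def sum_nonneg less_le)
    have "(\<Sum>j\<in>J. (v j / s)\<^sup>2) = 1"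
      using s(1) by (simp add: power_divide sum_divide_distrib[symmetric] flip: s(2))
    from unit[OF this] have "\<tau> * real L \<le> quad_form L J AX v / s\<^sup>2"
      by (simp add: quad_form_def sum_divide_distrib[symmetric] power_divide)
    then have "\<tau> * real L * s\<^sup>2 \<le> quad_form L J AX v" using s(1) by (simp add: field_simps)
    then show ?thesis by (simp only: s(2))
  qed
qed

section \<open>Truncated noise and Euler steps\<close>

lemma abs_trunc_vec_nth_le: "r \<ge> 0 \<Longrightarrow> \<bar>trunc_vec r \<xi> $ d\<bar> \<le> \<bar>\<xi> $ d\<bar>"
  "r \<ge> 0 \<Longrightarrow> \<bar>trunc_vec r \<xi> $ d\<bar> \<le> r"
  by (auto simp: trunc_vec_def max_def min_def)

lemma trunc_vec_id: "norm \<xi> \<le> r \<Longrightarrow> trunc_vec r \<xi> = \<xi>"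
proof -
  assume "norm \<xi> \<le> r"
  then have "\<bar>\<xi> $ d\<bar> \<le> r" for d using component_le_norm_cart[of \<xi> d] by linarith
  then have "max (min (\<xi> $ d) r) (- r) = \<xi> $ d" for d
    by (auto simp: max_def min_def abs_le_iff minus_le_iff dest: spec) (metis abs_le_iff minus_le_iff antisym)+
  then show ?thesis by (simp add: trunc_vec_def vec_eq_iff)
qed

lemma norm_trunc_vec_le: "r \<ge> 0 \<Longrightarrow> norm (trunc_vec r (\<xi> :: real^'d::finite)) \<le> real CARD('d) * r"
  using norm_le_l1_cart[of "trunc_vec r \<xi>"] sum_bounded_above[of UNIV "\<lambda>d. \<bar>trunc_vec r \<xi> $ d\<bar>" r]
    abs_trunc_vec_nth_le(2)[of r \<xi>] by auto

lemma continuous_on_trunc_vec: "continuous_on UNIV (trunc_vec r)"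
  unfolding trunc_vec_def by (intro continuous_on_vec_lambda continuous_intros)

text \<open>Keeping the noise as an argument makes the target and the estimator instances of one
  map, evaluated at \<xi> and at its truncation.\<close>

definition euler_step :: "real \<Rightarrow> (real^'d::finite \<Rightarrow> real^'d) \<Rightarrow> (real^'d \<Rightarrow> real^'d^'d) \<Rightarrow> real^'d \<Rightarrow> real^'d \<Rightarrow> real^'d" where
  "euler_step \<Delta> b \<sigma> x \<zeta> = x + \<Delta> *\<^sub>R b x + sqrt \<Delta> *\<^sub>R (\<sigma> x *v \<zeta>)"

lemma continuous_on_euler_step [continuous_intros]:
  fixes g :: "'a::topological_space \<Rightarrow> real^'d::finite"
  assumes "continuous_on S g"
  shows "continuous_on S (\<lambda>\<zeta>. euler_step \<Delta> b \<sigma> x (g \<zeta>))"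
proof -
  have "continuous_on UNIV (\<lambda>\<zeta>. \<sigma> x *v \<zeta>)"
    by (intro linear_continuous_on matrix_vector_mul_bounded_linear)
  from continuous_on_compose2[OF this assms] show ?thesis
    unfolding euler_step_def by (intro continuous_intros) auto
qed

abbreviation trunc_step where
  "trunc_step \<Delta> b \<sigma> r x \<xi> \<equiv> euler_step \<Delta> b \<sigma> x (trunc_vec r \<xi>)"

lemma norm_euler_step_diff:
  assumes b: "norm (b x) \<le> c" and \<sigma>: "onorm (\<lambda>v. \<sigma> x *v v) \<le> c" and D: "\<Delta> \<ge> 0" and \<zeta>: "norm \<zeta> \<le> s"
  shows "norm (euler_step \<Delta> b \<sigma> x \<zeta> - x) \<le> \<Delta> * c + sqrt \<Delta> * (c * s)"
proof -
  have c: "c \<ge> 0" using norm_ge_zero b order_trans by blast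
  have "norm (euler_step \<Delta> b \<sigma> x \<zeta> - x) \<le> norm (\<Delta> *\<^sub>R b x) + norm (sqrt \<Delta> *\<^sub>R (\<sigma> x *v \<zeta>))"
    unfolding euler_step_def by (rule order_trans[OF _ norm_triangle_ineq]) simp
  also have "\<dots> = \<Delta> * norm (b x) + sqrt \<Delta> * norm (\<sigma> x *v \<zeta>)" using D by simp
  also have "\<dots> \<le> \<Delta> * c + sqrt \<Delta> * (c * s)"
  proof (intro add_mono mult_left_mono)
    show "norm (\<sigma> x *v \<zeta>) \<le> c * s"
      using norm_matrix_vector_le[OF \<sigma>, of \<zeta>] mult_left_mono[OF \<zeta> c] by linarith
  qed (use b D in auto)
  finally show ?thesis .
qed

text \<open>On \<open>{|\<xi>| > r}\<close>, the only place where truncation matters, \<open>1 \<le> exp ((|\<xi>|\<^sup>2 - r\<^sup>2) / 6)\<close>.\<close>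

lemma cond_target_truncation_error:
  fixes \<iota> :: "'d::finite \<Rightarrow> nat" and y P :: "real^'d \<Rightarrow> real"
  assumes y: "continuous_on UNIV y" and P: "continuous_on UNIV P" and M: "\<And>x. \<bar>y x\<bar> \<le> M" and r: "r \<ge> 0"
    and e: "\<And>\<xi>. \<bar>y (trunc_step \<Delta> b \<sigma> r x \<xi>) - P (trunc_step \<Delta> b \<sigma> r x \<xi>)\<bar> \<le> e"
  shows "\<bar>cond_target y \<Delta> \<iota> b \<sigma> x - (\<integral>\<xi>. P (trunc_step \<Delta> b \<sigma> r x \<xi>) * hermite_multi \<Delta> \<iota> (trunc_vec r \<xi>) \<partial>std_normal_vec)\<bar>
      \<le> \<Delta> powr (- real (l1 \<iota>) / 2) * (hermite_const \<iota> * gauss_const TYPE('d) * (2 * M * exp (- (r\<^sup>2) / 6) + e))"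
proof -
  let ?X = "euler_step \<Delta> b \<sigma> x" and ?t = "trunc_vec r" and ?h = "hermite_prod \<iota>"
  let ?p = "\<Delta> powr (- real (l1 \<iota>) / 2)" and ?H = "hermite_const \<iota>" and ?m = "2 * M * exp (- (r\<^sup>2) / 6)"
  note H = hermite_const_pos[of \<iota>]
  have M0: "M \<ge> 0" using M[of 0] by linarith
  have e0: "e \<ge> 0" using e[of 0] by linarith
  have h: "\<bar>?h \<xi>\<bar> \<le> ?H * exp ((norm \<xi>)\<^sup>2 / 12)" "\<bar>?h (?t \<xi>)\<bar> \<le> ?H * exp ((norm \<xi>)\<^sup>2 / 12)" for \<xi>
    using abs_trunc_vec_nth_le(1)[OF r] by (auto intro!: abs_hermite_prod_le)
  have hW: "\<bar>?h \<xi>\<bar> \<le> ?H * gauss_weight \<xi>" "\<bar>?h (?t \<xi>)\<bar> \<le> ?H * gauss_weight \<xi>" for \<xi>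
    using h[of \<xi>] mult_left_mono[OF exp_norm_le_weight(1)[of \<xi>], of ?H] H by linarith+
  define F1 where "F1 \<xi> = ?h \<xi> * y (?X \<xi>)" for \<xi>
  define F2 where "F2 \<xi> = P (?X (?t \<xi>)) * ?h (?t \<xi>)" for \<xi>
  have m1: "F1 \<in> borel_measurable borel"
    unfolding F1_def by (intro borel_measurable_continuous_onI continuous_intros continuous_on_compose2[OF y]) auto
  have m2: "F2 \<in> borel_measurable borel"
    unfolding F2_def
    by (intro borel_measurable_continuous_onI continuous_intros continuous_on_compose2[OF P] continuous_on_trunc_vec) auto
  have b1: "\<bar>F1 \<xi>\<bar> \<le> (?H * M) * gauss_weight \<xi>" for \<xi>
    using mult_mono[OF hW(1)[of \<xi>] M[of "?X \<xi>"]] H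
    by (simp add: F1_def abs_mult mult_ac gauss_weight_def)
  have Ple: "\<bar>P (?X (?t \<xi>))\<bar> \<le> M + e" for \<xi>
    using e[of \<xi>] M[of "?X (?t \<xi>)"] by linarith
  have b2: "\<bar>F2 \<xi>\<bar> \<le> ((M + e) * ?H) * gauss_weight \<xi>" for \<xi>
    using mult_mono[OF Ple hW(2)[of \<xi>]] M0 e0 by (simp add: F2_def abs_mult mult_ac)
  have b12: "\<bar>F1 \<xi> - F2 \<xi>\<bar> \<le> (?H * (?m + e)) * gauss_weight \<xi>" for \<xi>
  proof -
    \<comment> \<open>The difference is split into the effect of truncating the noise with
      \<open>y\<close> kept, and that of replacing \<open>y\<close> by \<open>P\<close> at the
      truncated step, the only points where the two are known to be close.\<close>
    let ?d = "?h \<xi> * y (?X \<xi>) - ?h (?t \<xi>) * y (?X (?t \<xi>))"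
    have A: "\<bar>?d\<bar> \<le> ?H * ?m * gauss_weight \<xi>"
    proof (cases "norm \<xi> \<le> r")
      case True
      then show ?thesis using H M0 by (simp add: trunc_vec_id gauss_weight_def)
    next
      case False
      let ?e = "exp ((norm \<xi>)\<^sup>2 / 12)"
      from False have "r\<^sup>2 \<le> (norm \<xi>)\<^sup>2" using r by (intro power_mono) auto
      then have one: "1 \<le> exp (- (r\<^sup>2) / 6) * exp ((norm \<xi>)\<^sup>2 / 6)"
        by (simp flip: exp_add)
      have "\<bar>?d\<bar> \<le> \<bar>?h \<xi>\<bar> * \<bar>y (?X \<xi>)\<bar> + \<bar>?h (?t \<xi>)\<bar> * \<bar>y (?X (?t \<xi>))\<bar>"
        by (metis abs_mult abs_triangle_ineq4)
      also have "\<dots> \<le> (?H * ?e) * M + (?H * ?e) * M"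
        using h[of \<xi>] M H by (intro add_mono mult_mono) auto
      also have "\<dots> = ?H * (2 * M) * ?e * 1" by simp
      also have "\<dots> \<le> ?H * (2 * M) * ?e * (exp (- (r\<^sup>2) / 6) * exp ((norm \<xi>)\<^sup>2 / 6))"
        using one H M0 by (intro mult_left_mono) auto
      also have "\<dots> = ?H * ?m * (?e * exp ((norm \<xi>)\<^sup>2 / 6))"
        by (simp only: mult_ac)
      also have "\<dots> \<le> ?H * ?m * gauss_weight \<xi>"
        using H M0 by (intro mult_left_mono exp_norm_le_weight) auto
      finally show ?thesis .
    qed
    have B: "\<bar>?h (?t \<xi>) * (y (?X (?t \<xi>)) - P (?X (?t \<xi>)))\<bar> \<le> (?H * gauss_weight \<xi>) * e"
      unfolding abs_mult using hW(2)[of \<xi>] e H by (intro mult_mono) (auto simp: gauss_weight_def)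
    have "F1 \<xi> - F2 \<xi> = ?d + ?h (?t \<xi>) * (y (?X (?t \<xi>)) - P (?X (?t \<xi>)))"
      by (simp add: F1_def F2_def algebra_simps)
    then show ?thesis using A B by (simp add: algebra_simps)
  qed
  note i1 = integrable_gauss_dominated[OF m1 b1] and i2 = integrable_gauss_dominated[OF m2 b2]
  have c1: "cond_target y \<Delta> \<iota> b \<sigma> x = ?p * (\<integral>\<xi>. F1 \<xi> \<partial>std_normal_vec)"
    unfolding cond_target_def F1_def hermite_multi_eq euler_step_def by (simp add: mult.assoc)
  have "P (?X (?t \<xi>)) * (?p * ?h (?t \<xi>)) = ?p * F2 \<xi>" for \<xi>
    by (simp only: F2_def mult.left_commute)
  then have c2: "(\<integral>\<xi>. P (?X (?t \<xi>)) * hermite_multi \<Delta> \<iota> (?t \<xi>) \<partial>std_normal_vec) = ?p * (\<integral>\<xi>. F2 \<xi> \<partial>std_normal_vec)"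
    unfolding hermite_multi_eq by (simp only: integral_mult_right_zero)
  have "\<bar>cond_target y \<Delta> \<iota> b \<sigma> x - (\<integral>\<xi>. P (?X (?t \<xi>)) * hermite_multi \<Delta> \<iota> (?t \<xi>) \<partial>std_normal_vec)\<bar>
      = ?p * \<bar>\<integral>\<xi>. F1 \<xi> - F2 \<xi> \<partial>std_normal_vec\<bar>"
    unfolding c1 c2 using i1 i2 by (simp add: abs_mult flip: right_diff_distrib)
  also have "\<dots> \<le> ?p * ((?H * (?m + e)) * gauss_const TYPE('d))"
    using m1 m2 by (intro mult_left_mono integral_gauss_dominated b12) auto
  finally show ?thesis by (simp only: mult_ac)
qed

section \<open>Cubes and the estimator on one cube\<close>

lemma cube_center_dist:
  fixes i :: "int^'d::finite"
  assumes "h > 0" "u \<in> cube h i"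
  shows "norm ((2 / h) *\<^sub>R (u - center h i)) \<le> real CARD('d)"
proof -
  have "\<bar>((2 / h) *\<^sub>R (u - center h i)) $ d\<bar> \<le> 1" for d
    using cube_scaled[OF assms, of d] by (simp add: mult.commute)
  then have "(\<Sum>d\<in>UNIV. \<bar>((2 / h) *\<^sub>R (u - center h i)) $ d\<bar>) \<le> real CARD('d) * 1"
    by (intro sum_bounded_above) auto
  from order_trans[OF norm_le_l1_cart this] show ?thesis by (simp only: mult_1_right)
qed

text \<open>Scaling by 2/h turns a step of length \<kappa> h / 2 into one of length \<kappa>. The
  scaled cube has radius at most D, so all steps end in the ball of radius D + 1, on which the
  reference basis is controlled.\<close>

lemma cube_neighbour_dist:
  fixes i :: "int^'d::finite"
  assumes h: "h > 0" "u \<in> cube h i" and p: "norm (p - u) \<le> \<kappa> * h / 2" and \<kappa>: "\<kappa> \<le> 1"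
  shows "norm ((2 / h) *\<^sub>R (p - u)) \<le> \<kappa>"
    and "norm ((2 / h) *\<^sub>R (p - center h i)) \<le> real CARD('d) + 1"
    and "norm (p - center h i) \<le> (real CARD('d) + 1) * h"
proof -
  have eq: "norm ((2 / h) *\<^sub>R (p - u)) = 2 / h * norm (p - u)" using h(1) by simp
  also have "\<dots> \<le> 2 / h * (\<kappa> * h / 2)" using p h(1) by (intro mult_left_mono) auto
  finally show 1: "norm ((2 / h) *\<^sub>R (p - u)) \<le> \<kappa>" using h(1) by simp
  have split: "(2 / h) *\<^sub>R (p - center h i) = (2 / h) *\<^sub>R (p - u) + (2 / h) *\<^sub>R (u - center h i)"
    by (simp flip: scaleR_add_right)
  show 2: "norm ((2 / h) *\<^sub>R (p - center h i)) \<le> real CARD('d) + 1"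
    unfolding split using norm_triangle_ineq[of "(2 / h) *\<^sub>R (p - u)" "(2 / h) *\<^sub>R (u - center h i)"] 1 \<kappa> cube_center_dist[OF h]
    by linarith
  have "norm (p - center h i) = h / 2 * norm ((2 / h) *\<^sub>R (p - center h i))" using h(1) by simp
  also have "\<dots> \<le> h / 2 * (real CARD('d) + 1)" using 2 h(1) by (intro mult_left_mono) auto
  also have "\<dots> \<le> (real CARD('d) + 1) * h" using h(1) by (simp add: field_simps)
  finally show "norm (p - center h i) \<le> (real CARD('d) + 1) * h" .
qed

lemma cube_disjoint:
  assumes "h > 0" "x \<in> cube h i" "x \<in> cube h k"
  shows "i = k"
proof -
  have "i $ d = k $ d" for d
  proof -
    have "h * of_int (i $ d) < h * (of_int (k $ d) + 1)" "h * of_int (k $ d) < h * (of_int (i $ d) + 1)"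
      using assms(2,3) unfolding cube_def mem_Collect_eq by (meson less_le_trans)+
    then have "of_int (i $ d) < (of_int (k $ d) + 1 :: real)" "of_int (k $ d) < (of_int (i $ d) + 1 :: real)"
      using assms(1) by (simp_all only: mult_less_cancel_left_pos)
    then show ?thesis by linarith
  qed
  then show ?thesis by (simp add: vec_eq_iff)
qed

lemma cube_cover:
  assumes "h > 0"
  shows "\<exists>i. x \<in> cube h i"
proof -
  define i :: "int^'a" where "i = (\<chi> d. \<lceil>x $ d / h\<rceil> - 1)"
  have "of_int (i $ d) < x $ d / h" "x $ d / h \<le> of_int (i $ d) + 1" for d
    unfolding i_def by (simp_all, linarith)
  then have "x \<in> cube h i" using assms by (auto simp: cube_def field_simps)
  then show ?thesis ..
qed

lemma finite_alg1_I:
  assumes "h > 0"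
  shows "finite (alg1_I h r :: (int^'d::finite) set)"
proof (rule finite_subset)
  let ?N = "\<lceil>\<bar>r\<bar> / h\<rceil> + 1"
  show "(alg1_I h r :: (int^'d) set) \<subseteq> vec_lambda ` PiE UNIV (\<lambda>_. {- ?N..?N})"
  proof
    fix i :: "int^'d" assume "i \<in> alg1_I h r"
    then obtain x where x: "x \<in> cube h i" "norm x \<le> r" by (auto simp: alg1_I_def)
    have "i $ d \<in> {- ?N..?N}" for d
    proof -
      have a: "\<bar>x $ d\<bar> \<le> \<bar>r\<bar>" using component_le_norm_cart[of x d] x(2) by linarith
      have "h * of_int (i $ d) \<le> \<bar>r\<bar>" "- \<bar>r\<bar> \<le> h * (of_int (i $ d) + 1)"
        using x(1) a by (auto simp: cube_def abs_le_iff dest!: spec[of _ d])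
      then have "of_int (i $ d) \<le> \<bar>r\<bar> / h" "- (\<bar>r\<bar> / h) \<le> of_int (i $ d) + 1"
        using assms by (simp_all add: field_simps)
      then show ?thesis by (simp, linarith)
    qed
    then have "(\<lambda>d. i $ d) \<in> PiE UNIV (\<lambda>_. {- ?N..?N})" by (simp add: PiE_UNIV_domain)
    then show "i \<in> vec_lambda ` PiE UNIV (\<lambda>_. {- ?N..?N})"
      by (intro image_eqI[of _ _ "\<lambda>d. i $ d"]) (auto simp: vec_eq_iff)
  qed
  show "finite (vec_lambda ` PiE (UNIV :: 'd set) (\<lambda>_. {- ?N..?N}))"
    by (intro finite_imageI finite_PiE) auto
qed

lemma outside_cubes_norm:
  assumes h: "h > 0" and x: "\<And>i. i \<in> alg1_I h r \<Longrightarrow> x \<notin> cube h i"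
  shows "norm x > r"
proof (rule ccontr)
  assume "\<not> norm x > r"
  moreover obtain i where "x \<in> cube h i" using cube_cover[OF h] by blast
  ultimately have "i \<in> alg1_I h r" by (auto simp: alg1_I_def)
  with x \<open>x \<in> cube h i\<close> show False by blast
qed

abbreviation sample_point where
  "sample_point \<Delta> b \<sigma> r \<omega> i l \<equiv> trunc_step \<Delta> b \<sigma> r (fst (\<omega> (i, l))) (snd (\<omega> (i, l)))"

abbreviation design_matrix where
  "design_matrix h \<Delta> b \<sigma> r \<omega> i \<equiv> (\<lambda>l j. eta h i j (sample_point \<Delta> b \<sigma> r \<omega> i l))"

abbreviation fitted_coeffs where
  "fitted_coeffs y Q L h \<Delta> b \<sigma> r \<omega> i \<equiv>
     pinv_apply L (multi_idx Q) (design_matrix h \<Delta> b \<sigma> r \<omega> i) (\<lambda>l. y (sample_point \<Delta> b \<sigma> r \<omega> i l))"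

abbreviation basis_mean where
  "basis_mean h \<Delta> \<iota> b \<sigma> r x i j \<equiv>
     \<integral>\<xi>. eta h i j (trunc_step \<Delta> b \<sigma> r x \<xi>) * hermite_multi \<Delta> \<iota> (trunc_vec r \<xi>) \<partial>std_normal_vec"

text \<open>Used in contrapositive form: failure of the test on the Euler points forces
  \<open>net_bad\<close> on the uniform points, which moves the estimate from the actual branch of
  the algorithm to an event of known probability.\<close>

lemma smallest_sv_large:
  fixes \<omega> :: "(int^'d::finite) \<times> nat \<Rightarrow> (real^'d) \<times> (real^'d)"
  assumes h: "h > 0" and U: "\<And>l. l < L \<Longrightarrow> fst (\<omega> (i, l)) \<in> cube h i"
    and step: "\<And>u \<xi>. norm (trunc_step \<Delta> b \<sigma> r u \<xi> - u) \<le> \<kappa> * h / 2" and \<kappa>: "\<kappa> \<le> 1"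
    and E: "E \<ge> 1" "\<And>j z. j \<in> multi_idx Q \<Longrightarrow> norm z \<le> real CARD('d) + 1 \<Longrightarrow> \<bar>ref_basis j (z :: real^'d)\<bar> \<le> E"
    and uc: "\<And>j z z'. j \<in> multi_idx Q \<Longrightarrow> norm z \<le> real CARD('d) + 1 \<Longrightarrow> norm z' \<le> real CARD('d) + 1 \<Longrightarrow>
       norm (z - z') \<le> \<kappa> \<Longrightarrow> \<bar>ref_basis j z - ref_basis j (z' :: real^'d)\<bar> \<le> \<epsilon>" and \<epsilon>: "\<epsilon> \<ge> 0"
    and W: "\<And>w. w \<in> W \<Longrightarrow> (\<Sum>j\<in>multi_idx Q. (w j)\<^sup>2) = 1"
      "\<And>v. (\<Sum>j\<in>multi_idx Q. (v j)\<^sup>2) = 1 \<Longrightarrow> \<exists>w\<in>W. \<forall>j\<in>multi_idx Q. \<bar>v j - w j\<bar> \<le> \<epsilon>"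
    and slack: "4 * (real (card (multi_idx Q :: ('d \<Rightarrow> nat) set)))\<^sup>2 * E\<^sup>2 * \<epsilon> \<le> 1 - \<delta> - \<tau>" and \<tau>: "\<tau> \<ge> 0"
    and good: "\<not> net_bad Q h \<delta> W L i \<omega>"
  shows "\<tau> * real L \<le> (smallest_sv L (multi_idx Q) (design_matrix h \<Delta> b \<sigma> r \<omega> i))\<^sup>2"
proof -
  let ?J = "multi_idx Q :: ('d \<Rightarrow> nat) set"
  let ?X = "sample_point \<Delta> b \<sigma> r \<omega> i"
  let ?U = "\<lambda>l. fst (\<omega> (i, l))"
  have "\<tau> * real L * (\<Sum>j\<in>?J. (v j)\<^sup>2) \<le> quad_form L ?J (\<lambda>l j. eta h i j (?X l)) v" for v
  proof (rule quad_form_lower_from_net[where AU = "\<lambda>l j. eta h i j (?U l)" and E = E and \<epsilon> = \<epsilon> and W = W and \<delta> = \<delta>])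
    fix l j assume l: "l < L" and j: "j \<in> ?J"
    note cu = cube_center_dist[OF h U[OF l]]
    show "\<bar>eta h i j (?U l)\<bar> \<le> E"
      unfolding eta_ref_basis using cu by (intro E j) linarith
    note nb = cube_neighbour_dist[OF h U[OF l] step \<kappa>]
    show "\<bar>eta h i j (?X l) - eta h i j (?U l)\<bar> \<le> \<epsilon>"
      unfolding eta_ref_basis
    proof (rule uc[OF j nb(2)])
      show "norm ((2 / h) *\<^sub>R (?U l - center h i)) \<le> real CARD('d) + 1" using cu by linarith
      show "norm ((2 / h) *\<^sub>R (?X l - center h i) - (2 / h) *\<^sub>R (?U l - center h i)) \<le> \<kappa>"
        using nb(1) by (simp flip: scaleR_diff_right)
    qed
  next
    fix w assume "w \<in> W"
    then show "(1 - \<delta>) * real L \<le> (\<Sum>l<L. (\<Sum>j\<in>?J. w j * eta h i j (?U l))\<^sup>2)"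
      using good by (force simp: net_bad_def not_le)
  qed (use E \<epsilon> W slack in auto)
  moreover have "?J \<noteq> {}" using zero_in_multi_idx by blast
  ultimately show ?thesis
    using \<tau> by (subst smallest_sv_le_iff) auto
qed

lemma integrable_eta_hermite:
  fixes x :: "real^'d::finite"
  assumes h: "h > 0" and r: "r \<ge> 0" and bd: "\<And>\<xi>. \<bar>eta h i j (trunc_step \<Delta> b \<sigma> r x \<xi>)\<bar> \<le> E"
  shows "integrable std_normal_vec (\<lambda>\<xi>. eta h i j (trunc_step \<Delta> b \<sigma> r x \<xi>) * hermite_multi \<Delta> \<iota> (trunc_vec r \<xi>))"
proof -
  let ?H = "hermite_const \<iota>" and ?p = "\<Delta> powr (- real (l1 \<iota>) / 2)"
  have E: "E \<ge> 0" using bd[of 0] by linarith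
  show ?thesis
    unfolding hermite_multi_eq
  proof (rule integrable_gauss_dominated)
    show "(\<lambda>\<xi>. eta h i j (trunc_step \<Delta> b \<sigma> r x \<xi>) * (?p * hermite_prod \<iota> (trunc_vec r \<xi>))) \<in> borel_measurable borel"
      using h by (intro borel_measurable_continuous_onI continuous_intros continuous_on_trunc_vec) auto
    fix \<xi> :: "real^'d"
    let ?h = "hermite_prod \<iota> (trunc_vec r \<xi>)" and ?e = "eta h i j (trunc_step \<Delta> b \<sigma> r x \<xi>)"
    have "\<bar>?h\<bar> \<le> ?H * exp ((norm \<xi>)\<^sup>2 / 12)"
      using abs_trunc_vec_nth_le(1)[OF r] by (intro abs_hermite_prod_le) auto
    also have "\<dots> \<le> ?H * gauss_weight \<xi>"
      using hermite_const_pos[of \<iota>] by (intro mult_left_mono exp_norm_le_weight) auto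
    finally have le: "?p * \<bar>?h\<bar> \<le> ?p * (?H * gauss_weight \<xi>)"
      by (intro mult_left_mono) auto
    have "\<bar>?e * (?p * ?h)\<bar> = \<bar>?e\<bar> * (?p * \<bar>?h\<bar>)"
      by (simp add: abs_mult)
    also have "\<dots> \<le> E * (?p * (?H * gauss_weight \<xi>))"
      by (intro mult_mono bd le E mult_nonneg_nonneg) auto
    finally show "\<bar>?e * (?p * ?h)\<bar> \<le> (E * ?p * ?H) * gauss_weight \<xi>"
      by (simp only: mult.assoc)
  qed
qed

text \<open>Let e be the Taylor remainder. It bounds the residual of the Taylor coefficients at all
  sample points, so the fitted coefficients are within e / sqrt \<tau> of them. As each basis
  function is at most E, the fitted polynomial is within e (1 + card J E / sqrt \<tau>) of y at
  every truncated step from x, and the truncation estimate then passes to the Hermite-weighted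
  expectation.\<close>

lemma estimator_error_on_cube:
  fixes \<iota> :: "'d::finite \<Rightarrow> nat" and y :: "real^'d \<Rightarrow> real" and Q :: nat
    and \<omega> :: "(int^'d) \<times> nat \<Rightarrow> (real^'d) \<times> (real^'d)"
  defines "J \<equiv> multi_idx Q :: ('d \<Rightarrow> nat) set"
  assumes Cb: "Cb (Suc Q) y" and M: "\<And>is x. length is \<le> Suc Q \<Longrightarrow> \<bar>pdiff y is x\<bar> \<le> M"
    and h: "h > 0" and r: "r \<ge> 0" and \<tau>: "\<tau> > 0" and L: "L > 0"
    and U: "\<And>l. l < L \<Longrightarrow> fst (\<omega> (i, l)) \<in> cube h i" and x: "x \<in> cube h i"
    and step: "\<And>u \<xi>. norm (trunc_step \<Delta> b \<sigma> r u \<xi> - u) \<le> h / 2"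
    and E: "\<And>j z. j \<in> J \<Longrightarrow> norm z \<le> real CARD('d) + 1 \<Longrightarrow> \<bar>ref_basis j (z :: real^'d)\<bar> \<le> E"
    and sv: "\<tau> * real L \<le> (smallest_sv L J (design_matrix h \<Delta> b \<sigma> r \<omega> i))\<^sup>2"
  shows "\<bar>cond_target y \<Delta> \<iota> b \<sigma> x - (\<Sum>j\<in>J. fitted_coeffs y Q L h \<Delta> b \<sigma> r \<omega> i j * basis_mean h \<Delta> \<iota> b \<sigma> r x i j)\<bar>
    \<le> \<Delta> powr (- real (l1 \<iota>) / 2) * (hermite_const \<iota> * gauss_const TYPE('d) * (2 * M * exp (- (r\<^sup>2) / 6)
       + M * (real CARD('d) * ((real CARD('d) + 1) * h)) ^ Suc Q * (1 + real (card J) * E / sqrt \<tau>)))"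
proof -
  let ?D = "real CARD('d)"
  let ?X = "sample_point \<Delta> b \<sigma> r \<omega> i" and ?S = "trunc_step \<Delta> b \<sigma> r x"
  let ?A = "design_matrix h \<Delta> b \<sigma> r \<omega> i"
  have fJ: "finite J" and zJ: "(\<lambda>_. 0) \<in> J" by (simp_all add: J_def)
  have M0: "M \<ge> 0" using M[of "[]" 0] by simp
  have E0: "E \<ge> 0" using E[of "\<lambda>_. 0" 0] zJ by simp
  define e where "e = M * (?D * ((?D + 1) * h)) ^ Suc Q"
  have e: "e \<ge> 0" using M0 h by (simp add: e_def)
  obtain \<beta> where \<beta>: "\<And>p. taylor_poly (Suc Q) y (center h i) (p - center h i) = (\<Sum>j\<in>J. \<beta> j * eta h i j p)"
    using taylor_poly_eta_span[of h Q y i] h by (auto simp: J_def)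
  have near: "\<bar>eta h i j p\<bar> \<le> E" "\<bar>y p - (\<Sum>j\<in>J. \<beta> j * eta h i j p)\<bar> \<le> e"
    if "u \<in> cube h i" "norm (p - u) \<le> h / 2" "j \<in> J" for u p j
  proof -
    note nb = cube_neighbour_dist[OF h that(1), of p 1]
    show "\<bar>eta h i j p\<bar> \<le> E"
      unfolding eta_ref_basis using nb(2) that by (intro E) auto
    have "\<bar>y (center h i + (p - center h i)) - taylor_poly (Suc Q) y (center h i) (p - center h i)\<bar>
        \<le> M * (?D * norm (p - center h i)) ^ Suc Q"
      using M by (intro taylor_poly_error[OF Cb]) auto
    also have "\<dots> \<le> e"
      unfolding e_def using nb(3) that(2) M0 by (intro mult_left_mono power_mono) auto
    finally show "\<bar>y p - (\<Sum>j\<in>J. \<beta> j * eta h i j p)\<bar> \<le> e" by (simp add: \<beta>)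
  qed
  let ?\<alpha> = "fitted_coeffs y Q L h \<Delta> b \<sigma> r \<omega> i"
  have Jne: "J \<noteq> {}" using zJ by blast
  have q: "\<tau> * real L * (\<Sum>j\<in>J. (v j)\<^sup>2) \<le> quad_form L J ?A v" for v
    using sv smallest_sv_le_iff[OF fJ Jne, of "\<tau> * real L" L ?A] \<tau> by auto
  have coef: "\<bar>?\<alpha> j - \<beta> j\<bar> \<le> e / sqrt \<tau>" if "j \<in> J" for j
  unfolding J_def[symmetric]
  proof (rule pinv_apply_coefficient_error[OF fJ that \<tau> L q _ e])
    fix l assume l: "l < L"
    have "\<bar>y (?X l) - (\<Sum>j\<in>J. \<beta> j * eta h i j (?X l))\<bar> \<le> e"
      using U l step that by (intro near(2)[of "fst (\<omega> (i, l))"]) auto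
    then show "\<bar>y (?X l) - (\<Sum>j\<in>J. ?A l j * \<beta> j)\<bar> \<le> e" by (simp add: mult.commute)
  qed
  define P where "P p = (\<Sum>j\<in>J. ?\<alpha> j * eta h i j p)" for p
  have Pe: "\<bar>y p - P p\<bar> \<le> e * (1 + real (card J) * E / sqrt \<tau>)" if p: "norm (p - x) \<le> h / 2" for p
  proof -
    note np = near[OF x p]
    have "\<bar>\<Sum>j\<in>J. (\<beta> j - ?\<alpha> j) * eta h i j p\<bar> \<le> (\<Sum>j\<in>J. e / sqrt \<tau> * E)"
    proof (rule order_trans[OF sum_abs sum_mono])
      fix j assume j: "j \<in> J"
      show "\<bar>(\<beta> j - ?\<alpha> j) * eta h i j p\<bar> \<le> e / sqrt \<tau> * E"
        unfolding abs_mult using coef[OF j] np(1)[OF j] e \<tau>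
        by (intro mult_mono) (auto simp: abs_minus_commute)
    qed
    moreover have "(\<Sum>j\<in>J. (\<beta> j - ?\<alpha> j) * eta h i j p) = (\<Sum>j\<in>J. \<beta> j * eta h i j p) - P p"
      by (simp add: P_def sum_subtractf left_diff_distrib)
    ultimately have "\<bar>y p - P p\<bar> \<le> e + (\<Sum>j\<in>J. e / sqrt \<tau> * E)"
      using np(2)[OF zJ] by linarith
    then show ?thesis by (simp add: algebra_simps)
  qed
  have int: "integrable std_normal_vec (\<lambda>\<xi>. eta h i j (?S \<xi>) * hermite_multi \<Delta> \<iota> (trunc_vec r \<xi>))" if "j \<in> J" for j
    using step that by (intro integrable_eta_hermite[OF h r, of _ _ _ _ _ _ E] near(1)[OF x]) auto
  have yc: "continuous_on UNIV y" using Cb_continuous[OF Cb, of "[]"] by simp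
  have Pc: "continuous_on UNIV P" unfolding P_def using h by (intro continuous_intros) auto
  have "(\<integral>\<xi>. P (?S \<xi>) * hermite_multi \<Delta> \<iota> (trunc_vec r \<xi>) \<partial>std_normal_vec)
      = (\<integral>\<xi>. (\<Sum>j\<in>J. ?\<alpha> j * (eta h i j (?S \<xi>) * hermite_multi \<Delta> \<iota> (trunc_vec r \<xi>))) \<partial>std_normal_vec)"
    by (simp add: P_def sum_distrib_right mult.assoc)
  also have "\<dots> = (\<Sum>j\<in>J. ?\<alpha> j * basis_mean h \<Delta> \<iota> b \<sigma> r x i j)"
    using int by (subst Bochner_Integration.integral_sum) auto
  finally have Pint: "(\<Sum>j\<in>J. ?\<alpha> j * basis_mean h \<Delta> \<iota> b \<sigma> r x i j)
      = (\<integral>\<xi>. P (?S \<xi>) * hermite_multi \<Delta> \<iota> (trunc_vec r \<xi>) \<partial>std_normal_vec)" ..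
  show ?thesis
    unfolding Pint e_def[symmetric]
  proof (rule cond_target_truncation_error[OF yc Pc _ r])
    show "\<bar>y p\<bar> \<le> M" for p using M[of "[]" p] by simp
    show "\<bar>y (?S \<xi>) - P (?S \<xi>)\<bar> \<le> e * (1 + real (card J) * E / sqrt \<tau>)" for \<xi>
      using step by (intro Pe) auto
  qed
qed

lemma alg1_zhat_outside:
  assumes "\<And>i. i \<in> alg1_I (alg1_h c_cube \<gamma> \<Delta>) (alg1_r1 CARD('d) C2f c1t \<gamma>1t \<Delta>) \<Longrightarrow> x \<notin> cube (alg1_h c_cube \<gamma> \<Delta>) (i :: int^'d::finite)"
  shows "alg1_zhat y L Q \<Delta> \<iota> \<tau> \<gamma> c_cube c1t c2t \<gamma>1t \<gamma>2t C2f b \<sigma> \<omega> x = 0"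
  using assms by (simp add: alg1_zhat_def Let_def)

lemma alg1_zhat_on_cube:
  fixes i :: "int^'d::finite" and \<omega> :: "(int^'d) \<times> nat \<Rightarrow> (real^'d) \<times> (real^'d)"
    and c_cube \<gamma> \<Delta> c2t \<gamma>2t :: real
  defines "h \<equiv> alg1_h c_cube \<gamma> \<Delta>" and "r \<equiv> alg1_r2 c2t \<gamma>2t \<Delta>"
  assumes h: "h > 0" and i: "i \<in> alg1_I h (alg1_r1 CARD('d) C2f c1t \<gamma>1t \<Delta>)" and x: "x \<in> cube h i"
  shows "alg1_zhat y L Q \<Delta> \<iota> \<tau> \<gamma> c_cube c1t c2t \<gamma>1t \<gamma>2t C2f b \<sigma> \<omega> x =
    (if \<tau> * real L \<le> (smallest_sv L (multi_idx Q) (design_matrix h \<Delta> b \<sigma> r \<omega> i))\<^sup>2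
     then \<Sum>j\<in>multi_idx Q. fitted_coeffs y Q L h \<Delta> b \<sigma> r \<omega> i j * basis_mean h \<Delta> \<iota> b \<sigma> r x i j else 0)"
proof -
  let ?I = "alg1_I h (alg1_r1 CARD('d) C2f c1t \<gamma>1t \<Delta>) :: (int^'d) set"
  have pick: "(\<Sum>k\<in>?I. indicator (cube h k) x * F k) = F i" for F :: "int^'d \<Rightarrow> real"
  proof -
    have "(\<Sum>k\<in>?I. indicator (cube h k) x * F k) = (\<Sum>k\<in>?I. if k = i then F i else 0)"
    proof (intro sum.cong refl)
      fix k
      show "indicator (cube h k) x * F k = (if k = i then F i else 0)"
      proof (cases "k = i")
        case False
        then have "x \<notin> cube h k" using cube_disjoint[OF h x] by blast
        then show ?thesis using False by simp
      qed (use x in simp)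
    qed
    also have "\<dots> = F i" using i by (simp add: finite_alg1_I[OF h])
    finally show ?thesis .
  qed
  show ?thesis
    unfolding alg1_zhat_def Let_def h_def[symmetric] r_def[symmetric] euler_step_def[of \<Delta> b \<sigma>, symmetric] pick
    by simp
qed

section \<open>Mean square error\<close>

text \<open>The failure event of cube i matters only for x in that cube, so its probability is
  weighted by the mass of the cube. The cubes are disjoint, these masses add up to at most 1, and
  their number does not enter. The integrals of \<open>err\<close> are bounded by monotonicity
  alone, which suits an integrand of unknown measurability in \<omega>.\<close>

lemma mean_square_error_from_pointwise:
  fixes err :: "((int^'d::finite) \<times> nat \<Rightarrow> (real^'d) \<times> (real^'d)) \<Rightarrow> real^'d \<Rightarrow> real"
  assumes h: "h > 0" and I: "finite I" and \<mu>: "prob_space \<mu>" "sets \<mu> = sets borel"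
    and nn: "a \<ge> 0" "c \<ge> 0" "p \<ge> 0" "t \<ge> 0"
    and pw: "\<And>\<omega> x. \<omega> \<in> space (alg1_samples I h L) \<Longrightarrow> (\<And>i l. i \<in> I \<Longrightarrow> l < L \<Longrightarrow> fst (\<omega> (i, l)) \<in> cube h i) \<Longrightarrow>
       (err \<omega> x)\<^sup>2 \<le> a + c * (\<Sum>i\<in>I. indicator (Bd i) \<omega> * indicator (cube h i) x) + c * indicator {x. norm x > r1} x"
    and Bd: "\<And>i. i \<in> I \<Longrightarrow> Bd i \<in> sets (alg1_samples I h L)"
      "\<And>i. i \<in> I \<Longrightarrow> emeasure (alg1_samples I h L) (Bd i) \<le> ennreal p"
    and tail: "emeasure \<mu> {x. norm x > r1} \<le> ennreal t"
  shows "(\<integral>\<^sup>+\<omega>. \<integral>\<^sup>+x. ennreal ((err \<omega> x)\<^sup>2) \<partial>\<mu> \<partial>alg1_samples I h L) \<le> ennreal (a + c * p + c * t)"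
proof -
  interpret \<mu>: prob_space \<mu> by fact
  let ?P = "alg1_samples I h L" and ?T = "{x :: real^'d. norm x > r1}"
  let ?m = "\<lambda>\<omega>. ennreal a + ennreal c * (\<Sum>i\<in>I. indicator (Bd i) \<omega> * emeasure \<mu> (cube h i)) + ennreal c * emeasure \<mu> ?T"
  define M where "M = (\<lambda>(i :: int^'d, l :: nat). sample_law h i)"
  have P: "?P = PiM (I \<times> {..<L}) M" by (simp add: alg1_samples_def M_def)
  have prM: "prob_space (M q)" for q
    using prob_space_sample_law[OF h] by (auto simp: M_def split: prod.split)
  interpret P: prob_space ?P unfolding P by (intro prob_space_PiM prM)
  have mc: "cube h i \<in> sets \<mu>" "?T \<in> sets \<mu>" for i unfolding \<mu>(2) by measurable
  \<comment> \<open>The uniform points lie in their cubes only almost surely; the pointwise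
    hypothesis is invoked on this event of full measure.\<close>
  have "AE \<omega> in ?P. \<forall>q\<in>I \<times> {..<L}. fst (\<omega> q) \<in> cube h (fst q)"
  proof (rule AE_finite_allI)
    fix q assume q: "q \<in> I \<times> {..<L}"
    have "M q = sample_law h (fst q)" by (simp add: M_def case_prod_beta)
    then have "AE p in M q. fst p \<in> cube h (fst q)"
      using AE_sample_law_cube[OF h, of "fst q"] by metis
    then show "AE \<omega> in ?P. fst (\<omega> q) \<in> cube h (fst q)"
      unfolding P by (rule AE_PiM_component[OF prM q])
  qed (use I in simp)
  then have ae: "AE \<omega> in ?P. (\<integral>\<^sup>+x. ennreal ((err \<omega> x)\<^sup>2) \<partial>\<mu>)
      \<le> ?m \<omega>"
    using AE_space
  proof eventually_elim
    case (elim \<omega>)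
    have "ennreal ((err \<omega> x)\<^sup>2) \<le> ennreal a + ennreal c * (\<Sum>i\<in>I. indicator (Bd i) \<omega> * indicator (cube h i) x)
        + ennreal c * indicator ?T x" for x
    proof -
      let ?s = "\<Sum>i\<in>I. indicator (Bd i) \<omega> * indicator (cube h i) x :: real"
      have "ennreal ((err \<omega> x)\<^sup>2) \<le> ennreal (a + c * ?s + c * indicator ?T x)"
        using elim by (intro ennreal_leI pw) auto
      also have "\<dots> = ennreal a + ennreal c * ennreal ?s + ennreal c * ennreal (indicator ?T x)"
        using nn by (simp add: ennreal_plus ennreal_mult sum_nonneg)
      also have "ennreal ?s = (\<Sum>i\<in>I. indicator (Bd i) \<omega> * indicator (cube h i) x)"
        by (subst sum_ennreal[symmetric]) (auto simp: ennreal_mult ennreal_indicator)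
      finally show ?thesis by (simp add: ennreal_indicator)
    qed
    then have "(\<integral>\<^sup>+x. ennreal ((err \<omega> x)\<^sup>2) \<partial>\<mu>) \<le> (\<integral>\<^sup>+x. ennreal a + ennreal c * (\<Sum>i\<in>I. indicator (Bd i) \<omega> * indicator (cube h i) x)
        + ennreal c * indicator ?T x \<partial>\<mu>)"
      by (intro nn_integral_mono)
    also have "\<dots> = ?m \<omega>"
      using mc by (simp add: nn_integral_add nn_integral_cmult nn_integral_sum nn_integral_cmult_indicator \<mu>.emeasure_space_1)
    finally show ?case .
  qed
  have "(\<integral>\<^sup>+\<omega>. \<integral>\<^sup>+x. ennreal ((err \<omega> x)\<^sup>2) \<partial>\<mu> \<partial>?P)
      \<le> (\<integral>\<^sup>+\<omega>. ?m \<omega> \<partial>?P)"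
    by (rule nn_integral_mono_AE[OF ae])
  also have "\<dots> = ennreal a + ennreal c * (\<Sum>i\<in>I. emeasure ?P (Bd i) * emeasure \<mu> (cube h i)) + ennreal c * emeasure \<mu> ?T"
    using Bd(1) by (simp add: nn_integral_add nn_integral_cmult nn_integral_sum nn_integral_multc P.emeasure_space_1)
  also have "\<dots> \<le> ennreal a + ennreal c * (ennreal p * 1) + ennreal c * ennreal t"
  proof (intro add_mono mult_left_mono order_refl tail)
    have "(\<Sum>i\<in>I. emeasure ?P (Bd i) * emeasure \<mu> (cube h i)) \<le> (\<Sum>i\<in>I. ennreal p * emeasure \<mu> (cube h i))"
      using Bd(2) by (intro sum_mono mult_right_mono) auto
    also have "\<dots> = ennreal p * emeasure \<mu> (\<Union>i\<in>I. cube h i)"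
      using I mc cube_disjoint[OF h]
      by (simp add: sum_distrib_left[symmetric]) (subst sum_emeasure, auto simp: disjoint_family_on_def)
    also have "\<dots> \<le> ennreal p * 1"
      by (intro mult_left_mono \<mu>.emeasure_le_1) auto
    finally show "(\<Sum>i\<in>I. emeasure ?P (Bd i) * emeasure \<mu> (cube h i)) \<le> ennreal p * 1" .
  qed auto
  also have "\<dots> = ennreal (a + c * p + c * t)"
    using nn by (simp add: ennreal_mult ennreal_plus)
  finally show ?thesis .
qed

section \<open>Rates as \<Delta> tends to 0\<close>

text \<open>With X the argument of the logarithm in r2, the left side is X to the power -1/3. This
  explains the factor 1.5: a third of \<gamma> is m / 2. X \<ge> 1 keeps the radicand nonnegative,
  so that squaring undoes the root, and dropping the factor ln (1 / \<Delta>) \<ge> 1 from X only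
  enlarges the bound.\<close>

lemma exp_trunc_radius_le:
  assumes D: "0 < \<Delta>" and c: "c > 0" and g: "\<gamma> = 1.5 * real m"
    and l: "1 \<le> ln (1 / \<Delta>)" and X: "1 \<le> c * \<Delta> powr (- \<gamma>) * ln (1 / \<Delta>)"
  shows "exp (- ((alg1_r2 c \<gamma> \<Delta>)\<^sup>2) / 6) \<le> c powr (-1/3) * \<Delta> powr (real m / 2)"
proof -
  let ?X = "c * \<Delta> powr (- \<gamma>) * ln (1 / \<Delta>)"
  have "(alg1_r2 c \<gamma> \<Delta>)\<^sup>2 = 2 * ln ?X"
    using X by (simp add: alg1_r2_def)
  then have "exp (- ((alg1_r2 c \<gamma> \<Delta>)\<^sup>2) / 6) = ?X powr (-1/3)"
  proof -
    have "exp (- (2 * ln x) / 6) = x powr (-1/3)" if "x \<ge> 1" for x :: real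
      using that by (simp add: powr_def)
    with X show ?thesis by (simp only: \<open>(alg1_r2 c \<gamma> \<Delta>)\<^sup>2 = 2 * ln ?X\<close>)
  qed
  also have "\<dots> \<le> (c * \<Delta> powr (- \<gamma>)) powr (-1/3)"
    using c D l mult_left_mono[of 1 "ln (1 / \<Delta>)" "c * \<Delta> powr (- \<gamma>)"] by (intro powr_mono2') auto
  also have "\<dots> = c powr (-1/3) * \<Delta> powr (real m / 2)"
    using c D by (simp add: powr_mult powr_powr g)
  finally show ?thesis .
qed

text \<open>The squared deviation is cs / c1p, so the factor c1p in L cancels, and 2 B \<le> cs
  leaves at least \<rho> ln (c2p / \<Delta>) in the exponent.\<close>

lemma net_failure_rate:
  fixes c1p cs \<rho> B :: real
  assumes "0 < \<Delta>" "0 < c2p" "0 < c1p" "0 \<le> \<rho>" "0 < B" "2 * B \<le> cs" "0 \<le> ln (c2p / \<Delta>)"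
    and L: "\<rho> * c1p * ln (c2p / \<Delta>) \<le> L"
  shows "exp (- (L * (sqrt (cs / c1p))\<^sup>2 / (2 * B))) \<le> c2p powr (- \<rho>) * \<Delta> powr \<rho>"
proof -
  have "\<rho> * ln (c2p / \<Delta>) * (2 * B) \<le> \<rho> * ln (c2p / \<Delta>) * cs"
    using assms by (intro mult_left_mono) auto
  also have "\<dots> = (\<rho> * c1p * ln (c2p / \<Delta>)) * (cs / c1p)" using assms by simp
  also have "\<dots> \<le> L * (cs / c1p)" using assms by (intro mult_right_mono L) auto
  also have "cs / c1p = (sqrt (cs / c1p))\<^sup>2" using assms by simp
  finally have "\<rho> * ln (c2p / \<Delta>) \<le> L * (sqrt (cs / c1p))\<^sup>2 / (2 * B)"
    using assms(5) by (subst pos_le_divide_eq) auto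
  then have "exp (- (L * (sqrt (cs / c1p))\<^sup>2 / (2 * B))) \<le> exp (- (\<rho> * ln (c2p / \<Delta>)))"
    by simp
  also have "\<dots> = c2p powr (- \<rho>) * \<Delta> powr \<rho>"
    using assms(1,2) by (simp add: powr_def ln_div algebra_simps flip: exp_add)
  finally show ?thesis .
qed

text \<open>The cube width is proportional to x powr g. Since g < 1/2, the square root of x beats it
  even after multiplication by the logarithmic radius r2. Halving the neighbourhood found gives a
  range closed on the right.\<close>

lemma small_step_eventually:
  fixes g g2 c s d c1 c2 \<rho> :: real
  assumes "g < 1/2" "g2 > 0" "c > 0" "s > 0" "c1 > 0" "c2 > 0" "\<rho> > 0"
  shows "\<exists>x0>0. \<forall>x. 0 < x \<and> x \<le> x0 \<longrightarrow> x / x powr g \<le> s \<and> sqrt x * alg1_r2 c g2 x / x powr g \<le> s \<and>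
     1 \<le> c * x powr (- g2) * ln (1 / x) \<and> c1 * x powr \<rho> < 1 \<and> 0 < ln (c2 / x) \<and> 1 \<le> ln (1 / x)"
proof -
  have 1: "((\<lambda>x. x / x powr g) \<longlongrightarrow> 0) (at_right 0)"
    using assms by real_asymp
  have 2: "((\<lambda>x. sqrt x * sqrt (2 * ln (c * x powr (- g2) * ln (1 / x))) / x powr g) \<longlongrightarrow> 0) (at_right 0)"
    using assms by real_asymp
  have 3: "eventually (\<lambda>x. 1 \<le> c * x powr (- g2) * ln (1 / x)) (at_right 0)"
    using assms by real_asymp
  have 4: "eventually (\<lambda>x. c1 * x powr \<rho> < 1) (at_right 0)"
    using assms by real_asymp
  have 5: "eventually (\<lambda>x. 0 < ln (c2 / x)) (at_right 0)"
    using assms by real_asymp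
  have 6: "eventually (\<lambda>x::real. 1 < ln (1 / x)) (at_right 0)"
    by real_asymp
  have "eventually (\<lambda>x. x / x powr g \<le> s \<and> sqrt x * alg1_r2 c g2 x / x powr g \<le> s \<and>
     1 \<le> c * x powr (- g2) * ln (1 / x) \<and> c1 * x powr \<rho> < 1 \<and> 0 < ln (c2 / x) \<and> 1 \<le> ln (1 / x)) (at_right 0)"
    using order_tendstoD(2)[OF 1 assms(4)] order_tendstoD(2)[OF 2 assms(4)] 3 4 5 6
    by eventually_elim (auto simp: alg1_r2_def)
  then obtain x1 where "x1 > 0" "\<forall>x. 0 < x \<and> x < x1 \<longrightarrow> x / x powr g \<le> s \<and> sqrt x * alg1_r2 c g2 x / x powr g \<le> s \<and>
     1 \<le> c * x powr (- g2) * ln (1 / x) \<and> c1 * x powr \<rho> < 1 \<and> 0 < ln (c2 / x) \<and> 1 \<le> ln (1 / x)"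
    unfolding eventually_at_right_field by blast
  then show ?thesis by (intro exI[of _ "x1 / 2"]) auto
qed

section \<open>Choice of constants and assembly of the bound\<close>

theorem theorem3p1:
  fixes \<rho> Q :: nat and \<iota> :: "'d::finite \<Rightarrow> nat"
    and c_cube c1t c2t c1p c2p \<tau> C1f C2f Cb\<sigma> M :: real
  assumes "\<rho> \<ge> 1" and "Q \<ge> 1" and "Q \<ge> l1 \<iota> + \<rho>"
    and "c_cube > 0" and "c1t > 0" and "c2t > 0"
    and "c2p > 0" and "c1p > cstar_paths TYPE('d) Q"
    and "\<tau> > 0" and "\<tau> < 1 - sqrt (cstar_paths TYPE('d) Q / c1p)"
    and "C1f > 0" and "C2f > 0"
  shows "\<exists>C>0. \<exists>\<Delta>0>0. \<forall>(f :: real^'d \<Rightarrow> real) b \<sigma> (y :: real^'d \<Rightarrow> real) \<Delta>.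
     f \<in> borel_measurable borel \<and> (\<forall>x. 0 \<le> f x) \<and> prob_space (density lborel (\<lambda>x. ennreal (f x))) \<and>
     (\<forall>x. f x \<le> C1f / (2 * pi * C2f) powr (real CARD('d) / 2) * exp (- (norm x)\<^sup>2 / (2 * C2f))) \<and>
     b \<in> borel_measurable borel \<and> \<sigma> \<in> borel_measurable borel \<and>
     (\<forall>u. norm (b u) + onorm (\<lambda>v. \<sigma> u *v v) \<le> Cb\<sigma>) \<and>
     Cb (Q + 1) y \<and> Cb_norm (Q + 1) y \<le> M \<and>
     0 < \<Delta> \<and> \<Delta> \<le> \<Delta>0
     \<longrightarrow>
     (let L = nat \<lceil>real \<rho> * c1p * ln (c2p / \<Delta>)\<rceil>;
          \<gamma>_cube = real (\<rho> + l1 \<iota>) / (2 * real (Q + 1));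
          \<gamma>1t = real \<rho>;
          \<gamma>2t = 1.5 * real (l1 \<iota> + \<rho>);
          h = alg1_h c_cube \<gamma>_cube \<Delta>;
          I = (alg1_I h (alg1_r1 CARD('d) C2f c1t \<gamma>1t \<Delta>) :: (int^'d) set)
      in (\<integral>\<^sup>+\<omega>. (\<integral>\<^sup>+x. ennreal ((cond_target y \<Delta> \<iota> b \<sigma> x
                 - alg1_zhat y L Q \<Delta> \<iota> \<tau> \<gamma>_cube c_cube c1t c2t \<gamma>1t \<gamma>2t C2f b \<sigma> \<omega> x)\<^sup>2)
               \<partial>density lborel (\<lambda>x. ennreal (f x))) \<partial>alg1_samples I h L)
         \<le> ennreal (C * ln (1 / \<Delta>) powr (real CARD('d) / 2) * \<Delta> powr real \<rho>))"
proof -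
  let ?J = "multi_idx Q :: ('d \<Rightarrow> nat) set" and ?D = "real CARD('d)" and ?B = "basis_bound TYPE('d) Q"
    and ?n = "l1 \<iota>" and ?cs = "cstar_paths TYPE('d) Q"
  define K where "K = real (card ?J)"
  have Jne: "?J \<noteq> {}" using zero_in_multi_idx by blast
  have K: "K \<ge> 1" using Jne by (simp add: K_def Suc_le_eq card_gt_0_iff)
  have B: "?B \<ge> 1" by (rule basis_bound_ge_1)
  have cs: "2 * ?B \<le> ?cs" "?cs > 0" using B by (simp_all add: cstar_paths_eq)
  have c1p: "c1p > 0" using assms(8) cs by simp
  define \<delta> where "\<delta> = sqrt (?cs / c1p)"
  have \<delta>: "\<delta> \<ge> 0" "\<tau> < 1 - \<delta>" using cs c1p assms(10) by (auto simp: \<delta>_def)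
  obtain E where E: "E \<ge> 1" "\<forall>j\<in>?J. \<forall>z :: real^'d. norm z \<le> ?D + 1 \<longrightarrow> \<bar>ref_basis j z\<bar> \<le> E"
    using ref_basis_bounded by blast
  \<comment> \<open>The largest tolerance allowed by the slack condition of
    \<open>quad_form_lower_from_net\<close>. It serves both as net width and as permitted change of
    the basis functions under an Euler step.\<close>
  define \<epsilon> where "\<epsilon> = (1 - \<delta> - \<tau>) / (4 * K\<^sup>2 * E\<^sup>2)"
  have \<epsilon>: "\<epsilon> > 0" "4 * K\<^sup>2 * E\<^sup>2 * \<epsilon> = 1 - \<delta> - \<tau>"
    using \<delta> K E(1) by (simp_all add: \<epsilon>_def)
  obtain \<kappa> where \<kappa>: "\<kappa> > 0" "\<kappa> \<le> 1" "\<forall>j\<in>?J. \<forall>z z' :: real^'d. norm z \<le> ?D + 1 \<longrightarrow> norm z' \<le> ?D + 1 \<longrightarrow>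
     norm (z - z') \<le> \<kappa> \<longrightarrow> \<bar>ref_basis j z - ref_basis j z'\<bar> \<le> \<epsilon>"
    using ref_basis_uniformly_continuous[OF \<epsilon>(1)] by blast
  obtain W where W': "finite W \<and> (\<forall>w\<in>W. (\<Sum>j\<in>?J. (w j)\<^sup>2) = 1) \<and>
     (\<forall>v. (\<Sum>j\<in>?J. (v j)\<^sup>2) = 1 \<longrightarrow> (\<exists>w\<in>W. \<forall>j\<in>?J. \<bar>v j - w j\<bar> \<le> \<epsilon>))"
    using unit_sphere_net[OF finite_multi_idx \<epsilon>(1)] by (rule exE)
  note W = conjunct1[OF W'] conjunct1[OF conjunct2[OF W']] conjunct2[OF conjunct2[OF W']]
  obtain CT where CT': "CT > 0 \<and> (\<forall>y \<Delta> b \<sigma> (x :: real^'d) k. Cb k y \<and> ?n \<le> k \<and> (\<forall>is x. length is \<le> k \<longrightarrow> \<bar>pdiff y is x\<bar> \<le> M)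
     \<and> 0 < \<Delta> \<and> onorm (\<lambda>v. \<sigma> x *v v) \<le> Cb\<sigma> \<longrightarrow> \<bar>cond_target y \<Delta> \<iota> b \<sigma> x\<bar> \<le> CT)"
    using cond_target_bound[of \<iota> M Cb\<sigma>] by (rule exE)
  note CT = conjunct1[OF CT'] conjunct2[OF CT']
  define H where "H = hermite_const \<iota> * gauss_const TYPE('d)"
  have H: "H \<ge> 0"
    using hermite_const_pos[of \<iota>] gauss_const_nonneg[where 'd = 'd] by (simp add: H_def)
  \<comment> \<open>The truncation term and the Taylor-regression term once their common power of
    \<open>\<Delta>\<close>, with exponent \<open>(|\<iota>| + \<rho>) / 2\<close>, is taken
    out.\<close>
  define A where "A = 2 * M * c2t powr (-1/3) + M * (?D * ((?D + 1) * c_cube)) ^ Suc Q * (1 + K * E / sqrt \<tau>)"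
  \<comment> \<open>The summands belong to cubes where the test succeeds, cubes where it fails, and
    points outside all cubes; the final 1 makes \<open>C\<close> positive.\<close>
  define C where "C = (H * A)\<^sup>2 + CT\<^sup>2 * (real (card W) * c2p powr (- real \<rho>)) + CT\<^sup>2 * (C1f * c1t) + 1"
  have C: "C > 0"
    unfolding C_def using assms(5,11) by (intro add_nonneg_pos add_nonneg_nonneg) auto
  define \<gamma> where "\<gamma> = real (\<rho> + ?n) / (2 * real (Q + 1))"
  define \<gamma>2 where "\<gamma>2 = 1.5 * real (?n + \<rho>)"
  have "real (\<rho> + ?n) < real (Q + 1)" using assms(3) by simp
  then have \<gamma>: "\<gamma> < 1 / 2" by (simp add: \<gamma>_def field_simps)
  have \<gamma>2: "\<gamma>2 > 0" using assms(1) by (simp add: \<gamma>2_def)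
  \<comment> \<open>Calibrated so that drift and noise together move a point by at most
    \<open>\<kappa> h / 2\<close>. No \<open>b\<close> or \<open>\<sigma>\<close> is fixed yet, so
    the sign of \<open>Cb\<sigma>\<close> is unknown, and \<open>|Cb\<sigma>| + 1\<close> is a
    positive substitute.\<close>
  define s where "s = \<kappa> * c_cube / (2 * (\<bar>Cb\<sigma>\<bar> + 1) * (1 + ?D))"
  have s: "s > 0" using \<kappa> assms(4) by (auto simp: s_def intro!: divide_pos_pos mult_pos_pos)
  obtain \<Delta>0 where \<Delta>0: "\<Delta>0 > 0" "\<forall>x. 0 < x \<and> x \<le> \<Delta>0 \<longrightarrow> x / x powr \<gamma> \<le> s \<and> sqrt x * alg1_r2 c2t \<gamma>2 x / x powr \<gamma> \<le> s \<and>
   1 \<le> c2t * x powr (- \<gamma>2) * ln (1 / x) \<and> c1t * x powr real \<rho> < 1 \<and> 0 < ln (c2p / x) \<and> 1 \<le> ln (1 / x)"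
    using small_step_eventually[OF \<gamma> \<gamma>2 assms(6) s assms(5,7), of "real \<rho>"] assms(1) by auto
  show ?thesis
  proof (rule exI[of _ C], rule conjI[OF C], rule exI[of _ \<Delta>0], rule conjI[OF \<Delta>0(1)],
      intro allI impI, elim conjE)
    fix f :: "real^'d \<Rightarrow> real" and b :: "real^'d \<Rightarrow> real^'d" and \<sigma> :: "real^'d \<Rightarrow> real^'d^'d" and y :: "real^'d \<Rightarrow> real" and \<Delta>
    assume fm: "f \<in> borel_measurable borel" and f0: "\<forall>x. 0 \<le> f x" and fp: "prob_space (density lborel (\<lambda>x. ennreal (f x)))"
      and fle: "\<forall>x. f x \<le> C1f / (2 * pi * C2f) powr (real CARD('d) / 2) * exp (- (norm x)\<^sup>2 / (2 * C2f))"
      and b\<sigma>: "\<forall>u. norm (b u) + onorm (\<lambda>v. \<sigma> u *v v) \<le> Cb\<sigma>"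
      and Cb: "Cb (Q + 1) y" and Cbn: "Cb_norm (Q + 1) y \<le> M" and D: "0 < \<Delta>" "\<Delta> \<le> \<Delta>0"
    let ?\<mu> = "density lborel (\<lambda>x. ennreal (f x))"
    define L where "L = nat \<lceil>real \<rho> * c1p * ln (c2p / \<Delta>)\<rceil>"
    define h where "h = alg1_h c_cube \<gamma> \<Delta>"
    define r1 where "r1 = alg1_r1 CARD('d) C2f c1t (real \<rho>) \<Delta>"
    define r where "r = alg1_r2 c2t \<gamma>2 \<Delta>"
    define I where "I = (alg1_I h r1 :: (int^'d) set)"
    have e1: "\<Delta> / \<Delta> powr \<gamma> \<le> s" and e2: "sqrt \<Delta> * r / \<Delta> powr \<gamma> \<le> s"
      and e3: "1 \<le> c2t * \<Delta> powr (- \<gamma>2) * ln (1 / \<Delta>)" and e4: "c1t * \<Delta> powr real \<rho> < 1"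
      and e5: "0 < ln (c2p / \<Delta>)" and e6: "1 \<le> ln (1 / \<Delta>)"
      using \<Delta>0(2) D unfolding r_def by blast+
    have h: "h > 0" "h = c_cube * \<Delta> powr \<gamma>" using D assms(4) by (simp_all add: h_def alg1_h_def)
    have r0: "r \<ge> 0" using e3 by (simp add: r_def alg1_r2_def)
    have Lge: "real \<rho> * c1p * ln (c2p / \<Delta>) \<le> real L"
      unfolding L_def by linarith
    have "0 < real \<rho> * c1p * ln (c2p / \<Delta>)" using assms(1) c1p e5 by simp
    then have L: "L > 0" using Lge by (cases "L = 0") auto
    have M: "\<forall>is x. length is \<le> Suc Q \<longrightarrow> \<bar>pdiff y is x\<bar> \<le> M"
      using Cb_norm_bound[OF Cb] Cbn by (metis Suc_eq_plus1 order_trans)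
    have on0: "0 \<le> onorm (\<lambda>v. \<sigma> u *v v)" for u by (intro onorm_pos_le matrix_vector_mul_bounded_linear)
    have bn: "norm (b u) \<le> Cb\<sigma>" and \<sigma>n: "onorm (\<lambda>v. \<sigma> u *v v) \<le> Cb\<sigma>" for u
      using b\<sigma>[rule_format, of u] on0[of u] norm_ge_zero[of "b u"] by linarith+
    have c0: "Cb\<sigma> \<ge> 0" using bn[of 0] norm_ge_zero[of "b 0"] by linarith
    have step: "norm (trunc_step \<Delta> b \<sigma> r u \<xi> - u) \<le> \<kappa> * h / 2" for u \<xi>
    proof -
      have p: "\<Delta> powr \<gamma> > 0" using D by simp
      have "norm (trunc_step \<Delta> b \<sigma> r u \<xi> - u) \<le> \<Delta> * Cb\<sigma> + sqrt \<Delta> * (Cb\<sigma> * (?D * r))"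
        using D by (intro norm_euler_step_diff bn \<sigma>n norm_trunc_vec_le r0) simp
      also have "\<dots> = Cb\<sigma> * (\<Delta> + ?D * (sqrt \<Delta> * r))" by (simp add: algebra_simps)
      also have "\<dots> \<le> Cb\<sigma> * (s * \<Delta> powr \<gamma> + ?D * (s * \<Delta> powr \<gamma>))"
        using e1 e2 p c0 by (intro mult_left_mono add_mono) (auto simp: pos_divide_le_eq)
      also have "\<dots> \<le> (\<bar>Cb\<sigma>\<bar> + 1) * (s * \<Delta> powr \<gamma> + ?D * (s * \<Delta> powr \<gamma>))"
        using s p by (intro mult_right_mono) auto
      also have "\<dots> = (\<bar>Cb\<sigma>\<bar> + 1) * (1 + ?D) * s * \<Delta> powr \<gamma>" by (simp add: algebra_simps)
      also have "(\<bar>Cb\<sigma>\<bar> + 1) * (1 + ?D) * s = \<kappa> * c_cube / 2"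
      proof -
        have "2 * (\<bar>Cb\<sigma>\<bar> + 1) * (1 + ?D) \<noteq> 0" by (simp add: add_nonneg_eq_0_iff)
        then show ?thesis by (simp add: s_def field_simps)
      qed
      finally show ?thesis by (simp add: h(2))
    qed
    have "\<kappa> * h / 2 \<le> h / 2" using \<kappa>(2) h(1) by simp
    then have step1: "norm (trunc_step \<Delta> b \<sigma> r u \<xi> - u) \<le> h / 2" for u \<xi>
      using step order_trans by blast
    have tb: "(cond_target y \<Delta> \<iota> b \<sigma> x)\<^sup>2 \<le> CT\<^sup>2" for x
    proof -
      have "\<bar>cond_target y \<Delta> \<iota> b \<sigma> x\<bar> \<le> CT"
        using Cb M D(1) \<sigma>n assms(3) by (intro CT(2)[rule_format, of "Suc Q"]) auto
      then show ?thesis using CT(1) by (simp flip: abs_le_square_iff)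
    qed
    have exp_r: "exp (- (r\<^sup>2) / 6) \<le> c2t powr (-1/3) * \<Delta> powr (real (?n + \<rho>) / 2)"
      unfolding r_def by (rule exp_trunc_radius_le[OF D(1) assms(6) \<gamma>2_def e6 e3])
    \<comment> \<open>\<open>\<gamma> (Q + 1) = (|\<iota>| + \<rho>) / 2\<close>, so the Taylor
      remainder has the same order in \<open>\<Delta>\<close> as the truncation error.\<close>
    have hQ: "h ^ Suc Q = c_cube ^ Suc Q * \<Delta> powr (real (?n + \<rho>) / 2)"
    proof -
      have "(\<Delta> powr \<gamma>) ^ Suc Q = \<Delta> powr (\<gamma> * real (Suc Q))"
        using D by (subst powr_realpow[symmetric]) (simp_all only: powr_gt_zero powr_powr)
      also have "\<gamma> * real (Suc Q) = real (?n + \<rho>) / 2" by (simp add: \<gamma>_def field_simps)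
      finally show ?thesis unfolding h(2) power_mult_distrib by simp
    qed
    have M0: "M \<ge> 0" using M[rule_format, of "[]" 0] by simp
    define G where "G = \<Delta> powr (- real ?n / 2) * (H * (2 * M * exp (- (r\<^sup>2) / 6)
        + M * (?D * ((?D + 1) * h)) ^ Suc Q * (1 + K * E / sqrt \<tau>)))"
    \<comment> \<open>The negative power \<open>- |\<iota>| / 2\<close> from the Hermite weight uses
      up the |\<iota>| part of the exponent and leaves \<open>\<rho> / 2\<close>.\<close>
    have G: "G \<le> H * A * \<Delta> powr (real \<rho> / 2)"
    proof -
      let ?d = "\<Delta> powr (real (?n + \<rho>) / 2)"
      have "G \<le> \<Delta> powr (- real ?n / 2) * (H * (2 * M * (c2t powr (-1/3) * ?d)
        + M * (?D * ((?D + 1) * h)) ^ Suc Q * (1 + K * E / sqrt \<tau>)))"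
        unfolding G_def using H M0 exp_r by (intro mult_left_mono add_right_mono) auto
      also have "(?D * ((?D + 1) * h)) ^ Suc Q = (?D * ((?D + 1) * c_cube)) ^ Suc Q * ?d"
        using hQ by (simp only: power_mult_distrib mult_ac)
      also have "\<Delta> powr (- real ?n / 2) * (H * (2 * M * (c2t powr (-1/3) * ?d)
        + M * ((?D * ((?D + 1) * c_cube)) ^ Suc Q * ?d) * (1 + K * E / sqrt \<tau>)))
        = H * A * (\<Delta> powr (- real ?n / 2) * ?d)"
        by (simp only: A_def distrib_left distrib_right mult_ac)
      also have "\<Delta> powr (- real ?n / 2) * ?d = \<Delta> powr (real \<rho> / 2)"
        by (simp add: add_divide_distrib flip: powr_add)
      finally show ?thesis .
    qed
    have A0: "A \<ge> 0" unfolding A_def using M0 K E(1) assms(4,9)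
      by (intro add_nonneg_nonneg mult_nonneg_nonneg divide_nonneg_nonneg zero_le_power) auto
    define a where "a = (H * A)\<^sup>2 * \<Delta> powr real \<rho>"
    have a0: "a \<ge> 0" by (simp add: a_def)
    define z where "z \<omega> x = alg1_zhat y L Q \<Delta> \<iota> \<tau> \<gamma> c_cube c1t c2t (real \<rho>) \<gamma>2 C2f b \<sigma> \<omega> x" for \<omega> x
    define Bd where "Bd i = {\<omega> \<in> space (alg1_samples I h L). net_bad Q h \<delta> W L i \<omega>}" for i
    let ?R = "\<lambda>\<omega> x. \<Sum>i\<in>I. indicator (Bd i) \<omega> * indicator (cube h i) x :: real"
    have pw: "(cond_target y \<Delta> \<iota> b \<sigma> x - z \<omega> x)\<^sup>2 \<le> a + CT\<^sup>2 * ?R \<omega> x + CT\<^sup>2 * indicator {x. norm x > r1} x"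
      if \<omega>: "\<omega> \<in> space (alg1_samples I h L)" and U: "\<And>i l. i \<in> I \<Longrightarrow> l < L \<Longrightarrow> fst (\<omega> (i, l)) \<in> cube h i" for \<omega> x
    proof (cases "\<exists>i\<in>I. x \<in> cube h i")
      \<comment> \<open>Outside all cubes the estimator is 0 and the error is the target itself,
        bounded by \<open>CT\<close>; such points have norm above \<open>r1\<close> and are charged
        to the tail.\<close>
      case False
      then have "norm x > r1"
        by (intro outside_cubes_norm[OF h(1)]) (auto simp: I_def)
      moreover have "z \<omega> x = 0"
        unfolding z_def by (rule alg1_zhat_outside) (use False in \<open>auto simp: I_def h_def r1_def\<close>)
      ultimately show ?thesis
        using tb[of x] a0 by (auto intro!: add_increasing sum_nonneg mult_nonneg_nonneg)
    next
      case True
      then obtain i where i: "i \<in> I" "x \<in> cube h i" by blast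
      let ?A = "design_matrix h \<Delta> b \<sigma> r \<omega> i"
      have z: "z \<omega> x = (if \<tau> * real L \<le> (smallest_sv L ?J ?A)\<^sup>2
         then \<Sum>j\<in>?J. fitted_coeffs y Q L h \<Delta> b \<sigma> r \<omega> i j * basis_mean h \<Delta> \<iota> b \<sigma> r x i j else 0)"
        unfolding z_def h_def r_def
        by (rule alg1_zhat_on_cube) (use i h(1) in \<open>simp_all add: I_def h_def r1_def\<close>)
      have nnR: "0 \<le> CT\<^sup>2 * ?R \<omega> x"
         "0 \<le> CT\<^sup>2 * indicator {x. norm x > r1} x"
        by (auto intro!: mult_nonneg_nonneg sum_nonneg)
      show ?thesis
      proof (cases "\<tau> * real L \<le> (smallest_sv L ?J ?A)\<^sup>2")
        case True
        have "\<bar>cond_target y \<Delta> \<iota> b \<sigma> x - z \<omega> x\<bar> \<le> G"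
          unfolding z if_P[OF True] G_def K_def H_def
          by (rule estimator_error_on_cube) (use Cb M h(1) r0 assms(9) L U i step1 E(2) True in auto)
        also note G
        finally have "(cond_target y \<Delta> \<iota> b \<sigma> x - z \<omega> x)\<^sup>2 \<le> (H * A * \<Delta> powr (real \<rho> / 2))\<^sup>2"
          using A0 H by (simp flip: abs_le_square_iff)
        also have "\<dots> = a"
          using D by (simp add: a_def power_mult_distrib power2_eq_square flip: powr_add)
        finally show ?thesis using nnR by linarith
      next
        case False
        \<comment> \<open>A failed test also makes the estimator 0 at \<open>x\<close>; the
          resulting \<open>CT^2\<close> is covered by the summand of cube \<open>i\<close> in the
          indicator sum.\<close>
        have "net_bad Q h \<delta> W L i \<omega>"
        proof (rule ccontr)
          assume "\<not> net_bad Q h \<delta> W L i \<omega>"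
          then have "\<tau> * real L \<le> (smallest_sv L ?J ?A)\<^sup>2"
            by (intro smallest_sv_large[where \<kappa> = \<kappa> and E = E and \<epsilon> = \<epsilon> and W = W and \<delta> = \<delta>])
               (use h(1) U i step \<kappa> E \<epsilon> W assms(9) in \<open>auto simp: K_def\<close>)
          with False show False by simp
        qed
        then have "\<omega> \<in> Bd i" using \<omega> by (simp add: Bd_def)
        then have "1 = (indicator (Bd i) \<omega> * indicator (cube h i) x :: real)" using i by simp
        also have "\<dots> \<le> ?R \<omega> x"
          using i finite_alg1_I[OF h(1)] by (intro member_le_sum) (auto simp: I_def)
        finally have "CT\<^sup>2 * 1 \<le> CT\<^sup>2 * ?R \<omega> x"
          by (intro mult_left_mono) auto
        then show ?thesis
          unfolding z if_not_P[OF False] diff_0_right using tb[of x] a0 nnR(2) by linarith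
      qed
    qed
    define p where "p = real (card W) * (c2p powr (- real \<rho>) * \<Delta> powr real \<rho>)"
    define t where "t = C1f * (c1t * \<Delta> powr real \<rho>)"
    have fin: "finite I" unfolding I_def by (rule finite_alg1_I[OF h(1)])
    have nb: "Bd i \<in> sets (alg1_samples I h L)" "emeasure (alg1_samples I h L) (Bd i) \<le> ennreal p" if "i \<in> I" for i
    proof -
      note nbp = net_bad_prob[OF h(1) fin that W(1) W(2)[rule_format] \<delta>(1), of L]
      show "Bd i \<in> sets (alg1_samples I h L)" unfolding Bd_def by (rule nbp(1))
      have "exp (- (real L * \<delta>\<^sup>2 / (2 * ?B))) \<le> c2p powr (- real \<rho>) * \<Delta> powr real \<rho>"
        unfolding \<delta>_def by (rule net_failure_rate) (use D assms(7) c1p B cs e5 Lge in auto)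
      then have "ennreal (real (card W) * exp (- (real L * \<delta>\<^sup>2 / (2 * ?B)))) \<le> ennreal p"
        unfolding p_def by (intro ennreal_leI mult_left_mono) auto
      with nbp(2) show "emeasure (alg1_samples I h L) (Bd i) \<le> ennreal p"
        unfolding Bd_def by (rule order_trans)
    qed
    have tail: "emeasure ?\<mu> {x. norm x > r1} \<le> ennreal t"
    proof -
      let ?q = "chi2_quantile CARD('d) (c1t * \<Delta> powr real \<rho>)"
      have al: "0 < c1t * \<Delta> powr real \<rho>" using assms(5) D by simp
      note q = std_normal_vec_tail_chi2_quantile[where 'd = 'd, OF al e4]
      have "emeasure ?\<mu> {x. norm x > sqrt (C2f * ?q)} \<le> ennreal (C1f * measure std_normal_vec {x :: real^'d. (norm x)\<^sup>2 > ?q})"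
        by (rule gauss_bounded_density_tail) (use fm fle assms(11,12) q(1) in auto)
      also have "\<dots> \<le> ennreal t"
        unfolding t_def using q(2) assms(11) by (intro ennreal_leI mult_left_mono) auto
      finally show ?thesis by (simp add: r1_def alg1_r1_def)
    qed
    have "(\<integral>\<^sup>+\<omega>. \<integral>\<^sup>+x. ennreal ((cond_target y \<Delta> \<iota> b \<sigma> x - z \<omega> x)\<^sup>2) \<partial>?\<mu> \<partial>alg1_samples I h L)
        \<le> ennreal (a + CT\<^sup>2 * p + CT\<^sup>2 * t)"
      by (rule mean_square_error_from_pointwise[OF h(1) fin fp _ a0 _ _ _ pw nb tail])
         (use assms(5,11) in \<open>auto simp: p_def t_def\<close>)
    also have "\<dots> \<le> ennreal (C * ln (1 / \<Delta>) powr (real CARD('d) / 2) * \<Delta> powr real \<rho>)"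
    proof (rule ennreal_leI)
      have "a + CT\<^sup>2 * p + CT\<^sup>2 * t = (C - 1) * \<Delta> powr real \<rho>"
        by (simp add: a_def p_def t_def C_def algebra_simps)
      also have "\<dots> \<le> C * 1 * \<Delta> powr real \<rho>" by (intro mult_right_mono) auto
      \<comment> \<open>\<open>ln (1 / \<Delta>)\<close> is at least 1 on the chosen range, so its
        nonnegative power is at least 1 as well.\<close>
      also have "\<dots> \<le> C * ln (1 / \<Delta>) powr (real CARD('d) / 2) * \<Delta> powr real \<rho>"
        using C e6 by (intro mult_right_mono mult_left_mono ge_one_powr_ge_zero) auto
      finally show "a + CT\<^sup>2 * p + CT\<^sup>2 * t \<le> C * ln (1 / \<Delta>) powr (real CARD('d) / 2) * \<Delta> powr real \<rho>" .
    qed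
    finally show "let L = nat \<lceil>real \<rho> * c1p * ln (c2p / \<Delta>)\<rceil>;
        \<gamma>_cube = real (\<rho> + l1 \<iota>) / (2 * real (Q + 1));
        \<gamma>1t = real \<rho>;
        \<gamma>2t = 1.5 * real (l1 \<iota> + \<rho>);
        h = alg1_h c_cube \<gamma>_cube \<Delta>;
        I = (alg1_I h (alg1_r1 CARD('d) C2f c1t \<gamma>1t \<Delta>) :: (int^'d) set)
    in (\<integral>\<^sup>+\<omega>. (\<integral>\<^sup>+x. ennreal ((cond_target y \<Delta> \<iota> b \<sigma> x
               - alg1_zhat y L Q \<Delta> \<iota> \<tau> \<gamma>_cube c_cube c1t c2t \<gamma>1t \<gamma>2t C2f b \<sigma> \<omega> x)\<^sup>2)
             \<partial>density lborel (\<lambda>x. ennreal (f x))) \<partial>alg1_samples I h L)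
       \<le> ennreal (C * ln (1 / \<Delta>) powr (real CARD('d) / 2) * \<Delta> powr real \<rho>)"
      unfolding Let_def z_def I_def r1_def h_def L_def \<gamma>_def \<gamma>2_def .
  qed
qed

end
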